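(* There is a PTAS for the linear robust optimization problem subject to a knapsack constraint: for every fixed $\epsilon>0$ there is a polynomial-time algorithm that outputs $p\in\Delta(\mathcal{I})$ with $\min_{k\in[n]}\sum_{X\in\mathcal{I}}p_Xf_k(X)\ge(1-\epsilon)\max_{p'\in\Delta(\mathcal{I})}\min_{k\in[n]}\sum_{X\in\mathcal{I}}p'_Xf_k(X)$.
   Context: $E$ is a finite set of items with sizes $s(e)\ge0$ and a capacity $C$; $\mathcal{I}=\{X\subseteq E:\sum_{e\in X}s(e)\le C\}$. The functions are linear: $f_k(X)=\sum_{e\in X}w_{ke}$ with $w_{ke}\ge0$, $k\in[n]$. $\Delta(\mathcal{I})$ is the set of probability distributions over $\mathcal{I}$. *)

theory Defs
  imports
    "HOL-Probability.Probability"
    "HOL-Computational_Algebra.Polynomial"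
    "HOL-Library.Log_Nat"
begin

section \<open>Computation model\<close>

text \<open>
  The library has no notion of polynomial-time algorithm, so we fix one: a program is a finite
  list of first-order functions, possibly mutually recursive, over trees whose leaves are integers.
  Integers are unbounded, but all sizes are bit lengths, and evaluating an expression charges the
  full size of every intermediate value (logarithmic cost, values counted as copied and unshared).
  A computation of cost \<open>t\<close> can therefore be carried out by a Turing machine in time polynomial
  in \<open>t\<close>, and conversely.
\<close>

datatype val = VInt int | VPair val val

fun vsize :: "val \<Rightarrow> nat" where
  "vsize (VInt i) = 1 + floorlog 2 (nat \<bar>i\<bar>)"
| "vsize (VPair u v) = 1 + vsize u + vsize v"

datatype op1 = Fst | Snd | IsInt

datatype op2 = MkPair | Add | Sub | Mul | Div | Leq

datatype exp =
    Var nat               \<comment> \<open>de Bruijn index into the environment\<close>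
  | Const val
  | Op1 op1 exp
  | Op2 op2 exp exp
  | Ite exp exp exp
  | LetIn exp exp         \<comment> \<open>binds index 0 in the second expression\<close>
  | Call nat "exp list"   \<comment> \<open>the called body is evaluated in the list of argument values\<close>

type_synonym program = "exp list"

abbreviation vbool :: "bool \<Rightarrow> val" where
  "vbool b \<equiv> VInt (if b then 1 else 0)"

text \<open>Ill-typed applications yield \<open>VInt 0\<close>. \<open>Div\<close> rounds down.\<close>

fun apply1 :: "op1 \<Rightarrow> val \<Rightarrow> val" where
  "apply1 Fst (VPair u v) = u"
| "apply1 Snd (VPair u v) = v"
| "apply1 IsInt (VInt i) = vbool True"
| "apply1 _ _ = VInt 0"

fun apply2 :: "op2 \<Rightarrow> val \<Rightarrow> val \<Rightarrow> val" where
  "apply2 MkPair u v = VPair u v"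
| "apply2 Add (VInt i) (VInt j) = VInt (i + j)"
| "apply2 Sub (VInt i) (VInt j) = VInt (i - j)"
| "apply2 Mul (VInt i) (VInt j) = VInt (i * j)"
| "apply2 Div (VInt i) (VInt j) = VInt (i div j)"
| "apply2 Leq (VInt i) (VInt j) = vbool (i \<le> j)"
| "apply2 _ _ _ = VInt 0"

text \<open>
  \<open>eval P env e v t\<close>: in environment \<open>env\<close> the evaluation of \<open>e\<close> terminates with value \<open>v\<close>
  at cost \<open>t\<close>. Every value other than \<open>VInt 0\<close> counts as true in a conditional.
\<close>

inductive eval :: "program \<Rightarrow> val list \<Rightarrow> exp \<Rightarrow> val \<Rightarrow> nat \<Rightarrow> bool"
  and evals :: "program \<Rightarrow> val list \<Rightarrow> exp list \<Rightarrow> val list \<Rightarrow> nat \<Rightarrow> bool"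
  for P :: program
where
  eval_Var: "i < length env \<Longrightarrow> v = env ! i \<Longrightarrow> eval P env (Var i) v (vsize v)"
| eval_Const: "eval P env (Const v) v (vsize v)"
| eval_Op1: "eval P env e u t \<Longrightarrow> v = apply1 f u \<Longrightarrow> eval P env (Op1 f e) v (t + vsize v)"
| eval_Op2: "eval P env e1 u1 t1 \<Longrightarrow> eval P env e2 u2 t2 \<Longrightarrow> v = apply2 f u1 u2 \<Longrightarrow>
    eval P env (Op2 f e1 e2) v (t1 + t2 + vsize v)"
| eval_Ite_true: "eval P env e u t1 \<Longrightarrow> u \<noteq> VInt 0 \<Longrightarrow> eval P env e1 v t2 \<Longrightarrow>
    eval P env (Ite e e1 e2) v (t1 + t2 + vsize v)"
| eval_Ite_false: "eval P env e (VInt 0) t1 \<Longrightarrow> eval P env e2 v t2 \<Longrightarrow>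
    eval P env (Ite e e1 e2) v (t1 + t2 + vsize v)"
| eval_LetIn: "eval P env e1 u t1 \<Longrightarrow> eval P (u # env) e2 v t2 \<Longrightarrow>
    eval P env (LetIn e1 e2) v (t1 + t2 + vsize v)"
| eval_Call: "i < length P \<Longrightarrow> evals P env es us t1 \<Longrightarrow> eval P us (P ! i) v t2 \<Longrightarrow>
    eval P env (Call i es) v (t1 + t2 + vsize v)"
| evals_Nil: "evals P env [] [] 0"
| evals_Cons: "eval P env e v t1 \<Longrightarrow> evals P env es vs t2 \<Longrightarrow>
    evals P env (e # es) (v # vs) (t1 + t2)"

inductive_cases eval_VarE: "eval P env (Var i) v t"
inductive_cases eval_ConstE: "eval P env (Const c) v t"
inductive_cases eval_Op1E: "eval P env (Op1 f e) v t"
inductive_cases eval_Op2E: "eval P env (Op2 f e1 e2) v t"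
inductive_cases eval_IteE: "eval P env (Ite e e1 e2) v t"
inductive_cases eval_LetInE: "eval P env (LetIn e1 e2) v t"
inductive_cases eval_CallE: "eval P env (Call i es) v t"
inductive_cases evals_NilE: "evals P env [] vs t"
inductive_cases evals_ConsE: "evals P env (e # es) vs t"

lemma eval_deterministic:
  "eval P env e v t \<Longrightarrow> eval P env e v' t' \<Longrightarrow> v' = v \<and> t' = t"
  "evals P env es vs t \<Longrightarrow> evals P env es vs' t' \<Longrightarrow> vs' = vs \<and> t' = t"
proof (induction arbitrary: v' t' and vs' t' rule: eval_evals.inducts)
  case (eval_Var i env v)
  then show ?case by (auto elim: eval_VarE)
next
  case (eval_Const env v)
  then show ?case by (auto elim: eval_ConstE)
next
  case (eval_Op1 env e u t v f)
  then show ?case by (blast elim: eval_Op1E)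
next
  case (eval_Op2 env e1 u1 t1 e2 u2 t2 v f)
  then show ?case by (blast elim: eval_Op2E)
next
  case (eval_Ite_true env e u t1 e1 v t2 e2)
  then show ?case by (blast elim: eval_IteE)
next
  case (eval_Ite_false env e t1 e2 v t2 e1)
  then show ?case by (blast elim: eval_IteE)
next
  case (eval_LetIn env e1 u t1 e2 v t2)
  then show ?case by (blast elim: eval_LetInE)
next
  case (eval_Call i env es us t1 v t2)
  then show ?case by (blast elim: eval_CallE)
next
  case (evals_Nil env)
  then show ?case by (blast elim: evals_NilE)
next
  case (evals_Cons env e v t1 es vs t2)
  then show ?case by (blast elim: evals_ConsE)
qed

text \<open>The first function of a program is its entry point.\<close>

definition runs :: "program \<Rightarrow> val \<Rightarrow> val \<Rightarrow> nat \<Rightarrow> bool" where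
  "runs P x y t \<longleftrightarrow> eval P [x] (Call 0 [Var 0]) y t"


section \<open>The linear robust problem with a knapsack constraint\<close>

text \<open>
  The items are \<open>{..<m}\<close> and the objectives are indexed by \<open>{..<n}\<close>. As the running time is measured
  in the bit length of the input, all numbers in the input are rational.
\<close>

definition knapsack :: "nat \<Rightarrow> (nat \<Rightarrow> rat) \<Rightarrow> rat \<Rightarrow> nat set set" where
  "knapsack m s C = {X. X \<subseteq> {..<m} \<and> (\<Sum>e\<in>X. s e) \<le> C}"

definition linear_fun :: "(nat \<Rightarrow> rat) \<Rightarrow> nat set \<Rightarrow> real" where
  "linear_fun u X = (\<Sum>e\<in>X. real_of_rat (u e))"

definition distributions :: "'a set \<Rightarrow> 'a pmf set" where
  "distributions I = {p. set_pmf p \<subseteq> I}"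

definition robust_value :: "nat \<Rightarrow> (nat \<Rightarrow> nat \<Rightarrow> rat) \<Rightarrow> nat set set \<Rightarrow> nat set pmf \<Rightarrow> real" where
  "robust_value n w I p = (MIN k\<in>{..<n}. \<Sum>X\<in>I. pmf p X * linear_fun (w k) X)"

definition robust_opt :: "nat \<Rightarrow> (nat \<Rightarrow> nat \<Rightarrow> rat) \<Rightarrow> nat set set \<Rightarrow> real" where
  "robust_opt n w I = (SUP p\<in>distributions I. robust_value n w I p)"

definition valid_instance ::
  "nat \<Rightarrow> nat \<Rightarrow> (nat \<Rightarrow> rat) \<Rightarrow> rat \<Rightarrow> (nat \<Rightarrow> nat \<Rightarrow> rat) \<Rightarrow> bool" where
  "valid_instance m n s C w \<longleftrightarrow>
     n \<ge> 1 \<and> C \<ge> 0 \<and> (\<forall>e<m. s e \<ge> 0) \<and> (\<forall>k<n. \<forall>e<m. w k e \<ge> 0)"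

text \<open>The supremum in \<^const>\<open>robust_opt\<close> is a maximum.\<close>

lemma continuous_on_Min_image:
  fixes f :: "'k \<Rightarrow> 'a::topological_space \<Rightarrow> real"
  assumes "finite K" "K \<noteq> {}" "\<And>k. k \<in> K \<Longrightarrow> continuous_on S (f k)"
  shows "continuous_on S (\<lambda>x. MIN k\<in>K. f k x)"
  using assms
proof (induction K rule: finite_ne_induct)
  case (insert k K)
  then have "continuous_on S (\<lambda>x. min (f k x) (MIN k\<in>K. f k x))"
    by (intro continuous_on_min) auto
  then show ?case using insert by simp
qed simp

lemma robust_opt_attained:
  assumes "finite I" "I \<noteq> {}" "n \<ge> 1"
  shows "\<exists>p\<in>distributions I. robust_value n w I p = robust_opt n w I \<and>
           (\<forall>p'\<in>distributions I. robust_value n w I p' \<le> robust_value n w I p)"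
proof -
  let ?val = "\<lambda>g. MIN k\<in>{..<n}. \<Sum>X\<in>I. g X * linear_fun (w k) X"
  define B :: "(nat set \<Rightarrow> real) set" where "B = PiE UNIV (\<lambda>X. {0..if X \<in> I then 1 else 0})"
  define S where "S = B \<inter> {g. (\<Sum>X\<in>I. g X) = 1}"
  have "compactin (product_topology (\<lambda>_. euclidean) UNIV) B"
    unfolding B_def compactin_PiE by auto
  then have "compact B"
    by (simp add: euclidean_product_topology)
  moreover have cont: "continuous_on T (\<lambda>g. g X)" for X :: "nat set" and T :: "(nat set \<Rightarrow> real) set"
    by (rule continuous_on_subset[OF continuous_on_product_coordinates]) simp
  have "closed {g. (\<Sum>X\<in>I. g X) = (1::real)}"
    by (intro closed_Collect_eq continuous_intros cont)
  ultimately have comp: "compact S"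
    unfolding S_def by (rule compact_Int_closed)
  have in_S: "pmf p \<in> S" if "p \<in> distributions I" for p
    using that assms(1)
    by (auto simp: S_def B_def distributions_def PiE_iff pmf_le_1 sum_pmf_eq_1 set_pmf_eq)
  have to_pmf: "\<exists>p\<in>distributions I. pmf p = g" if "g \<in> S" for g
  proof -
    have g: "0 \<le> g X" "X \<notin> I \<Longrightarrow> g X = 0" "(\<Sum>X\<in>I. g X) = 1" for X
      using that by (auto simp: S_def B_def PiE_iff split: if_splits dest: spec[of _ X])
    have "(\<integral>\<^sup>+X. ennreal (g X) \<partial>count_space UNIV) = (\<Sum>X\<in>I. ennreal (g X))"
      using assms(1) g by (intro nn_integral_count_space') auto
    also have "\<dots> = 1"
      using g by (simp add: sum_ennreal)
    finally have "pmf (embed_pmf g) = g"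
      using g(1) by (intro ext pmf_embed_pmf)
    moreover from this have "embed_pmf g \<in> distributions I"
      using g(2) by (auto simp: distributions_def set_pmf_eq)
    ultimately show ?thesis by blast
  qed
  obtain X where "X \<in> I" using assms(2) by blast
  then have "return_pmf X \<in> distributions I"
    by (simp add: distributions_def)
  then have "S \<noteq> {}" using in_S by blast
  moreover have "continuous_on S ?val"
    using assms(3) by (intro continuous_on_Min_image continuous_intros cont) (auto simp: lessThan_empty_iff)
  ultimately obtain g where g: "g \<in> S" "\<forall>h\<in>S. ?val h \<le> ?val g"
    using continuous_attains_sup[OF comp] by blast
  then obtain p where p: "p \<in> distributions I" "pmf p = g"
    using to_pmf by blast
  have max: "\<forall>p'\<in>distributions I. robust_value n w I p' \<le> robust_value n w I p"
    using g in_S p by (auto simp: robust_value_def)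
  then have "robust_opt n w I = robust_value n w I p"
    unfolding robust_opt_def using p by (intro cSup_eq_maximum) auto
  with p max show ?thesis by auto
qed

lemma knapsack_nonempty: "C \<ge> 0 \<Longrightarrow> finite (knapsack m s C) \<and> knapsack m s C \<noteq> {}"
proof -
  assume "C \<ge> 0"
  then have "{} \<in> knapsack m s C"
    by (simp add: knapsack_def)
  moreover have "finite (knapsack m s C)"
    by (rule finite_subset[of _ "Pow {..<m}"]) (auto simp: knapsack_def)
  ultimately show ?thesis by blast
qed


section \<open>Input and output format\<close>

fun enc_list :: "('a \<Rightarrow> val) \<Rightarrow> 'a list \<Rightarrow> val" where
  "enc_list f [] = VInt 0"
| "enc_list f (x # xs) = VPair (f x) (enc_list f xs)"

fun enc_frac :: "int \<times> int \<Rightarrow> val" where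
  "enc_frac (a, b) = VPair (VInt a) (VInt b)"

definition enc_rat :: "rat \<Rightarrow> val" where
  "enc_rat r = enc_frac (quotient_of r)"

definition enc_instance ::
  "nat \<Rightarrow> nat \<Rightarrow> (nat \<Rightarrow> rat) \<Rightarrow> rat \<Rightarrow> (nat \<Rightarrow> nat \<Rightarrow> rat) \<Rightarrow> val" where
  "enc_instance m n s C w =
     VPair (enc_rat C)
       (VPair (enc_list enc_rat (map s [0..<m]))
         (enc_list (enc_list enc_rat) (map (\<lambda>k. map (w k) [0..<m]) [0..<n])))"

text \<open>
  A distribution is output as a list of entries \<open>(L, a, b)\<close>, each contributing mass \<open>a / b \<ge> 0\<close> to
  the set of items listed in \<open>L\<close>. A set may occur in several entries, and \<open>a / b\<close> need not be in
  lowest terms.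
\<close>

definition enc_entry :: "nat list \<times> int \<times> int \<Rightarrow> val" where
  "enc_entry = (\<lambda>(L, q). VPair (enc_list (\<lambda>e. VInt (int e)) L) (enc_frac q))"

definition represents :: "val \<Rightarrow> nat set pmf \<Rightarrow> bool" where
  "represents y p \<longleftrightarrow>
     (\<exists>xs. y = enc_list enc_entry xs \<and>
        (\<forall>(L, a, b)\<in>set xs. a \<ge> 0 \<and> b > 0) \<and>
        (\<forall>X. pmf p X = (\<Sum>(L, a, b)\<leftarrow>xs. if set L = X then real_of_int a / real_of_int b else 0)))"

end

(*
  The robust problem is a zero-sum game between the player choosing a feasible set and an adversary
  choosing an objective. Multiplicative weights on the objectives, answered in every round by an
  approximate solution of the knapsack problem for the weighted sum of the objectives, yield a
  sequence of sets whose uniform distribution is nearly optimal. The number of rounds depends on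
  the ratio (the width) between the largest value of an objective and the optimum, which is made
  polynomial by capping all item weights at n h V. Here h is of order 1/eps, and V, the
  smallest over all objectives of the total weight of the items, is an upper bound of the optimum.
  Capping costs a factor 1 - 1/h only: mixing an optimal distribution with probability 1/h with
  the best single items of all n objectives gives an objective with a capped weight at least V.
  Best responses are computed by dynamic programming over rounded profits.

  The functions computable in polynomial time are closed under composition, case distinctions and
  loops whose state stays polynomially bounded, so the running time of the algorithm reduces to
  bounds on the sizes of the dynamic programming tables and of the integer weights.
*)
theory Submission
  imports Defs
begin

section \<open>Polynomial-time computable functions\<close>

subsection \<open>Relocation of programs\<close>

text \<open>The cap n h V makes the width comparable to the optimum: a capped objective is at most m
  n h V, while the uniform mixture of the best single items is worth at least V / (n m) to every
  objective. The original weights admit no such ratio, since they can be exponential in the input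
  length. To keep single items feasible, an item exceeding the capacity gets weight 0; it lies in no
  feasible set. The algorithm works on integers only: the data are multiplied by a common
  denominator, and the usual update factor 1 - a / (h F) becomes h F - a. The weights then grow, but
  only by about the bit length of h F per round. The final error 5 / h collects 1 / h from capping,
  1 / h from the approximate knapsack, 1 / h from the initial weights and 2 / h from the second
  order term of the logarithm. On the machine side, a polynomial-time loop body proves nothing about
  the loop, because the state might double its length in every round. The basic loop rule therefore
  demands a polynomial bound on all states in advance.\<close>

fun reloc :: "nat \<Rightarrow> exp \<Rightarrow> exp" where
  "reloc d (Var i) = Var i"
| "reloc d (Const v) = Const v"
| "reloc d (Op1 f e) = Op1 f (reloc d e)"
| "reloc d (Op2 f e1 e2) = Op2 f (reloc d e1) (reloc d e2)"
| "reloc d (Ite e e1 e2) = Ite (reloc d e) (reloc d e1) (reloc d e2)"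
| "reloc d (LetIn e1 e2) = LetIn (reloc d e1) (reloc d e2)"
| "reloc d (Call i es) = Call (d + i) (map (reloc d) es)"

text \<open>Only call targets change, and behind the prefix \<open>A\<close> they find the same
  bodies. The cost is preserved exactly, so linking programs does not affect their time
  bounds.\<close>

lemma eval_reloc:
  "eval P env e v t \<Longrightarrow>
     eval (A @ map (reloc (length A)) P @ B) env (reloc (length A) e) v t"
  "evals P env es vs t \<Longrightarrow>
     evals (A @ map (reloc (length A)) P @ B) env (map (reloc (length A)) es) vs t"
proof (induction rule: eval_evals.inducts)
  case (eval_Ite_true env e u t1 e1 v t2 e2)
  then show ?case by (auto intro: eval_evals.eval_Ite_true)
qed (auto intro!: eval_evals.intros simp: nth_append)

lemma reloc_0 [simp]: "reloc 0 e = e"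
proof (induction e)
  case (Call i es)
  then show ?case by (simp add: map_idI)
qed simp_all

text \<open>Every rule charges at least the size of its result. Hence a time bound doubles as a
  bound on the output, and in \<open>eval_call1\<close> the charge for the returned value is
  absorbed by a second \<open>t2\<close>.\<close>

lemma eval_size:
  "eval P env e v t \<Longrightarrow> vsize v \<le> t"
  "evals P env es vs t \<Longrightarrow> True"
  by (induction rule: eval_evals.inducts) auto

lemma eval_call1:
  assumes "eval P env e x t1" "eval P [x] (P ! i) y t2" "i < length P"
  shows "\<exists>t\<le>t1 + 2 * t2. eval P env (Call i [e]) y t"
proof -
  have "evals P env [e] [x] (t1 + 0)"
    using assms by (intro evals_Cons evals_Nil)
  then have "eval P env (Call i [e]) y (t1 + 0 + t2 + vsize y)"
    using assms by (intro eval_Call)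
  then show ?thesis using eval_size(1)[OF assms(2)] by (intro exI[of _ "t1 + 0 + t2 + vsize y"]) auto
qed


subsection \<open>Polynomially bounded quantities\<close>

text \<open>Coefficients of type \<open>nat\<close> cannot be negative. Monotonicity is what allows
  one bound to be substituted into another.\<close>

lemma poly_mono_nat: "x \<le> y \<Longrightarrow> poly (q :: nat poly) x \<le> poly q y"
  by (induction q) (auto intro!: add_mono mult_mono)

text \<open>
  Instances are elements \<open>a\<close> of an index set \<open>D\<close>, and \<open>c a\<close> is the machine representation of \<open>a\<close>.
\<close>

definition pbounded :: "'a set \<Rightarrow> ('a \<Rightarrow> val) \<Rightarrow> ('a \<Rightarrow> nat) \<Rightarrow> bool" where
  "pbounded D c b \<longleftrightarrow> (\<exists>q :: nat poly. \<forall>a\<in>D. b a \<le> poly q (vsize (c a)))"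

lemma pbounded_mono:
  assumes "pbounded D c b" "\<And>a. a \<in> D \<Longrightarrow> b' a \<le> b a"
  shows "pbounded D c b'"
  using assms unfolding pbounded_def by (meson order_trans)

lemma pbounded_const: "pbounded D c (\<lambda>_. k)"
  unfolding pbounded_def by (intro exI[of _ "[:k:]"]) simp

lemma pbounded_size: "pbounded D c (\<lambda>a. vsize (c a))"
  unfolding pbounded_def by (intro exI[of _ "[:0, 1:]"]) simp

lemma pbounded_add:
  assumes "pbounded D c b" "pbounded D c b'"
  shows "pbounded D c (\<lambda>a. b a + b' a)"
proof -
  from assms obtain q q' :: "nat poly" where "\<forall>a\<in>D. b a \<le> poly q (vsize (c a))"
    "\<forall>a\<in>D. b' a \<le> poly q' (vsize (c a))"
    by (auto simp: pbounded_def)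
  then show ?thesis
    unfolding pbounded_def by (intro exI[of _ "q + q'"]) (auto intro: add_mono)
qed

lemma pbounded_mult:
  assumes "pbounded D c b" "pbounded D c b'"
  shows "pbounded D c (\<lambda>a. b a * b' a)"
proof -
  from assms obtain q q' :: "nat poly" where "\<forall>a\<in>D. b a \<le> poly q (vsize (c a))"
    "\<forall>a\<in>D. b' a \<le> poly q' (vsize (c a))"
    by (auto simp: pbounded_def)
  then show ?thesis
    unfolding pbounded_def by (intro exI[of _ "q * q'"]) (auto intro: mult_mono)
qed

lemma pbounded_poly:
  assumes "pbounded D c b"
  shows "pbounded D c (\<lambda>a. poly p (b a))"
proof -
  from assms obtain q :: "nat poly" where "\<forall>a\<in>D. b a \<le> poly q (vsize (c a))"
    by (auto simp: pbounded_def)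
  then show ?thesis
    unfolding pbounded_def
    by (intro exI[of _ "pcompose p q"]) (auto simp: poly_pcompose intro: poly_mono_nat)
qed

lemma pbounded_trans:
  assumes "pbounded D f b" "pbounded D c (\<lambda>a. vsize (f a))"
  shows "pbounded D c b"
proof -
  from assms(1) obtain q :: "nat poly" where "\<forall>a\<in>D. b a \<le> poly q (vsize (f a))"
    by (auto simp: pbounded_def)
  then show ?thesis
    by (intro pbounded_mono[OF pbounded_poly[OF assms(2), of q]]) auto
qed

lemma pbounded_reindex:
  assumes "pbounded D c b" "\<And>x. x \<in> E \<Longrightarrow> h x \<in> D"
  shows "pbounded E (\<lambda>x. c (h x)) (\<lambda>x. b (h x))"
  using assms unfolding pbounded_def by blast

lemmas pbounded_intros = pbounded_const pbounded_add pbounded_mult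


subsection \<open>Closure properties\<close>

definition computes :: "program \<Rightarrow> nat \<Rightarrow> 'a set \<Rightarrow> ('a \<Rightarrow> val) \<Rightarrow> ('a \<Rightarrow> val) \<Rightarrow> ('a \<Rightarrow> nat) \<Rightarrow> bool" where
  "computes P i D c f b \<longleftrightarrow>
     i < length P \<and> pbounded D c b \<and> (\<forall>a\<in>D. \<exists>t\<le>b a. eval P [c a] (P ! i) (f a) t)"

text \<open>One program and one polynomial serve the whole family \<open>D\<close>. The input format
  \<open>c\<close> is a parameter so that the output of one computation can be the input of the
  next, and so that loop counters and states can enter as further components of the code.\<close>

definition ptime :: "'a set \<Rightarrow> ('a \<Rightarrow> val) \<Rightarrow> ('a \<Rightarrow> val) \<Rightarrow> bool" where
  "ptime D c f \<longleftrightarrow> (\<exists>P i b. computes P i D c f b)"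

lemma computes_reloc:
  assumes "computes P i D c f b"
  shows "computes (A @ map (reloc (length A)) P @ B) (length A + i) D c f b"
proof -
  have "i < length P" using assms by (simp add: computes_def)
  then show ?thesis
    using assms eval_reloc(1)[of P _ "P ! i" _ _ A B]
    unfolding computes_def by (fastforce simp: nth_append)
qed

lemma computes_append:
  assumes "computes P i D c f b"
  shows "computes (P @ B) i D c f b"
  using computes_reloc[OF assms, of "[]" B] by (simp add: map_idI)

lemma computes_append2:
  assumes "computes P i D c f b"
  shows "computes (A @ map (reloc (length A)) P) (length A + i) D c f b"
  using computes_reloc[OF assms, of A "[]"] by simp

text \<open>The second program is relocated behind the first, so that a new body can call both
  functions.\<close>

lemma ptime_join:
  assumes "ptime D c f" "ptime E d g"
  shows "\<exists>P i j b b'. computes P i D c f b \<and> computes P j E d g b'"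
proof -
  obtain P i b where "computes P i D c f b" using assms(1) by (auto simp: ptime_def)
  moreover obtain Q j b' where "computes Q j E d g b'" using assms(2) by (auto simp: ptime_def)
  ultimately show ?thesis
    by (blast intro: computes_append computes_append2)
qed

lemma ptime_join4:
  assumes "ptime D1 c1 f1" "ptime D2 c2 f2" "ptime D3 c3 f3" "ptime D4 c4 f4"
  shows "\<exists>P i1 i2 i3 i4 b1 b2 b3 b4.
    computes P i1 D1 c1 f1 b1 \<and> computes P i2 D2 c2 f2 b2 \<and>
    computes P i3 D3 c3 f3 b3 \<and> computes P i4 D4 c4 f4 b4"
proof -
  obtain P i1 i2 b1 b2 where "computes P i1 D1 c1 f1 b1" "computes P i2 D2 c2 f2 b2"
    using ptime_join[OF assms(1,2)] by blast
  then have 1: "computes (P @ X) i1 D1 c1 f1 b1" "computes (P @ X) i2 D2 c2 f2 b2" for X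
    by (blast intro: computes_append)+
  obtain Q i3 i4 b3 b4 where "computes Q i3 D3 c3 f3 b3" "computes Q i4 D4 c4 f4 b4"
    using ptime_join[OF assms(3,4)] by blast
  then have "computes (P @ map (reloc (length P)) Q) (length P + i3) D3 c3 f3 b3"
    "computes (P @ map (reloc (length P)) Q) (length P + i4) D4 c4 f4 b4"
    by (blast intro: computes_append2)+
  with 1 show ?thesis by blast
qed

lemma ptimeI_last:
  assumes "pbounded D c b" "\<And>a. a \<in> D \<Longrightarrow> \<exists>t\<le>b a. eval (P @ [e]) [c a] e (f a) t"
  shows "ptime D c f"
  unfolding ptime_def computes_def
  using assms by (intro exI[of _ "P @ [e]"] exI[of _ "length P"] exI[of _ b]) simp

lemma eval_callD:
  assumes "computes P i D c f b" "a \<in> D" "eval P env e (c a) t1"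
  shows "\<exists>t\<le>t1 + 2 * b a. eval P env (Call i [e]) (f a) t"
proof -
  obtain t where "t \<le> b a" "eval P [c a] (P ! i) (f a) t" "i < length P"
    using assms by (auto simp: computes_def)
  then show ?thesis
    using eval_call1[OF assms(3)] by (meson add_le_mono mult_le_mono2 order_refl order_trans)
qed

lemma ptime_size: "ptime D c f \<Longrightarrow> pbounded D c (\<lambda>a. vsize (f a))"
proof -
  assume "ptime D c f"
  then obtain P i b where P: "pbounded D c b" "\<And>a. a \<in> D \<Longrightarrow> \<exists>t\<le>b a. eval P [c a] (P ! i) (f a) t"
    unfolding ptime_def computes_def by blast
  show ?thesis
    using P(2) eval_size(1) by (intro pbounded_mono[OF P(1)]) (meson order_trans)
qed

lemma eval_Var0: "eval P (x # env) (Var 0) x (vsize x)"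
  by (intro eval_Var) auto

lemma ptime_self: "ptime D c c"
  by (rule ptimeI_last[OF pbounded_size, where P = "[]"]) (auto intro: eval_Var0)

lemma ptime_const: "ptime D c (\<lambda>_. v)"
  by (rule ptimeI_last[OF pbounded_const[of _ _ "vsize v"], where P = "[]" and e = "Const v"])
     (auto intro: eval_Const)

lemma ptime_trans:
  assumes "ptime D c f" "ptime D f g"
  shows "ptime D c g"
proof -
  obtain P i j b b' where P: "computes P i D c f b" "computes P j D f g b'"
    using ptime_join[OF assms] by (elim exE conjE) (rule that)
  have bb: "pbounded D c b" "pbounded D f b'"
    using P by (auto simp: computes_def)
  have sz: "pbounded D c (\<lambda>a. vsize (f a))"
    by (rule ptime_size[OF assms(1)])
  show ?thesis
  proof (rule ptimeI_last)
    show "pbounded D c (\<lambda>a. vsize (c a) + 2 * b a + 2 * b' a)"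
      by (intro pbounded_intros pbounded_size bb pbounded_trans[OF bb(2) sz])
    fix a assume a: "a \<in> D"
    let ?P = "P @ [Call j [Call i [Var 0]]]"
    obtain t where t: "t \<le> vsize (c a) + 2 * b a" "eval ?P [c a] (Call i [Var 0]) (f a) t"
      using eval_callD[OF computes_append[OF P(1)] a eval_Var0] by blast
    obtain t' where "t' \<le> t + 2 * b' a" "eval ?P [c a] (Call j [Call i [Var 0]]) (g a) t'"
      using eval_callD[OF computes_append[OF P(2)] a t(2)] by blast
    with t(1) show "\<exists>t\<le>vsize (c a) + 2 * b a + 2 * b' a. eval ?P [c a] (Call j [Call i [Var 0]]) (g a) t"
      by (intro exI[of _ t']) auto
  qed
qed

text \<open>No machine work is involved: \<open>h\<close> acts on the indices of the family, and the
  same program runs on the same codes.\<close>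

lemma ptime_reindex:
  assumes "ptime D c f" "\<And>x. x \<in> E \<Longrightarrow> h x \<in> D"
  shows "ptime E (\<lambda>x. c (h x)) (\<lambda>x. f (h x))"
proof -
  obtain P i b where "computes P i D c f b" using assms(1) by (auto simp: ptime_def)
  then have "computes P i E (\<lambda>x. c (h x)) (\<lambda>x. f (h x)) (\<lambda>x. b (h x))"
    using assms(2) pbounded_reindex[of D c b E h] by (auto simp: computes_def)
  then show ?thesis by (auto simp: ptime_def)
qed

lemma ptime_subset: "ptime D c f \<Longrightarrow> E \<subseteq> D \<Longrightarrow> ptime E c f"
  using ptime_reindex[of D c f E "\<lambda>x. x"] by auto

lemma ptime_cong:
  assumes "ptime D c f" "\<And>a. a \<in> D \<Longrightarrow> f a = g a"
  shows "ptime D c g"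
proof -
  obtain P i b where "computes P i D c f b" using assms(1) by (auto simp: ptime_def)
  then have "computes P i D c g b"
    using assms(2) by (simp add: computes_def)
  then show ?thesis by (auto simp: ptime_def)
qed

section \<open>Growth of sizes under the primitive operations\<close>

lemma floorlog2_le_iff: "floorlog 2 x \<le> k \<longleftrightarrow> x < 2 ^ k"
  by (simp add: floorlog_le_iff)

lemma floorlog2_0 [simp]: "floorlog 2 0 = 0" and floorlog2_1 [simp]: "floorlog 2 (Suc 0) = 1"
  by (simp_all add: floorlog_def)

lemma vsize_VInt_le: "vsize (VInt i) \<le> Suc k \<longleftrightarrow> \<bar>i\<bar> < 2 ^ k"
proof -
  have "vsize (VInt i) \<le> Suc k \<longleftrightarrow> nat \<bar>i\<bar> < 2 ^ k"
    by (simp add: floorlog2_le_iff)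
  also have "\<dots> \<longleftrightarrow> \<bar>i\<bar> < 2 ^ k"
    by (simp add: nat_less_iff)
  finally show ?thesis .
qed

lemma vsize_VInt_mono: "\<bar>i\<bar> \<le> \<bar>j\<bar> \<Longrightarrow> vsize (VInt i) \<le> vsize (VInt j)"
  by (simp add: floorlog_mono)

lemma abs_less_vsize: "\<bar>i\<bar> < 2 ^ vsize (VInt i)"
  using vsize_VInt_le[of i "vsize (VInt i)"] by simp

lemma vsize_int_le: "vsize (VInt (int n)) \<le> Suc n"
  unfolding vsize_VInt_le using of_nat_less_two_power[of n] by simp

lemma abs_div_le_abs: "\<bar>i div j\<bar> \<le> \<bar>i :: int\<bar>"
proof (cases "j = 0 \<or> i = 0")
  case False
  have "\<bar>i div j\<bar> \<le> \<bar>i\<bar>" if "j > 0" for i j :: int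
  proof (cases "i \<ge> 0")
    case True
    then show ?thesis using that by (smt (verit) div_by_1 pos_imp_zdiv_nonneg_iff zdiv_mono2)
  next
    case False
    have "i \<le> i div j"
      using zdiv_mono2_neg[of i 1 j] False that by simp
    moreover have "i div j < 0" using False that by (simp add: div_neg_pos_less0)
    ultimately show ?thesis by linarith
  qed
  from this[of j i] this[of "- j" "- i"] show ?thesis using False by (cases "j > 0") auto
qed auto

lemma vsize_apply1: "vsize (apply1 f u) \<le> vsize u + 2"
  by (cases "(f, u)" rule: apply1.cases) auto

text \<open>Multiplication is the worst arithmetic case: the bit lengths of the factors add up. The
  constant 2 covers the pair constructor, truth values and the default
  \<open>VInt 0\<close>.\<close>

lemma vsize_apply2: "vsize (apply2 f u v) \<le> vsize u + vsize v + 2"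
proof -
  have 1: "vsize (VInt k) \<le> vsize (VInt i) + vsize (VInt j) + 2"
    if "\<bar>k\<bar> \<le> 2 ^ vsize (VInt i) * 2 ^ vsize (VInt j)" for i j k
  proof -
    have "\<bar>k\<bar> < 2 ^ (vsize (VInt i) + vsize (VInt j) + 1)"
      using that by (simp add: power_add del: vsize.simps)
        (smt (verit) mult_pos_pos zero_less_power)
    then show ?thesis using vsize_VInt_le[of k "vsize (VInt i) + vsize (VInt j) + 1"] by simp
  qed
  have le: "\<bar>i\<bar> + \<bar>j\<bar> \<le> 2 ^ vsize (VInt i) * 2 ^ vsize (VInt j)"
    "\<bar>i\<bar> * \<bar>j\<bar> \<le> 2 ^ vsize (VInt i) * 2 ^ vsize (VInt j)"
    "\<bar>i\<bar> \<le> 2 ^ vsize (VInt i) * 2 ^ vsize (VInt j)" for i j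
  proof -
    define x y :: int where "x = 2 ^ vsize (VInt i)" and "y = 2 ^ vsize (VInt j)"
    have xy: "\<bar>i\<bar> + 1 \<le> x" "\<bar>j\<bar> + 1 \<le> y"
      using abs_less_vsize[of i] abs_less_vsize[of j] unfolding x_def y_def by linarith+
    have "(\<bar>i\<bar> + 1) * (\<bar>j\<bar> + 1) \<le> x * y"
      using xy by (intro mult_mono) auto
    moreover have "(\<bar>i\<bar> + 1) * (\<bar>j\<bar> + 1) = \<bar>i\<bar> * \<bar>j\<bar> + \<bar>i\<bar> + \<bar>j\<bar> + 1"
      by (simp add: algebra_simps)
    moreover have "\<bar>i\<bar> * \<bar>j\<bar> \<ge> 0" by simp
    ultimately show "\<bar>i\<bar> + \<bar>j\<bar> \<le> x * y" "\<bar>i\<bar> * \<bar>j\<bar> \<le> x * y" "\<bar>i\<bar> \<le> x * y"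
      by linarith+
  qed
  show ?thesis
  proof (cases "(f, u, v)" rule: apply2.cases)
    case (2 i j)
    have "\<bar>i + j\<bar> \<le> \<bar>i\<bar> + \<bar>j\<bar>" by simp
    with le(1)[of i j] 1[of "i + j" i j] 2 show ?thesis by (simp del: vsize.simps)
  next
    case (3 i j)
    have "\<bar>i - j\<bar> \<le> \<bar>i\<bar> + \<bar>j\<bar>" by simp
    with le(1)[of i j] 1[of "i - j" i j] 3 show ?thesis by (simp del: vsize.simps)
  next
    case (4 i j)
    with le(2)[of i j] 1[of "i * j" i j] show ?thesis by (simp add: abs_mult del: vsize.simps)
  next
    case (5 i j)
    with le(3)[of i j] 1[of "i div j" i j] abs_div_le_abs[of i j] show ?thesis
      by (simp del: vsize.simps)
  qed auto
qed

lemma ptime_op1: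
  assumes "ptime D c f"
  shows "ptime D c (\<lambda>a. apply1 op (f a))"
proof -
  obtain P i b where P: "computes P i D c f b" using assms by (auto simp: ptime_def)
  have b: "pbounded D c b" using P by (auto simp: computes_def)
  show ?thesis
  proof (rule ptimeI_last)
    show "pbounded D c (\<lambda>a. vsize (c a) + 2 * b a + (vsize (f a) + 2))"
      by (intro pbounded_intros pbounded_size b ptime_size[OF assms])
    fix a assume a: "a \<in> D"
    let ?e = "Op1 op (Call i [Var 0])"
    obtain t where t: "t \<le> vsize (c a) + 2 * b a" "eval (P @ [?e]) [c a] (Call i [Var 0]) (f a) t"
      using eval_callD[OF computes_append[OF P] a eval_Var0] by blast
    show "\<exists>t\<le>vsize (c a) + 2 * b a + (vsize (f a) + 2). eval (P @ [?e]) [c a] ?e (apply1 op (f a)) t"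
      using t(1) vsize_apply1[of op "f a"] eval_Op1[OF t(2) refl, of op]
      by (intro exI[of _ "t + vsize (apply1 op (f a))"]) auto
  qed
qed

lemma ptime_op2:
  assumes "ptime D c f" "ptime D c g"
  shows "ptime D c (\<lambda>a. apply2 op (f a) (g a))"
proof -
  obtain P i j b b' where P: "computes P i D c f b" "computes P j D c g b'"
    using ptime_join[OF assms] by (elim exE conjE) (rule that)
  have b: "pbounded D c b" "pbounded D c b'" using P by (auto simp: computes_def)
  show ?thesis
  proof (rule ptimeI_last)
    show "pbounded D c (\<lambda>a. (vsize (c a) + 2 * b a) + (vsize (c a) + 2 * b' a) +
            (vsize (f a) + vsize (g a) + 2))"
      by (intro pbounded_intros pbounded_size b assms[THEN ptime_size])
    fix a assume a: "a \<in> D"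
    let ?e = "Op2 op (Call i [Var 0]) (Call j [Var 0])"
    obtain t where t: "t \<le> vsize (c a) + 2 * b a" "eval (P @ [?e]) [c a] (Call i [Var 0]) (f a) t"
      using eval_callD[OF computes_append[OF P(1)] a eval_Var0] by blast
    obtain t' where t': "t' \<le> vsize (c a) + 2 * b' a" "eval (P @ [?e]) [c a] (Call j [Var 0]) (g a) t'"
      using eval_callD[OF computes_append[OF P(2)] a eval_Var0] by blast
    show "\<exists>t\<le>(vsize (c a) + 2 * b a) + (vsize (c a) + 2 * b' a) + (vsize (f a) + vsize (g a) + 2).
            eval (P @ [?e]) [c a] ?e (apply2 op (f a) (g a)) t"
      using t(1) t'(1) vsize_apply2[of op "f a" "g a"] eval_Op2[OF t(2) t'(2) refl, of op]
      by (intro exI[of _ "t + t' + vsize (apply2 op (f a) (g a))"]) auto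
  qed
qed

text \<open>\<open>Ite\<close> evaluates a single branch, so each branch needs to be computable only
  where it is taken. Outside its part of \<open>D\<close> the time bound of a branch says nothing;
  the proof therefore passes to the bounding polynomials, whose sum is valid for either
  branch.\<close>

lemma ptime_if:
  assumes "ptime D c (\<lambda>a. vbool (p a))"
    and "ptime {a\<in>D. p a} c f" "ptime {a\<in>D. \<not> p a} c g"
  shows "ptime D c (\<lambda>a. if p a then f a else g a)"
proof -
  obtain P i j k b b1 b2 where P: "computes P i D c (\<lambda>a. vbool (p a)) b"
    "computes P j {a\<in>D. p a} c f b1" "computes P k {a\<in>D. \<not> p a} c g b2"
    using ptime_join4[OF assms assms(1)] by (elim exE conjE) (rule that)
  have b: "pbounded D c b" using P by (auto simp: computes_def)
  obtain q1 q2 :: "nat poly" where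
    q: "\<And>a. a \<in> {a\<in>D. p a} \<Longrightarrow> b1 a \<le> poly q1 (vsize (c a))"
       "\<And>a. a \<in> {a\<in>D. \<not> p a} \<Longrightarrow> b2 a \<le> poly q2 (vsize (c a))"
    using P by (auto simp: computes_def pbounded_def)
  obtain r1 r2 :: "nat poly" where
    r: "\<And>a. a \<in> {a\<in>D. p a} \<Longrightarrow> vsize (f a) \<le> poly r1 (vsize (c a))"
       "\<And>a. a \<in> {a\<in>D. \<not> p a} \<Longrightarrow> vsize (g a) \<le> poly r2 (vsize (c a))"
    using assms(2,3)[THEN ptime_size] by (auto simp: pbounded_def)
  let ?B = "\<lambda>a. (vsize (c a) + 2 * b a) + (vsize (c a) + 2 * poly (q1 + q2) (vsize (c a))) +
     poly (r1 + r2) (vsize (c a))"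
  show ?thesis
  proof (rule ptimeI_last)
    show "pbounded D c ?B"
      by (intro pbounded_intros pbounded_poly pbounded_size b)
    fix a assume a: "a \<in> D"
    let ?e = "Ite (Call i [Var 0]) (Call j [Var 0]) (Call k [Var 0])"
    obtain t where t: "t \<le> vsize (c a) + 2 * b a"
      "eval (P @ [?e]) [c a] (Call i [Var 0]) (vbool (p a)) t"
      using eval_callD[OF computes_append[OF P(1)] a eval_Var0] by blast
    show "\<exists>t\<le>?B a. eval (P @ [?e]) [c a] ?e (if p a then f a else g a) t"
    proof (cases "p a")
      case True
      then have a: "a \<in> {a\<in>D. p a}" using a by simp
      obtain t' where t': "t' \<le> vsize (c a) + 2 * b1 a" "eval (P @ [?e]) [c a] (Call j [Var 0]) (f a) t'"
        using eval_callD[OF computes_append[OF P(2)] a eval_Var0] by blast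
      have "eval (P @ [?e]) [c a] ?e (f a) (t + t' + vsize (f a))"
        using t(2) True by (intro eval_Ite_true[OF _ _ t'(2)]) auto
      then show ?thesis
        using t(1) t'(1) q(1)[OF a] r(1)[OF a] True
        by (intro exI[of _ "t + t' + vsize (f a)"]) auto
    next
      case False
      then have a: "a \<in> {a\<in>D. \<not> p a}" using a by simp
      obtain t' where t': "t' \<le> vsize (c a) + 2 * b2 a" "eval (P @ [?e]) [c a] (Call k [Var 0]) (g a) t'"
        using eval_callD[OF computes_append[OF P(3)] a eval_Var0] by blast
      have "eval (P @ [?e]) [c a] ?e (g a) (t + t' + vsize (g a))"
        using t(2) False by (intro eval_Ite_false[OF _ t'(2)]) auto
      then show ?thesis
        using t(1) t'(1) q(2)[OF a] r(2)[OF a] False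
        by (intro exI[of _ "t + t' + vsize (g a)"]) auto
    qed
  qed
qed

text \<open>A bound in the size of the code of \<open>(a, j)\<close> turns into a bound depending on
  \<open>a\<close> alone as soon as the codes for all admissible \<open>j\<close> are uniformly
  short.\<close>

lemma pbounded_index:
  assumes "pbounded E d b" "\<And>a j. a \<in> D \<Longrightarrow> j \<in> J a \<Longrightarrow> (a, j) \<in> E \<and> vsize (d (a, j)) \<le> B a"
    and "pbounded D c B"
  shows "\<exists>B'. pbounded D c B' \<and> (\<forall>a\<in>D. \<forall>j\<in>J a. b (a, j) \<le> B' a)"
proof -
  obtain q :: "nat poly" where q: "\<And>x. x \<in> E \<Longrightarrow> b x \<le> poly q (vsize (d x))"
    using assms(1) by (auto simp: pbounded_def)
  have "b (a, j) \<le> poly q (B a)" if "a \<in> D" "j \<in> J a" for a j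
    using assms(2)[OF that] q poly_mono_nat by (meson order_trans)
  then show ?thesis
    by (intro exI[of _ "\<lambda>a. poly q (B a)"] conjI pbounded_poly[OF assms(3)]) blast
qed

text \<open>The body built here is the only one that calls itself; every loop reduces to it.
  \<open>z a j\<close> is the argument at depth \<open>j\<close>, \<open>r a j\<close> the value
  returned there, and \<open>d a\<close> the depth of the recursion. Since arguments and results are
  bounded in advance by \<open>Z\<close> and \<open>R\<close>, a level costs at most
  \<open>K a\<close> apart from its recursive call, and all levels together at most
  \<open>(d a + 1) * K a\<close>.\<close>

lemma ptime_linear_recursion:
  fixes z r :: "'a \<Rightarrow> nat \<Rightarrow> val" and d :: "'a \<Rightarrow> nat"
  defines "c \<equiv> \<lambda>a. z a 0"
  assumes d: "pbounded D c d"
    and Z: "pbounded D c Z" "\<And>a j. a \<in> D \<Longrightarrow> j \<le> d a \<Longrightarrow> vsize (z a j) \<le> Z a"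
    and R: "pbounded D c R" "\<And>a j. a \<in> D \<Longrightarrow> j \<le> d a \<Longrightarrow> vsize (r a j) \<le> R a"
    and stop: "ptime {x. fst x \<in> D \<and> snd x \<le> d (fst x)} (\<lambda>x. z (fst x) (snd x)) (\<lambda>x. vbool (snd x = d (fst x)))"
    and base: "ptime D (\<lambda>a. z a (d a)) (\<lambda>a. r a (d a))"
    and nxt: "ptime {x. fst x \<in> D \<and> snd x < d (fst x)} (\<lambda>x. z (fst x) (snd x)) (\<lambda>x. z (fst x) (Suc (snd x)))"
    and step: "ptime {x. fst x \<in> D \<and> snd x < d (fst x)} (\<lambda>x. VPair (z (fst x) (snd x)) (r (fst x) (Suc (snd x)))) (\<lambda>x. r (fst x) (snd x))"
  shows "ptime D c (\<lambda>a. r a 0)"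
proof -
  obtain P i1 i2 i3 i4 bs bb bn bu where
    P: "computes P i1 {x. fst x \<in> D \<and> snd x \<le> d (fst x)} (\<lambda>x. z (fst x) (snd x)) (\<lambda>x. vbool (snd x = d (fst x))) bs"
       "computes P i2 D (\<lambda>a. z a (d a)) (\<lambda>a. r a (d a)) bb"
       "computes P i3 {x. fst x \<in> D \<and> snd x < d (fst x)} (\<lambda>x. z (fst x) (snd x)) (\<lambda>x. z (fst x) (Suc (snd x))) bn"
       "computes P i4 {x. fst x \<in> D \<and> snd x < d (fst x)} (\<lambda>x. VPair (z (fst x) (snd x)) (r (fst x) (Suc (snd x)))) (\<lambda>x. r (fst x) (snd x)) bu"
    using ptime_join4[OF stop base nxt step] by (elim exE conjE) (rule that)
  let ?L = "length P"
  \<comment> \<open>\<open>?L\<close> is the position of this very body. \<open>i4\<close> receives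
    the argument paired with the result of the recursive call on the next argument.\<close>
  let ?e = "Ite (Call i1 [Var 0]) (Call i2 [Var 0])
       (Call i4 [Op2 MkPair (Var 0) (Call ?L [Call i3 [Var 0]])])"
  let ?P = "P @ [?e]"
  note P = P[THEN computes_append, of "[?e]"]
  have "\<exists>Bs. pbounded D c Bs \<and> (\<forall>a\<in>D. \<forall>j\<in>{..d a}. bs (a, j) \<le> Bs a)"
    by (rule pbounded_index[where E = "{x. fst x \<in> D \<and> snd x \<le> d (fst x)}" and d = "\<lambda>x. z (fst x) (snd x)" and B = Z])
       (use P(1) Z in \<open>auto simp: computes_def\<close>)
  then obtain Bs where Bs: "pbounded D c Bs" "\<And>a j. a \<in> D \<Longrightarrow> j \<le> d a \<Longrightarrow> bs (a, j) \<le> Bs a"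
    by auto
  have "\<exists>Bn. pbounded D c Bn \<and> (\<forall>a\<in>D. \<forall>j\<in>{..<d a}. bn (a, j) \<le> Bn a)"
    by (rule pbounded_index[where E = "{x. fst x \<in> D \<and> snd x < d (fst x)}" and d = "\<lambda>x. z (fst x) (snd x)" and B = Z])
       (use P(3) Z in \<open>auto simp: computes_def\<close>)
  then obtain Bn where Bn: "pbounded D c Bn" "\<And>a j. a \<in> D \<Longrightarrow> j < d a \<Longrightarrow> bn (a, j) \<le> Bn a"
    by auto
  have ZR: "pbounded D c (\<lambda>a. 1 + Z a + R a)"
    by (intro pbounded_intros Z R)
  have "\<exists>Bu. pbounded D c Bu \<and> (\<forall>a\<in>D. \<forall>j\<in>{..<d a}. bu (a, j) \<le> Bu a)"
    by (rule pbounded_index[where E = "{x. fst x \<in> D \<and> snd x < d (fst x)}"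
          and d = "\<lambda>x. VPair (z (fst x) (snd x)) (r (fst x) (Suc (snd x)))" and B = "\<lambda>a. 1 + Z a + R a"])
       (use P(4) ZR Z R in \<open>auto simp: computes_def intro!: add_mono\<close>)
  then obtain Bu where Bu: "pbounded D c Bu" "\<And>a j. a \<in> D \<Longrightarrow> j < d a \<Longrightarrow> bu (a, j) \<le> Bu a"
    by auto
  have Bb: "pbounded D c bb"
    by (rule pbounded_trans[where f = "\<lambda>a. z a (d a)"])
       (use P(2) Z in \<open>auto simp: computes_def intro: pbounded_mono\<close>)
  \<comment> \<open>The sum covers the base case and the recursive case at once, so that a single
    bound per level can be carried through the induction.\<close>
  define K where "K = (\<lambda>a. (Z a + 2 * Bs a) + (Z a + 2 * bb a) + R a + Z a +
      (Z a + 2 * Bn a) + 2 * R a + (Z a + R a + 1) + 2 * Bu a)"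
  have K: "pbounded D c K"
    unfolding K_def by (intro pbounded_intros Z Bs Bb R Bn Bu)
  have loop: "\<exists>t\<le>(k + 1) * K a. eval ?P [z a j] ?e (r a j) t"
    if a: "a \<in> D" and k: "k \<le> d a" "j = d a - k" for a k j
    using k
  proof (induction k arbitrary: j)
    case 0
    have aj: "(a, j) \<in> {x. fst x \<in> D \<and> snd x \<le> d (fst x)}" using a 0 by auto
    obtain t1 where t1: "t1 \<le> vsize (z a j) + 2 * bs (a, j)"
        "eval ?P [z a j] (Call i1 [Var 0]) (vbool (j = d a)) t1"
      using eval_callD[OF P(1) aj, of "[z a j]" "Var 0" "vsize (z a j)"]
      by (auto simp: eval_Var0)
    obtain t2 where t2: "t2 \<le> vsize (z a j) + 2 * bb a"
        "eval ?P [z a j] (Call i2 [Var 0]) (r a j) t2"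
      using eval_callD[OF P(2) a, of "[z a j]" "Var 0" "vsize (z a j)"] 0
      by (auto simp: eval_Var0)
    have "eval ?P [z a j] ?e (r a j) (t1 + t2 + vsize (r a j))"
      using t1(2) 0 by (intro eval_Ite_true[OF _ _ t2(2)]) auto
    moreover have "t1 + t2 + vsize (r a j) \<le> K a"
      using t1(1) t2(1) Z(2)[OF a, of j] R(2)[OF a, of j] Bs(2)[OF a, of j] 0
      unfolding K_def by simp
    ultimately show ?case by auto
  next
    case (Suc k)
    have j: "j < d a" using Suc.prems by auto
    have aj: "(a, j) \<in> {x. fst x \<in> D \<and> snd x \<le> d (fst x)}" and aj': "(a, j) \<in> {x. fst x \<in> D \<and> snd x < d (fst x)}"
      using a j by auto
    obtain t1 where t1: "t1 \<le> vsize (z a j) + 2 * bs (a, j)"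
        "eval ?P [z a j] (Call i1 [Var 0]) (vbool (j = d a)) t1"
      using eval_callD[OF P(1) aj, of "[z a j]" "Var 0" "vsize (z a j)"]
      by (auto simp: eval_Var0)
    obtain t2 where t2: "t2 \<le> vsize (z a j) + 2 * bn (a, j)"
        "eval ?P [z a j] (Call i3 [Var 0]) (z a (Suc j)) t2"
      using eval_callD[OF P(3) aj', of "[z a j]" "Var 0" "vsize (z a j)"]
      by (auto simp: eval_Var0)
    obtain t3 where t3: "t3 \<le> (k + 1) * K a" "eval ?P [z a (Suc j)] ?e (r a (Suc j)) t3"
    proof -
      have "k \<le> d a" "Suc j = d a - k" using Suc.prems by auto
      from Suc.IH[OF this] show ?thesis using that by blast
    qed
    have "evals ?P [z a j] [Call i3 [Var 0]] [z a (Suc j)] (t2 + 0)"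
      using t2(2) by (intro evals_Cons evals_Nil)
    then have t4: "eval ?P [z a j] (Call ?L [Call i3 [Var 0]]) (r a (Suc j))
        (t2 + 0 + t3 + vsize (r a (Suc j)))"
      using t3(2) by (intro eval_Call) auto
    let ?t5 = "vsize (z a j) + (t2 + 0 + t3 + vsize (r a (Suc j))) + vsize (VPair (z a j) (r a (Suc j)))"
    have t5: "eval ?P [z a j] (Op2 MkPair (Var 0) (Call ?L [Call i3 [Var 0]]))
        (VPair (z a j) (r a (Suc j))) ?t5"
      by (rule eval_Op2[OF eval_Var0 t4]) simp
    obtain t6 where t6: "t6 \<le> ?t5 + 2 * bu (a, j)"
        "eval ?P [z a j] (Call i4 [Op2 MkPair (Var 0) (Call ?L [Call i3 [Var 0]])]) (r a j) t6"
      using eval_callD[OF P(4) aj', of "[z a j]" _ ?t5] t5 by auto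
    have "eval ?P [z a j] ?e (r a j) (t1 + t6 + vsize (r a j))"
      using t1(2) j by (intro eval_Ite_false[OF _ t6(2)]) auto
    moreover have "t1 + t6 + vsize (r a j) \<le> K a + (k + 1) * K a"
    proof -
      have b: "vsize (z a j) \<le> Z a" "vsize (r a j) \<le> R a" "vsize (r a (Suc j)) \<le> R a"
        "bs (a, j) \<le> Bs a" "bn (a, j) \<le> Bn a" "bu (a, j) \<le> Bu a"
        "vsize (VPair (z a j) (r a (Suc j))) = 1 + vsize (z a j) + vsize (r a (Suc j))"
        using a j by (simp_all add: Z(2) R(2) Bs(2) Bn(2) Bu(2))
      show ?thesis
        using b t1(1) t2(1) t3(1) t6(1) unfolding K_def by linarith
    qed
    ultimately show ?case by (intro exI[of _ "t1 + t6 + vsize (r a j)"]) (simp add: algebra_simps)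
  qed
  have "computes ?P ?L D c (\<lambda>a. r a 0) (\<lambda>a. (d a + 1) * K a)"
    unfolding computes_def
  proof (intro conjI ballI)
    show "?L < length ?P" by simp
    show "pbounded D c (\<lambda>a. (d a + 1) * K a)" by (intro pbounded_intros d K)
    fix a assume a: "a \<in> D"
    show "\<exists>t\<le>(d a + 1) * K a. eval ?P [c a] (?P ! ?L) (r a 0) t"
      using loop[OF a, of "d a" 0] by (simp add: c_def)
  qed
  then show ?thesis unfolding ptime_def by blast
qed


section \<open>Closure under pairing, arithmetic and comparison\<close>

lemma ptime_pair:
  "ptime D c f \<Longrightarrow> ptime D c g \<Longrightarrow> ptime D c (\<lambda>a. VPair (f a) (g a))"
  using ptime_op2[of D c f g MkPair] by simp

lemma ptime_fst: "ptime D c (\<lambda>a. VPair (f a) (g a)) \<Longrightarrow> ptime D c f"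
  using ptime_op1[of D c "\<lambda>a. VPair (f a) (g a)" Fst] by simp

lemma ptime_snd: "ptime D c (\<lambda>a. VPair (f a) (g a)) \<Longrightarrow> ptime D c g"
  using ptime_op1[of D c "\<lambda>a. VPair (f a) (g a)" Snd] by simp

lemma ptime_code_fst: "ptime D (\<lambda>a. VPair (f a) (g a)) f"
  by (rule ptime_fst, rule ptime_self)

lemma ptime_code_snd: "ptime D (\<lambda>a. VPair (f a) (g a)) g"
  by (rule ptime_snd, rule ptime_self)

lemma ptime_drop: "ptime D c f \<Longrightarrow> ptime D (\<lambda>a. VPair (c a) (g a)) f"
  by (rule ptime_trans[OF ptime_code_fst])

lemma ptime_weaken:
  assumes "ptime D c f" "\<And>x. x \<in> E \<Longrightarrow> h x \<in> D"
  shows "ptime E (\<lambda>x. VPair (c (h x)) (g x)) (\<lambda>x. f (h x))"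
  by (rule ptime_drop[OF ptime_reindex[OF assms]])

lemma ptime_add:
  "ptime D c (\<lambda>a. VInt (f a)) \<Longrightarrow> ptime D c (\<lambda>a. VInt (g a)) \<Longrightarrow> ptime D c (\<lambda>a. VInt (f a + g a))"
  using ptime_op2[of D c "\<lambda>a. VInt (f a)" "\<lambda>a. VInt (g a)" Add] by simp

lemma ptime_diff:
  "ptime D c (\<lambda>a. VInt (f a)) \<Longrightarrow> ptime D c (\<lambda>a. VInt (g a)) \<Longrightarrow> ptime D c (\<lambda>a. VInt (f a - g a))"
  using ptime_op2[of D c "\<lambda>a. VInt (f a)" "\<lambda>a. VInt (g a)" Sub] by simp

lemma ptime_mult:
  "ptime D c (\<lambda>a. VInt (f a)) \<Longrightarrow> ptime D c (\<lambda>a. VInt (g a)) \<Longrightarrow> ptime D c (\<lambda>a. VInt (f a * g a))"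
  using ptime_op2[of D c "\<lambda>a. VInt (f a)" "\<lambda>a. VInt (g a)" Mul] by simp

lemma ptime_div:
  "ptime D c (\<lambda>a. VInt (f a)) \<Longrightarrow> ptime D c (\<lambda>a. VInt (g a)) \<Longrightarrow> ptime D c (\<lambda>a. VInt (f a div g a))"
  using ptime_op2[of D c "\<lambda>a. VInt (f a)" "\<lambda>a. VInt (g a)" Div] by simp

lemma ptime_le:
  "ptime D c (\<lambda>a. VInt (f a)) \<Longrightarrow> ptime D c (\<lambda>a. VInt (g a)) \<Longrightarrow> ptime D c (\<lambda>a. vbool (f a \<le> g a))"
  using ptime_op2[of D c "\<lambda>a. VInt (f a)" "\<lambda>a. VInt (g a)" Leq] by simp

lemma ptime_less:
  "ptime D c (\<lambda>a. VInt (f a)) \<Longrightarrow> ptime D c (\<lambda>a. VInt (g a)) \<Longrightarrow> ptime D c (\<lambda>a. vbool (f a < g a))"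
  using ptime_le[OF ptime_add[OF _ ptime_const[of D c "VInt 1"]], of f g] by (simp add: add1_zle_eq)

lemma ptime_nat_add:
  "ptime D c (\<lambda>a. VInt (int (f a))) \<Longrightarrow> ptime D c (\<lambda>a. VInt (int (g a))) \<Longrightarrow>
     ptime D c (\<lambda>a. VInt (int (f a + g a)))"
  using ptime_add[of D c "\<lambda>a. int (f a)" "\<lambda>a. int (g a)"] by simp

lemma ptime_nat_mult:
  "ptime D c (\<lambda>a. VInt (int (f a))) \<Longrightarrow> ptime D c (\<lambda>a. VInt (int (g a))) \<Longrightarrow>
     ptime D c (\<lambda>a. VInt (int (f a * g a)))"
  using ptime_mult[of D c "\<lambda>a. int (f a)" "\<lambda>a. int (g a)"] by simp

lemma ptime_if_int:
  assumes "ptime D c (\<lambda>a. vbool (p a))"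
    and "ptime D c (\<lambda>a. VInt (f a))" "ptime D c (\<lambda>a. VInt (g a))"
  shows "ptime D c (\<lambda>a. VInt (if p a then f a else g a))"
proof -
  have "ptime D c (\<lambda>a. if p a then VInt (f a) else VInt (g a))"
    by (intro ptime_if assms(1) ptime_subset[OF assms(2)] ptime_subset[OF assms(3)]) auto
  then show ?thesis by (rule ptime_cong) simp
qed

lemma ptime_min:
  assumes "ptime D c (\<lambda>a. VInt (f a))" "ptime D c (\<lambda>a. VInt (g a))"
  shows "ptime D c (\<lambda>a. VInt (min (f a) (g a)))"
  unfolding min_def by (rule ptime_if_int[OF ptime_le]) (rule assms)+


subsection \<open>Loops\<close>

text \<open>
  The body of a loop of length \<open>n a\<close> on the instance \<open>a\<close> is a function of the instance
  \<open>(a, j)\<close>, where \<open>j < n a\<close> is the loop counter.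
\<close>

abbreviation idx :: "'a set \<Rightarrow> ('a \<Rightarrow> nat) \<Rightarrow> ('a \<times> nat) set" where
  "idx D n \<equiv> {x. fst x \<in> D \<and> snd x < n (fst x)}"

abbreviation idx_code :: "('a \<Rightarrow> val) \<Rightarrow> 'a \<times> nat \<Rightarrow> val" where
  "idx_code c \<equiv> \<lambda>x. VPair (c (fst x)) (VInt (int (snd x)))"

lemma ptime_outer: "ptime D c f \<Longrightarrow> ptime (idx D n) (idx_code c) (\<lambda>x. f (fst x))"
  by (erule ptime_weaken) simp

lemma ptime_counter: "ptime E (idx_code c) (\<lambda>x. VInt (int (snd x)))"
  by (rule ptime_code_snd)

lemma pbounded_vpair: "pbounded D c b \<Longrightarrow> pbounded D (\<lambda>a. VPair (c a) (g a)) b"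
  by (erule pbounded_trans, rule pbounded_mono[OF pbounded_size]) simp

text \<open>A loop counting up is run as a recursion counting down: the argument is the instance
  with the number of rounds still to be computed, and the result at depth \<open>i\<close> is
  \<open>S a (n a - i)\<close>. Not only the bit length but the value of \<open>n\<close> has to be
  polynomial.\<close>

lemma ptime_natrec:
  fixes S :: "'a \<Rightarrow> nat \<Rightarrow> val"
  assumes n: "ptime D c (\<lambda>a. VInt (int (n a)))" "pbounded D c n"
    and init: "ptime D c (\<lambda>a. S a 0)"
    and step: "ptime (idx D n) (\<lambda>x. VPair (idx_code c x) (S (fst x) (snd x)))
      (\<lambda>x. S (fst x) (Suc (snd x)))"
    and B: "pbounded D c B" "\<And>a j. a \<in> D \<Longrightarrow> j \<le> n a \<Longrightarrow> vsize (S a j) \<le> B a"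
  shows "ptime D c (\<lambda>a. S a (n a))"
proof -
  define z where "z = (\<lambda>a i. VPair (c a) (VInt (int (n a - i))))"
  define r where "r = (\<lambda>a i. S a (n a - i))"
  have "ptime D (\<lambda>a. z a 0) (\<lambda>a. r a 0)"
  proof (rule ptime_linear_recursion)
    show "pbounded D (\<lambda>a. z a 0) n"
      unfolding z_def by (rule pbounded_vpair[OF n(2)])
    have "pbounded D c (\<lambda>a. 1 + vsize (c a) + (1 + n a))"
      by (intro pbounded_intros pbounded_size n)
    then show "pbounded D (\<lambda>a. z a 0) (\<lambda>a. 1 + vsize (c a) + (1 + n a))"
      unfolding z_def by (rule pbounded_vpair)
    show "vsize (z a j) \<le> 1 + vsize (c a) + (1 + n a)" for a j
      using vsize_int_le[of "n a - j"] by (simp add: z_def)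
    show "pbounded D (\<lambda>a. z a 0) B"
      unfolding z_def by (rule pbounded_vpair[OF B(1)])
    show "vsize (r a j) \<le> B a" if "a \<in> D" for a j
      using B(2)[OF that, of "n a - j"] by (simp add: r_def)
    have k: "ptime E (\<lambda>x. z (fst x) (snd x)) (\<lambda>x. VInt (int (n (fst x) - snd x)))" for E
      using ptime_code_snd[of E "\<lambda>x. c (fst x)" "\<lambda>x. VInt (int (n (fst x) - snd x))"]
      by (simp add: z_def)
    have "ptime {x. fst x \<in> D \<and> snd x \<le> n (fst x)} (\<lambda>x. z (fst x) (snd x))
        (\<lambda>x. vbool ((int (n (fst x) - snd x)) \<le> 0))"
      using k by (intro ptime_le ptime_const) simp
    then show "ptime {x. fst x \<in> D \<and> snd x \<le> n (fst x)} (\<lambda>x. z (fst x) (snd x)) (\<lambda>x. vbool (snd x = n (fst x)))"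
      by (rule ptime_cong) auto
    show "ptime D (\<lambda>a. z a (n a)) (\<lambda>a. r a (n a))"
      unfolding z_def r_def using ptime_weaken[OF init, of D "\<lambda>x. x"] by simp
    have code: "ptime E (\<lambda>x. z (fst x) (snd x)) (\<lambda>x. VPair (c (fst x)) (VInt (int (n (fst x) - Suc (snd x)))))"
      if E: "E \<subseteq> {x. fst x \<in> D \<and> snd x < n (fst x)}" for E
    proof -
      have "ptime E (\<lambda>x. z (fst x) (snd x)) (\<lambda>x. VPair (c (fst x)) (VInt (int (n (fst x) - snd x) - 1)))"
        using k[of E] ptime_code_fst[of E "\<lambda>x. c (fst x)" "\<lambda>x. VInt (int (n (fst x) - snd x))"]
        by (intro ptime_pair ptime_diff ptime_const) (simp_all add: z_def)
      then show ?thesis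
        by (rule ptime_cong) (use E in \<open>auto simp: of_nat_diff\<close>)
    qed
    show "ptime {x. fst x \<in> D \<and> snd x < n (fst x)} (\<lambda>x. z (fst x) (snd x)) (\<lambda>x. z (fst x) (Suc (snd x)))"
      using code[OF order_refl] by (simp add: z_def)
    let ?E = "{x. fst x \<in> D \<and> snd x < n (fst x)}"
    let ?d = "\<lambda>x. VPair (z (fst x) (snd x)) (r (fst x) (Suc (snd x)))"
    have "ptime ?E ?d (\<lambda>x. VPair (idx_code c (fst x, n (fst x) - Suc (snd x)))
        (S (fst x) (n (fst x) - Suc (snd x))))"
    proof (intro ptime_pair)
      have "ptime ?E ?d (\<lambda>x. z (fst x) (snd x))"
        using ptime_code_fst[of ?E "\<lambda>x. z (fst x) (snd x)" "\<lambda>x. r (fst x) (Suc (snd x))"]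
        by simp
      note * = ptime_trans[OF this code[OF order_refl]]
      show "ptime ?E ?d (\<lambda>x. c (fst (fst x, n (fst x) - Suc (snd x))))"
        "ptime ?E ?d (\<lambda>x. VInt (int (snd (fst x, n (fst x) - Suc (snd x)))))"
        using ptime_fst[OF *] ptime_snd[OF *] by simp_all
      show "ptime ?E ?d (\<lambda>x. S (fst x) (n (fst x) - Suc (snd x)))"
        using ptime_code_snd[of ?E "\<lambda>x. z (fst x) (snd x)" "\<lambda>x. r (fst x) (Suc (snd x))"]
        by (simp add: r_def)
    qed
    moreover have "ptime ?E (\<lambda>x. VPair (idx_code c (fst x, n (fst x) - Suc (snd x)))
        (S (fst x) (n (fst x) - Suc (snd x)))) (\<lambda>x. S (fst x) (Suc (n (fst x) - Suc (snd x))))"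
      using ptime_reindex[OF step, of ?E "\<lambda>x. (fst x, n (fst x) - Suc (snd x))"] by auto
    ultimately have "ptime ?E ?d (\<lambda>x. S (fst x) (Suc (n (fst x) - Suc (snd x))))"
      by (rule ptime_trans)
    then show "ptime ?E ?d (\<lambda>x. r (fst x) (snd x))"
      by (rule ptime_cong) (auto simp: r_def Suc_diff_Suc)
  qed
  moreover have "ptime D c (\<lambda>a. z a 0)"
    unfolding z_def using n(1) by (intro ptime_pair ptime_self) simp
  ultimately have "ptime D c (\<lambda>a. r a 0)" by (rule ptime_trans[rotated])
  then show ?thesis by (simp add: r_def)
qed

lemma pbounded_loop_body:
  assumes "ptime (idx D n) (idx_code c) f" "pbounded D c n"
  shows "\<exists>B. pbounded D c B \<and> (\<forall>a\<in>D. \<forall>j<n a. vsize (f (a, j)) \<le> B a)"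
proof -
  have "\<exists>B. pbounded D c B \<and> (\<forall>a\<in>D. \<forall>j\<in>{..<n a}. vsize (f (a, j)) \<le> B a)"
  proof (rule pbounded_index[OF ptime_size[OF assms(1)]])
    show "pbounded D c (\<lambda>a. 1 + vsize (c a) + (1 + n a))"
      by (intro pbounded_intros pbounded_size assms)
    show "(a, j) \<in> idx D n \<and> vsize (idx_code c (a, j)) \<le> 1 + vsize (c a) + (1 + n a)"
      if "a \<in> D" "j \<in> {..<n a}" for a j
      using vsize_int_le[of j] that by auto
  qed
  then show ?thesis by auto
qed

section \<open>Lists: sizes, construction, access and length\<close>

lemma vsize_enc_list_le:
  assumes "\<And>x. x \<in> set xs \<Longrightarrow> vsize (E x) \<le> B"
  shows "vsize (enc_list E xs) \<le> length xs * (B + 1) + 1"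
  using assms
proof (induction xs)
  case (Cons x xs)
  have "vsize (E x) \<le> B" "vsize (enc_list E xs) \<le> length xs * (B + 1) + 1"
    using Cons by auto
  then show ?case by simp
qed simp

lemma length_le_vsize: "length xs \<le> vsize (enc_list E xs)"
  by (induction xs) auto

lemma vsize_elem_le: "x \<in> set xs \<Longrightarrow> vsize (E x) \<le> vsize (enc_list E xs)"
  by (induction xs) auto

lemma vsize_drop_le: "vsize (enc_list E (drop k xs)) \<le> vsize (enc_list E xs)"
proof (induction xs arbitrary: k)
  case (Cons x xs)
  then show ?case by (cases k) (auto intro: le_SucI trans_le_add2)
qed simp

text \<open>In the loop of length \<open>n a\<close> that builds the list from its end, the counter runs downwards.\<close>

lemma ptime_vec:
  assumes n: "ptime D c (\<lambda>a. VInt (int (n a)))" "pbounded D c n"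
    and f: "ptime (idx D n) (idx_code c) (\<lambda>x. E (f (fst x) (snd x)))"
  shows "ptime D c (\<lambda>a. enc_list E (map (f a) [0..<n a]))"
proof -
  obtain B where B: "pbounded D c B" "\<And>a j. a \<in> D \<Longrightarrow> j < n a \<Longrightarrow> vsize (E (f a j)) \<le> B a"
    using pbounded_loop_body[OF f n(2)] by auto
  define S where "S = (\<lambda>a j. enc_list E (map (f a) [n a - j..<n a]))"
  have "ptime D c (\<lambda>a. S a (n a))"
  proof (rule ptime_natrec[OF n])
    show "ptime D c (\<lambda>a. S a 0)"
      by (simp add: S_def ptime_const)
    show "pbounded D c (\<lambda>a. n a * (B a + 1) + 1)"
      by (intro pbounded_intros n B)
    show "vsize (S a j) \<le> n a * (B a + 1) + 1" if "a \<in> D" "j \<le> n a" for a j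
    proof -
      have "vsize (S a j) \<le> length (map (f a) [n a - j..<n a]) * (B a + 1) + 1"
        unfolding S_def by (rule vsize_enc_list_le) (use B(2)[OF that(1)] in auto)
      also have "\<dots> \<le> n a * (B a + 1) + 1"
        by (intro add_mono mult_mono) auto
      finally show ?thesis .
    qed
    let ?d = "\<lambda>x. VPair (idx_code c x) (S (fst x) (snd x))"
    have "ptime (idx D n) (idx_code c) (\<lambda>x. VPair (c (fst x)) (VInt (int (n (fst x)) - int (snd x) - 1)))"
      using ptime_outer[OF n(1), of n]
      by (intro ptime_pair ptime_diff ptime_counter ptime_const ptime_code_fst)
    then have "ptime (idx D n) (idx_code c) (\<lambda>x. VPair (c (fst x)) (VInt (int (n (fst x) - Suc (snd x)))))"
      by (rule ptime_cong) auto
    moreover have "ptime (idx D n) (\<lambda>x. VPair (c (fst x)) (VInt (int (n (fst x) - Suc (snd x)))))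
        (\<lambda>x. E (f (fst x) (n (fst x) - Suc (snd x))))"
      using ptime_reindex[OF f, of "idx D n" "\<lambda>x. (fst x, n (fst x) - Suc (snd x))"] by auto
    ultimately have "ptime (idx D n) (idx_code c) (\<lambda>x. E (f (fst x) (n (fst x) - Suc (snd x))))"
      by (rule ptime_trans)
    then have "ptime (idx D n) ?d (\<lambda>x. VPair (E (f (fst x) (n (fst x) - Suc (snd x)))) (S (fst x) (snd x)))"
      by (rule ptime_pair[OF ptime_drop ptime_code_snd])
    then show "ptime (idx D n) ?d (\<lambda>x. S (fst x) (Suc (snd x)))"
    proof (rule ptime_cong)
      fix x assume "x \<in> idx D n"
      then have "[n (fst x) - Suc (snd x)..<n (fst x)] =
          (n (fst x) - Suc (snd x)) # [n (fst x) - snd x..<n (fst x)]"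
        by (subst upt_conv_Cons) (auto simp: Suc_diff_Suc)
      then show "VPair (E (f (fst x) (n (fst x) - Suc (snd x)))) (S (fst x) (snd x)) = S (fst x) (Suc (snd x))"
        by (simp add: S_def)
    qed
  qed
  then show ?thesis by (simp add: S_def)
qed

text \<open>The loop strips one element per round. Its number of rounds is polynomial because an
  index below the length of a list is bounded by the size of the encoded list.\<close>

lemma ptime_nth:
  assumes xs: "ptime D c (\<lambda>a. enc_list E (xs a))" and i: "ptime D c (\<lambda>a. VInt (int (i a)))"
    and len: "\<And>a. a \<in> D \<Longrightarrow> i a < length (xs a)"
  shows "ptime D c (\<lambda>a. E (xs a ! i a))"
proof -
  define S where "S = (\<lambda>a j. enc_list E (drop j (xs a)))"
  have S_cons: "S a j = VPair (E (xs a ! j)) (S a (Suc j))" if "a \<in> D" "j \<le> i a" for a j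
    using len[OF that(1)] that(2) by (simp add: S_def Cons_nth_drop_Suc[symmetric])
  have "ptime D c (\<lambda>a. S a (i a))"
  proof (rule ptime_natrec[OF i])
    show "pbounded D c i"
      by (rule pbounded_mono[OF ptime_size[OF xs]])
         (use len length_le_vsize in \<open>meson less_le_trans less_imp_le\<close>)
    show "ptime D c (\<lambda>a. S a 0)" using xs by (simp add: S_def)
    show "pbounded D c (\<lambda>a. vsize (enc_list E (xs a)))" by (rule ptime_size[OF xs])
    show "vsize (S a j) \<le> vsize (enc_list E (xs a))" for a j
      unfolding S_def by (rule vsize_drop_le)
    let ?d = "\<lambda>x. VPair (idx_code c x) (S (fst x) (snd x))"
    have "ptime (idx D i) ?d (\<lambda>x. apply1 Snd (S (fst x) (snd x)))"
      by (intro ptime_op1 ptime_code_snd)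
    then show "ptime (idx D i) ?d (\<lambda>x. S (fst x) (Suc (snd x)))"
      by (rule ptime_cong) (simp add: S_cons)
  qed
  then have "ptime D c (\<lambda>a. apply1 Fst (S a (i a)))" by (rule ptime_op1)
  then show ?thesis by (rule ptime_cong) (simp add: S_cons)
qed

lemma ptime_vec_nth:
  assumes "ptime D c (\<lambda>a. enc_list E (map (f a) [0..<n a]))" "ptime D c (\<lambda>a. VInt (int (i a)))"
    and "\<And>a. a \<in> D \<Longrightarrow> i a < n a"
  shows "ptime D c (\<lambda>a. E (f a (i a)))"
proof -
  have "ptime D c (\<lambda>a. E (map (f a) [0..<n a] ! i a))"
    using assms by (intro ptime_nth) auto
  then show ?thesis by (rule ptime_cong) (use assms(3) in simp)
qed

text \<open>\<open>ptime_natrec\<close> presupposes that the number of rounds has been computed,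
  which here is the question. The recursion follows the list itself instead and stops at the first
  integer: the empty list is coded as \<open>VInt 0\<close>, every other list as a pair.\<close>

lemma ptime_length:
  assumes "ptime D c (\<lambda>a. enc_list E (xs a))"
  shows "ptime D c (\<lambda>a. VInt (int (length (xs a))))"
proof -
  define z where "z = (\<lambda>a j. enc_list E (drop j (xs a)))"
  define r where "r = (\<lambda>a j. VInt (int (length (xs a) - j)))"
  define d where "d = (\<lambda>a. length (xs a))"
  have z_cons: "z a j = VPair (E (xs a ! j)) (z a (Suc j))" if "j < d a" for a j
    using that by (simp add: z_def d_def Cons_nth_drop_Suc[symmetric])
  have "ptime D (\<lambda>a. z a 0) (\<lambda>a. r a 0)"
  proof (rule ptime_linear_recursion)
    show d: "pbounded D (\<lambda>a. z a 0) d"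
      unfolding z_def d_def using length_le_vsize by (intro pbounded_mono[OF pbounded_size]) auto
    show "pbounded D (\<lambda>a. z a 0) (\<lambda>a. vsize (z a 0))" by (rule pbounded_size)
    show "vsize (z a j) \<le> vsize (z a 0)" for a j
      using vsize_drop_le[of E j "xs a"] by (simp add: z_def)
    show "pbounded D (\<lambda>a. z a 0) (\<lambda>a. 1 + d a)" by (intro pbounded_intros d)
    show "vsize (r a j) \<le> 1 + d a" for a j
      using vsize_int_le[of "length (xs a) - j"] by (simp add: r_def d_def)
    have "ptime {x. fst x \<in> D \<and> snd x \<le> d (fst x)} (\<lambda>x. z (fst x) (snd x)) (\<lambda>x. apply1 IsInt (z (fst x) (snd x)))"
      by (intro ptime_op1 ptime_self)
    then show "ptime {x. fst x \<in> D \<and> snd x \<le> d (fst x)} (\<lambda>x. z (fst x) (snd x)) (\<lambda>x. vbool (snd x = d (fst x)))"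
    proof (rule ptime_cong)
      fix x assume x: "x \<in> {x. fst x \<in> D \<and> snd x \<le> d (fst x)}"
      show "apply1 IsInt (z (fst x) (snd x)) = vbool (snd x = d (fst x))"
        using x by (cases "snd x = d (fst x)") (auto simp: z_cons, auto simp: z_def d_def)
    qed
    have "ptime D (\<lambda>a. z a (d a)) (\<lambda>a. VInt 0)" by (rule ptime_const)
    then show "ptime D (\<lambda>a. z a (d a)) (\<lambda>a. r a (d a))" by (simp add: r_def d_def)
    have "ptime {x. fst x \<in> D \<and> snd x < d (fst x)} (\<lambda>x. z (fst x) (snd x)) (\<lambda>x. apply1 Snd (z (fst x) (snd x)))"
      by (intro ptime_op1 ptime_self)
    then show "ptime {x. fst x \<in> D \<and> snd x < d (fst x)} (\<lambda>x. z (fst x) (snd x)) (\<lambda>x. z (fst x) (Suc (snd x)))"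
      by (rule ptime_cong) (auto simp: z_cons)
    let ?E = "{x. fst x \<in> D \<and> snd x < d (fst x)}"
    have "ptime ?E (\<lambda>x. VPair (z (fst x) (snd x)) (r (fst x) (Suc (snd x))))
        (\<lambda>x. apply2 Add (apply1 Snd (VPair (z (fst x) (snd x)) (r (fst x) (Suc (snd x))))) (VInt 1))"
      by (intro ptime_op1 ptime_op2 ptime_const ptime_self)
    then show "ptime ?E (\<lambda>x. VPair (z (fst x) (snd x)) (r (fst x) (Suc (snd x)))) (\<lambda>x. r (fst x) (snd x))"
      by (rule ptime_cong) (auto simp: r_def d_def)
  qed
  then have "ptime D (\<lambda>a. enc_list E (xs a)) (\<lambda>a. VInt (int (length (xs a))))"
    by (simp add: z_def r_def)
  with assms show ?thesis by (rule ptime_trans)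
qed

section \<open>Sums, products and minima over a loop\<close>

lemma vsize_sum_le:
  assumes "\<And>i. i < n \<Longrightarrow> vsize (VInt (f i)) \<le> B" "j \<le> n"
  shows "vsize (VInt (\<Sum>i<j. f i)) \<le> n + B + 1"
proof -
  have "\<bar>\<Sum>i<j. f i\<bar> \<le> (\<Sum>i<j. \<bar>f i\<bar>)" by (rule sum_abs)
  also have "\<dots> \<le> (\<Sum>i<j. 2 ^ B)"
  proof (rule sum_mono)
    fix i assume "i \<in> {..<j}"
    then have "vsize (VInt (f i)) \<le> Suc B" using assms(1)[of i] assms(2) by simp
    then show "\<bar>f i\<bar> \<le> 2 ^ B" unfolding vsize_VInt_le by simp
  qed
  also have "\<dots> = int j * 2 ^ B" by simp
  also have "\<dots> < 2 ^ n * 2 ^ B"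
    using le_less_trans[OF assms(2) less_exp] by (intro mult_strict_right_mono) auto
  finally show ?thesis using vsize_VInt_le[of "\<Sum>i<j. f i" "n + B"] by (simp add: power_add)
qed

lemma ptime_sum:
  assumes n: "ptime D c (\<lambda>a. VInt (int (n a)))" "pbounded D c n"
    and f: "ptime (idx D n) (idx_code c) (\<lambda>x. VInt (f (fst x) (snd x)))"
  shows "ptime D c (\<lambda>a. VInt (\<Sum>j<n a. f a j))"
proof -
  obtain B where B: "pbounded D c B" "\<And>a j. a \<in> D \<Longrightarrow> j < n a \<Longrightarrow> vsize (VInt (f a j)) \<le> B a"
    using pbounded_loop_body[OF f n(2)] by auto
  show ?thesis
  proof (rule ptime_natrec[OF n, where S = "\<lambda>a j. VInt (\<Sum>i<j. f a i)"])
    show "ptime D c (\<lambda>a. VInt (\<Sum>i<0. f a i))" by (simp add: ptime_const)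
    show "pbounded D c (\<lambda>a. n a + B a + 1)" by (intro pbounded_intros n B)
    show "vsize (VInt (\<Sum>i<j. f a i)) \<le> n a + B a + 1" if "a \<in> D" "j \<le> n a" for a j
      using vsize_sum_le[of "n a" "f a" "B a" j] B(2) that by blast
    show "ptime (idx D n) (\<lambda>x. VPair (idx_code c x) (VInt (\<Sum>i<snd x. f (fst x) i)))
        (\<lambda>x. VInt (\<Sum>i<Suc (snd x). f (fst x) i))"
      unfolding sum.lessThan_Suc
      by (rule ptime_add[OF ptime_code_snd ptime_drop[OF f]])
  qed
qed

text \<open>Bit lengths add up under multiplication, so a product of polynomially many short factors
  stays short. This controls both the common denominator of the input and the multiplicative
  weights.\<close>

lemma vsize_prod_le:
  assumes "\<And>i. i < n \<Longrightarrow> vsize (VInt (f i)) \<le> B" "j \<le> n"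
  shows "vsize (VInt (\<Prod>i<j. f i)) \<le> n * B + 2"
proof -
  have "\<bar>\<Prod>i<j. f i\<bar> = (\<Prod>i<j. \<bar>f i\<bar>)" by (rule abs_prod)
  also have "\<dots> \<le> (\<Prod>i<j. 2 ^ B)"
  proof (rule prod_mono)
    fix i assume "i \<in> {..<j}"
    then have "vsize (VInt (f i)) \<le> Suc B" using assms(1)[of i] assms(2) by simp
    then show "0 \<le> \<bar>f i\<bar> \<and> \<bar>f i\<bar> \<le> 2 ^ B" unfolding vsize_VInt_le by simp
  qed
  also have "\<dots> = 2 ^ (B * j)" by (simp add: power_mult)
  also have "\<dots> \<le> (2 :: int) ^ (n * B)"
    using assms(2) by (intro power_increasing) auto
  also have "\<dots> < 2 ^ (n * B + 1)" by simp
  finally show ?thesis using vsize_VInt_le[of "\<Prod>i<j. f i" "n * B + 1"] by simp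
qed

lemma ptime_prod:
  assumes n: "ptime D c (\<lambda>a. VInt (int (n a)))" "pbounded D c n"
    and f: "ptime (idx D n) (idx_code c) (\<lambda>x. VInt (f (fst x) (snd x)))"
  shows "ptime D c (\<lambda>a. VInt (\<Prod>j<n a. f a j))"
proof -
  obtain B where B: "pbounded D c B" "\<And>a j. a \<in> D \<Longrightarrow> j < n a \<Longrightarrow> vsize (VInt (f a j)) \<le> B a"
    using pbounded_loop_body[OF f n(2)] by auto
  show ?thesis
  proof (rule ptime_natrec[OF n, where S = "\<lambda>a j. VInt (\<Prod>i<j. f a i)"])
    show "ptime D c (\<lambda>a. VInt (\<Prod>i<0. f a i))" by (simp add: ptime_const)
    show "pbounded D c (\<lambda>a. n a * B a + 2)" by (intro pbounded_intros n B)
    show "vsize (VInt (\<Prod>i<j. f a i)) \<le> n a * B a + 2" if "a \<in> D" "j \<le> n a" for a j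
      using vsize_prod_le[of "n a" "f a" "B a" j] B(2) that by blast
    show "ptime (idx D n) (\<lambda>x. VPair (idx_code c x) (VInt (\<Prod>i<snd x. f (fst x) i)))
        (\<lambda>x. VInt (\<Prod>i<Suc (snd x). f (fst x) i))"
      unfolding prod.lessThan_Suc
      by (rule ptime_mult[OF ptime_code_snd ptime_drop[OF f]])
  qed
qed

lemma ptime_Min:
  assumes n: "ptime D c (\<lambda>a. VInt (int (n a)))" "pbounded D c n"
    and pos: "\<And>a. a \<in> D \<Longrightarrow> n a \<ge> 1"
    and f: "ptime (idx D n) (idx_code c) (\<lambda>x. VInt (f (fst x) (snd x)))"
  shows "ptime D c (\<lambda>a. VInt (MIN j\<in>{..<n a}. f a j))"
proof -
  obtain B where B: "pbounded D c B" "\<And>a j. a \<in> D \<Longrightarrow> j < n a \<Longrightarrow> vsize (VInt (f a j)) \<le> B a"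
    using pbounded_loop_body[OF f n(2)] by auto
  \<comment> \<open>Inserting \<open>f a 0\<close> gives the initial state a minimum; the final
    value is unaffected because \<open>n a\<close> is at least 1.\<close>
  define M where "M = (\<lambda>a j. Min (insert (f a 0) (f a ` {..<j})))"
  have f0: "ptime D c (\<lambda>a. VInt (f a 0))"
  proof -
    have "ptime D (\<lambda>a. VPair (c a) (VInt 0)) (\<lambda>a. VInt (f a 0))"
      using ptime_reindex[OF f, of D "\<lambda>a. (a, 0)"] pos by force
    moreover have "ptime D c (\<lambda>a. VPair (c a) (VInt 0))"
      by (rule ptime_pair[OF ptime_self ptime_const])
    ultimately show ?thesis by (rule ptime_trans[rotated])
  qed
  have "ptime D c (\<lambda>a. VInt (M a (n a)))"
  proof (rule ptime_natrec[OF n, where S = "\<lambda>a j. VInt (M a j)"])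
    show "ptime D c (\<lambda>a. VInt (M a 0))" using f0 by (simp add: M_def)
    show "pbounded D c B" by (rule B)
    show "vsize (VInt (M a j)) \<le> B a" if "a \<in> D" "j \<le> n a" for a j
    proof -
      have "M a j \<in> insert (f a 0) (f a ` {..<j})"
        unfolding M_def by (rule Min_in) auto
      moreover have "0 < n a" using pos[OF \<open>a \<in> D\<close>] by simp
      ultimately obtain i where "i < n a" "M a j = f a i"
        using \<open>j \<le> n a\<close> by (auto dest: less_le_trans)
      then show ?thesis using B(2)[OF \<open>a \<in> D\<close>] by simp
    qed
    have "M a (Suc j) = min (M a j) (f a j)" for a j
      unfolding M_def lessThan_Suc image_insert insert_commute[of "f a 0"]
      by (subst Min_insert) (auto simp: min.commute)
    then show "ptime (idx D n) (\<lambda>x. VPair (idx_code c x) (VInt (M (fst x) (snd x))))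
        (\<lambda>x. VInt (M (fst x) (Suc (snd x))))"
      by (simp only:) (rule ptime_min[OF ptime_code_snd ptime_drop[OF f]])
  qed
  then show ?thesis
  proof (rule ptime_cong)
    fix a assume "a \<in> D"
    then have "insert (f a 0) (f a ` {..<n a}) = f a ` {..<n a}"
      using pos[of a] by force
    then show "VInt (M a (n a)) = VInt (MIN j\<in>{..<n a}. f a j)" by (simp add: M_def)
  qed
qed


section \<open>Approximate knapsack by dynamic programming\<close>

text \<open>
  \<open>dp C s q i v\<close> is a lightest subset of \<open>{..<i}\<close> of profit \<open>v\<close>, together with its size. The size
  \<open>C + 1\<close> stands for infinity.
\<close>

fun dp :: "int \<Rightarrow> (nat \<Rightarrow> int) \<Rightarrow> (nat \<Rightarrow> nat) \<Rightarrow> nat \<Rightarrow> nat \<Rightarrow> int \<times> nat list" where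
  "dp C s q 0 v = (if v = 0 then 0 else C + 1, [])"
| "dp C s q (Suc i) v =
     (if q i \<le> v \<and> fst (dp C s q i (v - q i)) + s i < fst (dp C s q i v)
      then (fst (dp C s q i (v - q i)) + s i, i # snd (dp C s q i (v - q i)))
      else dp C s q i v)"

text \<open>The strict comparison in \<open>dp\<close> replaces an entry only by a smaller one, so
  no entry ever exceeds the initial \<open>C + 1\<close>. This bounds the bit length of the table
  entries.\<close>

lemma dp_range:
  assumes "C \<ge> 0" "\<And>e. e < i \<Longrightarrow> s e \<ge> 0"
  shows "0 \<le> fst (dp C s q i v) \<and> fst (dp C s q i v) \<le> C + 1"
  using assms(2)
proof (induction i arbitrary: v)
  case 0
  then show ?case using assms(1) by simp
next
  case (Suc i)
  from Suc.IH[of v] Suc.IH[of "v - q i"] Suc.prems show ?case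
    by (auto simp: less_Suc_eq)
qed

lemma dp_list:
  "distinct (snd (dp C s q i v)) \<and> set (snd (dp C s q i v)) \<subseteq> {..<i}"
proof (induction i arbitrary: v)
  case (Suc i)
  from Suc.IH[of v] Suc.IH[of "v - q i"] show ?case
    by (auto simp: less_Suc_eq)
qed simp

text \<open>As sizes are nonnegative, adding an item to an entry of size \<open>C + 1\<close> never
  brings it down to \<open>C\<close>. Hence an entry within the capacity can be traced back to an
  actual set.\<close>

lemma dp_sound:
  assumes "\<And>e. e < i \<Longrightarrow> s e \<ge> 0" "fst (dp C s q i v) \<le> C"
  shows "sum s (set (snd (dp C s q i v))) = fst (dp C s q i v) \<and>
    sum q (set (snd (dp C s q i v))) = v"
  using assms
proof (induction i arbitrary: v)
  case 0
  then show ?case by (auto split: if_splits)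
next
  case (Suc i)
  show ?case
  proof (cases "q i \<le> v \<and> fst (dp C s q i (v - q i)) + s i < fst (dp C s q i v)")
    case True
    define L where "L = snd (dp C s q i (v - q i))"
    have "s i \<ge> 0" using Suc.prems(1) by simp
    then have "fst (dp C s q i (v - q i)) \<le> C" using Suc.prems(2) True by simp
    then have IH: "sum s (set L) = fst (dp C s q i (v - q i))" "sum q (set L) = v - q i"
      using Suc.IH[of "v - q i"] Suc.prems(1) by (auto simp: L_def)
    have "i \<notin> set L" using dp_list[of C s q i "v - q i"] by (auto simp: L_def)
    then show ?thesis using True IH by (simp add: L_def[symmetric])
  next
    case False
    then have eq: "dp C s q (Suc i) v = dp C s q i v"
      by (simp only: dp.simps if_False)
    then show ?thesis using Suc.IH[of v] Suc.prems unfolding eq by simp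
  qed
qed

lemma dp_optimal:
  assumes "X \<subseteq> {..<i}" "sum q X = v"
  shows "fst (dp C s q i v) \<le> sum s X"
  using assms
proof (induction i arbitrary: X v)
  case 0
  then show ?case by simp
next
  case (Suc i)
  show ?case
  proof (cases "i \<in> X")
    case False
    then have "X \<subseteq> {..<i}" using Suc.prems(1) by (auto simp: less_Suc_eq)
    then show ?thesis using Suc.IH[of X v] Suc.prems(2) by auto
  next
    case True
    have fin: "finite X" using Suc.prems(1) finite_subset by blast
    have "X - {i} \<subseteq> {..<i}" using Suc.prems(1) by (auto simp: less_Suc_eq)
    moreover have q: "sum q X = q i + sum q (X - {i})" by (rule sum.remove[OF fin True])
    ultimately have "fst (dp C s q i (v - q i)) \<le> sum s (X - {i})"
      using Suc.IH[of "X - {i}" "v - q i"] Suc.prems(2) by simp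
    moreover have "sum s X = s i + sum s (X - {i})" by (rule sum.remove[OF fin True])
    moreover have "q i \<le> v" using q Suc.prems(2) by simp
    ultimately show ?thesis by auto
  qed
qed

text \<open>A search downwards from \<open>K\<close> for the largest attainable profit. Profit 0
  serves as the default, since the empty set attains it within any capacity
  \<open>C >= 0\<close>.\<close>

fun select :: "int \<Rightarrow> (nat \<Rightarrow> int \<times> 'a) \<Rightarrow> nat \<Rightarrow> 'a" where
  "select C t 0 = snd (t 0)"
| "select C t (Suc v) = (if fst (t (Suc v)) \<le> C then snd (t (Suc v)) else select C t v)"

lemma select_is_snd: "\<exists>v\<le>K. select C t K = snd (t v)"
  by (induction K) (auto intro: le_SucI)

lemma select_max:
  assumes "fst (t 0) \<le> C"
  shows "\<exists>v\<le>K. select C t K = snd (t v) \<and> fst (t v) \<le> C \<and> (\<forall>v'\<le>K. fst (t v') \<le> C \<longrightarrow> v' \<le> v)"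
proof (induction K)
  case 0
  then show ?case using assms by auto
next
  case (Suc K)
  then obtain v where v: "v \<le> K" "select C t K = snd (t v)" "fst (t v) \<le> C"
    "\<forall>v'\<le>K. fst (t v') \<le> C \<longrightarrow> v' \<le> v" by blast
  show ?case
  proof (cases "fst (t (Suc K)) \<le> C")
    case True
    then show ?thesis by (intro exI[of _ "Suc K"]) auto
  next
    case False
    then show ?thesis using v by (intro exI[of _ v]) (auto simp: le_Suc_eq)
  qed
qed

text \<open>Scaling by the total profit, rather than by the largest one, makes the rounded profits
  of all items add up to at most \<open>K\<close>; the table needs only \<open>K + 1\<close>
  columns. If the total is 0, the division yields 0.\<close>

definition scaled_profit :: "nat \<Rightarrow> nat \<Rightarrow> (nat \<Rightarrow> int) \<Rightarrow> nat \<Rightarrow> nat" where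
  "scaled_profit m K u e = nat (u e * int K div (\<Sum>j<m. u j))"

definition knapsack_approx :: "nat \<Rightarrow> nat \<Rightarrow> int \<Rightarrow> (nat \<Rightarrow> int) \<Rightarrow> (nat \<Rightarrow> int) \<Rightarrow> nat list" where
  "knapsack_approx m K C s u = select C (dp C s (scaled_profit m K u) m) K"

lemma knapsack_approx_list:
  "distinct (knapsack_approx m K C s u) \<and> set (knapsack_approx m K C s u) \<subseteq> {..<m}"
  unfolding knapsack_approx_def using select_is_snd dp_list by metis

lemma knapsack_approx_feasible:
  assumes "C \<ge> 0" "\<And>e. e < m \<Longrightarrow> s e \<ge> 0"
  shows "sum s (set (knapsack_approx m K C s u)) \<le> C"
proof -
  let ?t = "dp C s (scaled_profit m K u) m"
  have "fst (?t 0) \<le> C" using dp_optimal[of "{}" m "scaled_profit m K u" 0 C s] assms(1) by simp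
  then obtain v where "knapsack_approx m K C s u = snd (?t v)" "fst (?t v) \<le> C"
    using select_max unfolding knapsack_approx_def by blast
  then show ?thesis using dp_sound[of m s C _ v] assms(2) by auto
qed

text \<open>The set found is optimal for the rounded profits. Rounding down loses less than one unit
  per item, a unit being worth \<open>P / K\<close>, and a set has at most \<open>m\<close> items.
  The estimate is multiplied by \<open>K\<close> to stay within the integers.\<close>

lemma knapsack_approx_additive:
  assumes "C \<ge> 0" "\<And>e. e < m \<Longrightarrow> s e \<ge> 0" "\<And>e. e < m \<Longrightarrow> u e \<ge> 0"
    and P: "P = (\<Sum>j<m. u j)" "P > 0"
    and X: "X \<subseteq> {..<m}" "sum s X \<le> C"
  shows "int K * sum u X \<le> int K * sum u (set (knapsack_approx m K C s u)) + int m * P"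
proof -
  define q where "q = scaled_profit m K u"
  let ?L = "knapsack_approx m K C s u"
  let ?t = "dp C s q m"
  have q: "int (q e) * P \<le> u e * int K" "u e * int K \<le> int (q e) * P + P" if "e < m" for e
  proof -
    have "int (q e) = u e * int K div P"
      using assms(3)[OF that] P by (simp add: q_def scaled_profit_def pos_imp_zdiv_nonneg_iff)
    then have "u e * int K = int (q e) * P + u e * int K mod P"
      using div_mult_mod_eq[of "u e * int K" P] by (simp only:)
    moreover have "0 \<le> u e * int K mod P" "u e * int K mod P < P" using P by auto
    ultimately show "int (q e) * P \<le> u e * int K" "u e * int K \<le> int (q e) * P + P"
      by linarith+
  qed
  have fin: "finite X" using X finite_subset by blast
  have "int (sum q X) * P \<le> (\<Sum>e<m. int (q e) * P)"
    using X(1) P by (auto simp: sum_distrib_right intro!: sum_mono2)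
  also have "\<dots> \<le> (\<Sum>e<m. u e * int K)" using q by (intro sum_mono) auto
  also have "\<dots> = int K * P" unfolding P(1) by (simp add: sum_distrib_left mult.commute)
  finally have "int (sum q X) \<le> int K"
    using P(2) by (simp only: mult_le_cancel_right_pos)
  then have "sum q X \<le> K" by (simp only: of_nat_le_iff)
  moreover have "fst (?t (sum q X)) \<le> C" using dp_optimal[OF X(1) refl, of C s q] X(2) by simp
  moreover have "fst (?t 0) \<le> C" using dp_optimal[of "{}" m q 0 C s] assms(1) by auto
  ultimately obtain v where v: "?L = snd (?t v)" "fst (?t v) \<le> C" "sum q X \<le> v"
    using select_max[of ?t C K] unfolding knapsack_approx_def q_def by blast
  then have "sum q X \<le> sum q (set ?L)" using dp_sound[of m s C q v] assms(2) by auto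
  then have qq: "int (sum q X) * P \<le> int (sum q (set ?L)) * P"
    using P(2) by (simp only: mult_le_cancel_right_pos of_nat_le_iff)
  have "int K * sum u X = (\<Sum>e\<in>X. u e * int K)"
    by (simp add: sum_distrib_left mult.commute)
  also have "\<dots> \<le> (\<Sum>e\<in>X. int (q e) * P + P)"
    using q(2) X(1) by (intro sum_mono) auto
  also have "\<dots> = int (sum q X) * P + int (card X) * P"
    by (simp add: sum.distrib sum_distrib_right)
  also have "\<dots> \<le> int (sum q (set ?L)) * P + int m * P"
    using qq X(1) P(2) card_mono[of "{..<m}" X] by (intro add_mono mult_right_mono) auto
  also have "int (sum q (set ?L)) * P = (\<Sum>e\<in>set ?L. int (q e) * P)"
    by (simp add: sum_distrib_right)
  also have "\<dots> \<le> (\<Sum>e\<in>set ?L. u e * int K)"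
    using q(1) knapsack_approx_list[of m K C s u] by (intro sum_mono) auto
  also have "\<dots> = int K * sum u (set ?L)"
    by (simp add: sum_distrib_left mult.commute)
  finally show ?thesis by simp
qed

lemma exists_ge_average:
  fixes u :: "nat \<Rightarrow> int"
  assumes "m > 0"
  shows "\<exists>e<m. (\<Sum>j<m. u j) \<le> int m * u e \<and> (\<forall>j<m. u j \<le> u e)"
proof -
  have "Max (u ` {..<m}) \<in> u ` {..<m}" using assms by (intro Max_in) auto
  then obtain e where e: "e < m" "u e = Max (u ` {..<m})" by force
  then have le: "u j \<le> u e" if "j < m" for j using that by simp
  have "(\<Sum>j<m. u j) \<le> (\<Sum>j<m. u e)" by (intro sum_mono le) simp
  then show ?thesis using e(1) le by auto
qed

text \<open>With \<open>K = m * m * h\<close> the additive error is \<open>P / (m * h)\<close>,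
  which is a fraction 1 / h of any set worth at least \<open>P / m\<close>. If \<open>X\<close> is
  worth less, it is beaten by a single item of at least average profit; this item has positive
  profit and is therefore feasible by \<open>small\<close>.\<close>

lemma knapsack_approx:
  assumes C: "C \<ge> 0" "\<And>e. e < m \<Longrightarrow> s e \<ge> 0" "\<And>e. e < m \<Longrightarrow> u e \<ge> 0"
    and small: "\<And>e. e < m \<Longrightarrow> u e > 0 \<Longrightarrow> s e \<le> C"
    and h: "h \<ge> 1"
    and X: "X \<subseteq> {..<m}" "sum s X \<le> C"
  shows "(int h - 1) * sum u X \<le> int h * sum u (set (knapsack_approx m (m * m * h) C s u))"
    (is "_ \<le> int h * ?L")
proof -
  define P where "P = (\<Sum>j<m. u j)"
  have L: "?L \<ge> 0" using knapsack_approx_list[of m "m * m * h" C s u] C(3) by (intro sum_nonneg) auto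
  have uX: "sum u X \<ge> 0" "sum u X \<le> P"
    using X(1) C(3) by (auto simp: P_def intro: sum_nonneg sum_mono2)
  show ?thesis
  proof (cases "P > 0")
    case False
    then have "sum u X = 0" using uX by simp
    then show ?thesis using L by simp
  next
    case P: True
    then have m: "m > 0" by (auto simp: P_def intro: gr0I)
    have main: "(int h - 1) * sum u Y \<le> int h * ?L"
      if Y: "Y \<subseteq> {..<m}" "sum s Y \<le> C" "P \<le> int m * sum u Y" for Y
    proof -
      have "int (m * m * h) * sum u Y \<le> int (m * m * h) * ?L + int m * P"
        using knapsack_approx_additive[OF C P_def P Y(1,2), of "m * m * h"] .
      also have "int m * P \<le> int m * (int m * sum u Y)"
        using Y(3) by (intro mult_left_mono) auto
      finally have "int (m * m) * ((int h - 1) * sum u Y) \<le> int (m * m) * (int h * ?L)"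
        by (simp add: algebra_simps)
      then show ?thesis using m by (simp add: mult_le_cancel_left)
    qed
    show ?thesis
    proof (cases "P \<le> int m * sum u X")
      case True
      then show ?thesis using main X by blast
    next
      case False
      obtain e where e: "e < m" "P \<le> int m * u e"
        using exists_ge_average[OF m, of u] unfolding P_def by blast
      have "u e > 0"
        using e P C(3)[OF e(1)] by (cases "u e = 0") auto
      then have "(int h - 1) * sum u {e} \<le> int h * ?L"
        using e small by (intro main) auto
      moreover have "int m * sum u X < int m * u e" using e(2) False by linarith
      then have "(int h - 1) * sum u X \<le> (int h - 1) * u e"
        using h m by (intro mult_left_mono) auto
      ultimately show ?thesis by simp
    qed
  qed
qed


section \<open>Multiplicative weights\<close>

text \<open>Here \<open>a t k\<close> is the value of objective \<open>k\<close> in round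
  \<open>t\<close>. A large value shrinks the relative weight of \<open>k\<close>, so the adversary
  turns to the objectives that are badly served. The proof compares the total weight
  \<open>\<Phi> T\<close> with the single weight \<open>lam T k\<close>: \<open>best\<close> forces
  the total down relative to \<open>(h * F) ^ T\<close>, and a small total leaves \<open>k\<close>
  no choice but to have collected much value.\<close>

lemma multiplicative_weights_bound:
  fixes a :: "nat \<Rightarrow> nat \<Rightarrow> real" and lam :: "nat \<Rightarrow> nat \<Rightarrow> real"
  assumes n: "n \<ge> 1" and h: "h \<ge> 2" and F: "F > 0"
    and a: "\<And>t k. k < n \<Longrightarrow> 0 \<le> a t k \<and> a t k \<le> F"
    and lam: "\<And>t k. lam t k = (\<Prod>i<t. h * F - a i k)"
    and best: "\<And>t. (h - 1) * \<mu> * (\<Sum>k<n. lam t k) \<le> h * (\<Sum>k<n. lam t k * a t k)"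
    and T: "real n * F * h\<^sup>2 \<le> real T * \<mu>"
    and k: "k < n"
  shows "real T * \<mu> * (1 - 2 / h) \<le> (1 + 2 / h) * (\<Sum>t<T. a t k)"
proof -
  define \<Phi> where "\<Phi> t = (\<Sum>k<n. lam t k)" for t
  \<comment> \<open>The guaranteed relative decrease of the total weight in one round, measured
    against the common factor \<open>h * F\<close>.\<close>
  define y where "y = (1 - 1 / h) * \<mu> / (h * F)"
  have hF: "h * F > 0" using h F by simp
  have h0: "h > 0" using h by simp
  have lam_pos: "lam t j > 0" if "j < n" for t j
    unfolding lam
  proof (intro prod_pos)
    fix i
    have "a i j \<le> F" using a that by blast
    also have "F < h * F" using h F by simp
    finally show "0 < h * F - a i j" by simp
  qed
  have lam_Suc: "lam (Suc t) j = lam t j * (h * F - a t j)" for t j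
    by (simp add: lam)
  have \<Phi>_pos: "\<Phi> t > 0" for t
    unfolding \<Phi>_def using n lam_pos by (intro sum_pos) (auto simp: lessThan_empty_iff)
  have step: "\<Phi> (Suc t) \<le> h * F * (1 - y) * \<Phi> t" for t
  proof -
    have "\<Phi> (Suc t) = h * F * \<Phi> t - (\<Sum>k<n. lam t k * a t k)"
      by (simp add: \<Phi>_def lam_Suc right_diff_distrib sum_subtractf sum_distrib_left mult_ac)
    moreover have "(1 - 1 / h) * \<mu> * \<Phi> t \<le> (\<Sum>k<n. lam t k * a t k)"
      using best[of t] h0 by (simp add: \<Phi>_def field_simps)
    moreover have "h * F * (1 - y) * \<Phi> t = h * F * \<Phi> t - (1 - 1 / h) * \<mu> * \<Phi> t"
      using hF F h0 by (simp add: y_def field_simps)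
    ultimately show ?thesis by linarith
  qed
  \<comment> \<open>The total weight stays positive, so the factor \<open>1 - y\<close> in
    \<open>step\<close> cannot vanish or be negative.\<close>
  have y1: "y < 1"
  proof -
    have "0 < h * F * (1 - y) * \<Phi> 0" using step[of 0] \<Phi>_pos[of "Suc 0"] by linarith
    then have "0 < h * F * (1 - y)" using \<Phi>_pos[of 0] by (simp add: zero_less_mult_iff)
    then have "0 < 1 - y" using hF zero_less_mult_pos by blast
    then show ?thesis by simp
  qed
  have \<Phi>T: "\<Phi> t \<le> (h * F) ^ t * ((1 - y) ^ t * real n)" for t
  proof (induction t)
    case 0
    then show ?case by (simp add: \<Phi>_def lam)
  next
    case (Suc t)
    have "\<Phi> (Suc t) \<le> h * F * (1 - y) * \<Phi> t" by (rule step)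
    also have "\<dots> \<le> h * F * (1 - y) * ((h * F) ^ t * ((1 - y) ^ t * real n))"
      using Suc hF y1 by (intro mult_left_mono) auto
    finally show ?case by (simp add: mult_ac)
  qed
  define x where "x t = a t k / (h * F)" for t
  have x: "0 \<le> x t" "x t \<le> 1 / h" for t
    using a[OF k, of t] hF F h0 by (auto simp: x_def field_simps)
  have x_half: "x t \<le> 1 / 2" for t
  proof -
    have "1 / h \<le> 1 / 2" using h by (intro divide_left_mono) auto
    with x(2)[of t] show ?thesis by linarith
  qed
  have "(h * F) ^ T * (\<Prod>t<T. 1 - x t) = lam T k"
  proof -
    have "(h * F) ^ T * (\<Prod>t<T. 1 - x t) = (\<Prod>t<T. h * F * (1 - x t))"
      by (simp add: prod.distrib)
    also have "\<dots> = lam T k" unfolding lam using h0 F by (simp add: x_def right_diff_distrib)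
    finally show ?thesis .
  qed
  also have "\<dots> \<le> \<Phi> T"
    unfolding \<Phi>_def using k lam_pos by (intro member_le_sum) (auto intro: less_imp_le)
  also have "\<dots> \<le> (h * F) ^ T * ((1 - y) ^ T * real n)" by (rule \<Phi>T)
  finally have prod_le: "(\<Prod>t<T. 1 - x t) \<le> (1 - y) ^ T * real n"
    using hF by simp
  have pos: "1 - x t > 0" for t using x_half[of t] by linarith
  \<comment> \<open>The factor h in the update pays off here: it forces \<open>x t\<close> to be at
    most 1 / h, so the quadratic term of the logarithm costs only 2 / h of the linear one.\<close>
  have "(\<Sum>t<T. - ((1 + 2 / h) * x t)) \<le> (\<Sum>t<T. ln (1 - x t))"
  proof (rule sum_mono)
    fix t
    have "- x t - 2 * (x t)\<^sup>2 \<le> ln (1 - x t)"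
      using x[of t] x_half[of t] by (intro ln_one_minus_pos_lower_bound) auto
    moreover have "(x t)\<^sup>2 \<le> 1 / h * x t"
      using x[of t] by (simp add: power2_eq_square mult_right_mono del: times_divide_eq_left)
    moreover have "(1 + 2 / h) * x t = x t + 2 * (1 / h * x t)"
      by (simp add: algebra_simps)
    ultimately show "- ((1 + 2 / h) * x t) \<le> ln (1 - x t)"
      by linarith
  qed
  also have "\<dots> = ln (\<Prod>t<T. 1 - x t)"
    using pos by (subst ln_prod) (auto simp: less_imp_neq[symmetric])
  also have "\<dots> \<le> ln ((1 - y) ^ T * real n)"
    using prod_le pos n y1 by (subst ln_le_cancel_iff) (auto intro!: prod_pos)
  also have "\<dots> = real T * ln (1 - y) + ln (real n)"
    using n y1 by (simp add: ln_mult ln_realpow)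
  \<comment> \<open>Estimating \<open>ln n\<close> by \<open>n\<close> costs a polynomial factor in
    the number of rounds but keeps that number free of logarithms.\<close>
  also have "\<dots> \<le> real T * (- y) + real n"
  proof (intro add_mono mult_left_mono)
    show "ln (1 - y) \<le> - y" using ln_le_minus_one[of "1 - y"] y1 by simp
    have "ln (real n) \<le> real n - 1" using n by (intro ln_le_minus_one) auto
    then show "ln (real n) \<le> real n" by simp
  qed simp
  finally have "real T * y - real n \<le> (1 + 2 / h) * (\<Sum>t<T. x t)"
    by (simp add: sum_negf sum_distrib_left)
  then have "(real T * y - real n) * (h * F) \<le> (1 + 2 / h) * (\<Sum>t<T. x t) * (h * F)"
    using hF by (intro mult_right_mono) auto
  moreover have "(1 + 2 / h) * (\<Sum>t<T. x t) * (h * F) = (1 + 2 / h) * (\<Sum>t<T. a t k)"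
  proof -
    have "(\<Sum>t<T. x t) * (h * F) = (\<Sum>t<T. a t k)"
      using h0 F by (simp add: sum_distrib_right x_def)
    then show ?thesis by (simp only: mult.assoc)
  qed
  moreover have "(real T * y - real n) * (h * F) = real T * \<mu> * (1 - 1 / h) - real n * F * h"
    using hF F h0 by (simp add: y_def field_simps)
  moreover have "real n * F * h \<le> real T * \<mu> / h"
    using T h0 by (simp add: field_simps power2_eq_square)
  moreover have "real T * \<mu> * (1 - 2 / h) = real T * \<mu> * (1 - 1 / h) - real T * \<mu> / h"
    by (simp add: algebra_simps add_divide_distrib[symmetric])
  ultimately show ?thesis by linarith
qed


text \<open>
  A distribution \<open>p\<close> that is good for the weights \<open>W\<close> yields, after mixing it with the best
  single items of all objectives, a distribution that is good for the weights capped at \<open>H\<close>.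
\<close>

lemma capped_average:
  fixes W :: "nat \<Rightarrow> nat \<Rightarrow> int" and lam :: "nat \<Rightarrow> real" and p :: "nat set \<Rightarrow> real"
  assumes n: "n \<ge> 1" and h: "h \<ge> 1" and m: "m > 0"
    and V: "V > 0" "\<And>k. k < n \<Longrightarrow> V \<le> (\<Sum>e<m. W k e)"
    and H: "H = int n * int h * V"
    and W: "\<And>k e. k < n \<Longrightarrow> e < m \<Longrightarrow> W k e \<ge> 0"
    and lam: "\<And>k. k < n \<Longrightarrow> lam k \<ge> 0"
    and I: "finite I" "\<And>X. X \<in> I \<Longrightarrow> X \<subseteq> {..<m}"
    and single: "\<And>k e. k < n \<Longrightarrow> e < m \<Longrightarrow> W k e > 0 \<Longrightarrow> {e} \<in> I"
    and p: "\<And>X. X \<in> I \<Longrightarrow> p X \<ge> 0" "sum p I = 1"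
    and opt: "\<And>k. k < n \<Longrightarrow> opt \<le> (\<Sum>X\<in>I. p X * real_of_int (\<Sum>e\<in>X. W k e))"
      "0 \<le> opt" "opt \<le> V"
    and G: "\<And>X. X \<in> I \<Longrightarrow> (\<Sum>k<n. lam k * real_of_int (\<Sum>e\<in>X. min (W k e) H)) \<le> G"
  shows "(1 - 1 / h) * opt * (\<Sum>k<n. lam k) \<le> G" "V * (\<Sum>k<n. lam k) \<le> real (n * m) * G"
proof -
  define g where "g k X = real_of_int (\<Sum>e\<in>X. min (W k e) H)" for k X
  have VH: "V \<le> H"
  proof -
    have "1 * V \<le> int n * int h * V"
      using n h V(1) by (intro mult_right_mono) (auto simp: mult_le_cancel_left1 simp flip: of_nat_mult)
    then show ?thesis by (simp add: H)
  qed
  \<comment> \<open>\<open>b k\<close> is a heaviest item for objective \<open>k\<close>. It carries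
    at least the average weight, and if it stays below the cap then so do all items for
    \<open>k\<close>.\<close>
  have "\<forall>k. \<exists>e. k < n \<longrightarrow> e < m \<and> (\<Sum>j<m. W k j) \<le> int m * W k e \<and> (\<forall>j<m. W k j \<le> W k e)"
    using exists_ge_average[OF m] by blast
  then obtain b where b: "\<And>k. k < n \<Longrightarrow> b k < m" "\<And>k. k < n \<Longrightarrow> (\<Sum>j<m. W k j) \<le> int m * W k (b k)"
    "\<And>k j. k < n \<Longrightarrow> j < m \<Longrightarrow> W k j \<le> W k (b k)"
    by metis
  have Vb: "V \<le> int m * W k (b k)" if "k < n" for k
    using b(2)[OF that] V(2)[OF that] by linarith
  have bI: "{b k} \<in> I" if "k < n" for k
  proof -
    have "0 < int m * W k (b k)" using Vb[OF that] V(1) by linarith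
    then have "W k (b k) > 0" using m by (simp add: zero_less_mult_iff)
    then show ?thesis using single that b(1) by blast
  qed
  have g0: "g k X \<ge> 0" if "k < n" "X \<in> I" for k X
    unfolding g_def using W[OF that(1)] I(2)[OF that(2)] V(1) VH
    by (simp flip: of_int_sum, intro sum_nonneg) auto
  have Gg: "(\<Sum>k<n. lam k * g k X) \<le> G" if "X \<in> I" for X
    using G[OF that] by (simp add: g_def)
  have avg1: "(\<Sum>j<n. \<Sum>k<n. lam k * g k {b j}) \<le> real n * G"
  proof -
    have "(\<Sum>j<n. \<Sum>k<n. lam k * g k {b j}) \<le> (\<Sum>j<n. G)"
      using Gg bI by (intro sum_mono) auto
    then show ?thesis by simp
  qed
  have avg2: "(\<Sum>X\<in>I. p X * (\<Sum>k<n. lam k * g k X)) \<le> G"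
  proof -
    have "(\<Sum>X\<in>I. p X * (\<Sum>k<n. lam k * g k X)) \<le> (\<Sum>X\<in>I. p X * G)"
      using Gg p(1) by (intro sum_mono mult_left_mono) auto
    then show ?thesis using p(2) by (simp flip: sum_distrib_right)
  qed
  \<comment> \<open>The best single item of each objective is worth at least V / m to it even after
    capping, because H is at least V. Summing over the n single items, each of weighted value at
    most \<open>G\<close>, gives the claim.\<close>
  show "V * (\<Sum>k<n. lam k) \<le> real (n * m) * G"
  proof -
    have "real_of_int V * (\<Sum>k<n. lam k) \<le> (\<Sum>j<n. real m * (\<Sum>k<n. lam k * g k {b j}))"
      unfolding sum_distrib_left
    proof (intro sum_mono)
      fix j assume j: "j \<in> {..<n}"
      have "V \<le> int m * min (W j (b j)) H"
      proof (cases "W j (b j) \<le> H")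
        case True
        then show ?thesis using Vb[of j] j by (simp add: min_def)
      next
        case False
        have "1 * H \<le> int m * H" using m V(1) VH by (intro mult_right_mono) auto
        then show ?thesis using False VH by (simp add: min_def)
      qed
      then have "real_of_int V \<le> real_of_int (int m * min (W j (b j)) H)"
        by (simp only: of_int_le_iff)
      then have "real_of_int V \<le> real m * g j {b j}"
        by (simp add: g_def)
      then have "real_of_int V * lam j \<le> real m * g j {b j} * lam j"
        using lam j by (intro mult_right_mono) auto
      also have "\<dots> = real m * (lam j * g j {b j})" by simp
      also have "\<dots> \<le> real m * (\<Sum>k<n. lam k * g k {b j})"
        using j lam g0 bI by (intro mult_left_mono member_le_sum) auto
      finally show "real_of_int V * lam j \<le> (\<Sum>k<n. real m * (lam k * g k {b j}))"
        by (simp add: sum_distrib_left)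
    qed
    also have "\<dots> \<le> real m * (real n * G)"
      using avg1 by (simp flip: sum_distrib_left) (simp add: mult_left_mono)
    finally show ?thesis by (simp add: mult_ac)
  qed
  \<comment> \<open>The right-hand side is the value of the mixture: \<open>p\<close> with
    probability 1 - 1 / h, otherwise a uniformly chosen \<open>{b j}\<close>. If capping leaves
    objective \<open>k\<close> untouched, the first part suffices. Otherwise \<open>{b k}\<close>
    has capped weight H, and its probability 1 / (h n) turns this into V, which is at least
    \<open>opt\<close>.\<close>
  have key: "(1 - 1 / h) * opt \<le> (1 - 1 / h) * (\<Sum>X\<in>I. p X * g k X) + (\<Sum>j<n. g k {b j}) / (h * n)"
    if k: "k < n" for k
  proof (cases "W k (b k) \<le> H")
    case True
    have "g k X = real_of_int (\<Sum>e\<in>X. W k e)" if "X \<in> I" for X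
      unfolding g_def using b(3)[OF k] True I(2)[OF that]
      by (intro arg_cong[where f = real_of_int] sum.cong) (auto simp: min_def intro: order_trans antisym)
    then have "opt \<le> (\<Sum>X\<in>I. p X * g k X)" using opt(1)[OF k] by simp
    moreover have "0 \<le> (\<Sum>j<n. g k {b j}) / (h * n)"
      using g0[OF k] bI by (intro divide_nonneg_nonneg sum_nonneg) auto
    ultimately show ?thesis using h by (intro add_increasing2 mult_left_mono) auto
  next
    case False
    have "real_of_int H = g k {b k}" using False by (simp add: g_def min_def)
    also have "\<dots> \<le> (\<Sum>j<n. g k {b j})"
      using g0[OF k] bI k by (intro member_le_sum[of _ _ "\<lambda>j. g k {b j}"]) auto
    finally have "real_of_int H / (h * n) \<le> (\<Sum>j<n. g k {b j}) / (h * n)"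
      by (intro divide_right_mono) auto
    moreover have "real_of_int H / (h * n) = V" using h n by (simp add: H)
    moreover have "(1 - 1 / h) * opt \<le> 1 * opt" using opt(2) h by (intro mult_right_mono) auto
    moreover have "0 \<le> (1 - 1 / h) * (\<Sum>X\<in>I. p X * g k X)"
      using h p(1) g0[OF k] by (intro mult_nonneg_nonneg sum_nonneg) auto
    ultimately show ?thesis using opt(3) by linarith
  qed
  have "(1 - 1 / h) * opt * (\<Sum>k<n. lam k) = (\<Sum>k<n. lam k * ((1 - 1 / h) * opt))"
    by (simp add: sum_distrib_left sum_distrib_right mult_ac)
  also have "\<dots> \<le> (\<Sum>k<n. lam k * ((1 - 1 / h) * (\<Sum>X\<in>I. p X * g k X) + (\<Sum>j<n. g k {b j}) / (h * n)))"
    using key lam by (intro sum_mono mult_left_mono) auto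
  also have "\<dots> = (1 - 1 / h) * (\<Sum>k<n. \<Sum>X\<in>I. p X * (lam k * g k X)) +
      (\<Sum>k<n. \<Sum>j<n. lam k * g k {b j}) / (h * n)"
    by (simp add: distrib_left sum.distrib sum_distrib_left sum_divide_distrib mult_ac)
  also have "\<dots> = (1 - 1 / h) * (\<Sum>X\<in>I. p X * (\<Sum>k<n. lam k * g k X)) +
      (\<Sum>j<n. \<Sum>k<n. lam k * g k {b j}) / (h * n)"
  proof -
    have "(\<Sum>k<n. \<Sum>X\<in>I. p X * (lam k * g k X)) = (\<Sum>X\<in>I. p X * (\<Sum>k<n. lam k * g k X))"
      by (subst sum.swap) (simp add: sum_distrib_left)
    moreover have "(\<Sum>k<n. \<Sum>j<n. lam k * g k {b j}) = (\<Sum>j<n. \<Sum>k<n. lam k * g k {b j})"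
      by (rule sum.swap)
    ultimately show ?thesis by (simp only:)
  qed
  also have "\<dots> \<le> (1 - 1 / h) * G + (real n * G) / (h * n)"
    using avg1 avg2 h by (intro add_mono mult_left_mono divide_right_mono) auto
  also have "\<dots> = G" using h n by (simp add: field_simps)
  finally show "(1 - 1 / h) * opt * (\<Sum>k<n. lam k) \<le> G" .
qed


subsection \<open>The algorithm on integer data\<close>

definition min_total :: "nat \<Rightarrow> nat \<Rightarrow> (nat \<Rightarrow> nat \<Rightarrow> int) \<Rightarrow> int" where
  "min_total n m W = (MIN k\<in>{..<n}. \<Sum>e<m. W k e)"

definition cap :: "nat \<Rightarrow> nat \<Rightarrow> nat \<Rightarrow> (nat \<Rightarrow> nat \<Rightarrow> int) \<Rightarrow> int" where
  "cap n m h W = int n * int h * min_total n m W"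

definition capped :: "nat \<Rightarrow> nat \<Rightarrow> nat \<Rightarrow> (nat \<Rightarrow> nat \<Rightarrow> int) \<Rightarrow> nat \<Rightarrow> nat \<Rightarrow> int" where
  "capped n m h W k e = min (W k e) (cap n m h W)"

definition combined_profit ::
  "nat \<Rightarrow> nat \<Rightarrow> nat \<Rightarrow> (nat \<Rightarrow> nat \<Rightarrow> int) \<Rightarrow> (nat \<Rightarrow> int) \<Rightarrow> nat \<Rightarrow> int" where
  "combined_profit n m h W lam e = (\<Sum>k<n. lam k * capped n m h W k e)"

definition best_response ::
  "nat \<Rightarrow> nat \<Rightarrow> nat \<Rightarrow> int \<Rightarrow> (nat \<Rightarrow> int) \<Rightarrow> (nat \<Rightarrow> nat \<Rightarrow> int) \<Rightarrow> (nat \<Rightarrow> int) \<Rightarrow> nat list" where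
  "best_response n m h C s W lam = knapsack_approx m (m * m * h) C s (combined_profit n m h W lam)"

text \<open>Summation over positions matches the loop rule for sums. It agrees with the sum over the
  set of items because the lists produced by the dynamic program are distinct.\<close>

definition list_total :: "(nat \<Rightarrow> int) \<Rightarrow> nat list \<Rightarrow> int" where
  "list_total u L = (\<Sum>j<length L. u (L ! j))"

lemma list_total_distinct: "distinct L \<Longrightarrow> list_total u L = sum u (set L)"
  unfolding list_total_def
  by (subst sum.distinct_set_conv_list) (simp_all add: sum_list_sum_nth atLeast0LessThan)

text \<open>
  All weights are scaled by \<open>h * m * cap\<close> in every round, which keeps them integral and does not
  affect the best responses.
\<close>

fun weight ::
  "nat \<Rightarrow> nat \<Rightarrow> nat \<Rightarrow> int \<Rightarrow> (nat \<Rightarrow> int) \<Rightarrow> (nat \<Rightarrow> nat \<Rightarrow> int) \<Rightarrow> nat \<Rightarrow> nat \<Rightarrow> int" where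
  "weight n m h C s W 0 k = 1"
| "weight n m h C s W (Suc t) k = weight n m h C s W t k *
     (int h * int m * cap n m h W -
      list_total (capped n m h W k) (best_response n m h C s W (weight n m h C s W t)))"

abbreviation play ::
  "nat \<Rightarrow> nat \<Rightarrow> nat \<Rightarrow> int \<Rightarrow> (nat \<Rightarrow> int) \<Rightarrow> (nat \<Rightarrow> nat \<Rightarrow> int) \<Rightarrow> nat \<Rightarrow> nat list" where
  "play n m h C s W t \<equiv> best_response n m h C s W (weight n m h C s W t)"

text \<open>With F = m n h V and \<mu> at least V / (n m), the requirement n F h^2 <= T \<mu> of
  \<open>multiplicative_weights_bound\<close> is met once T is at least m^2 n^3 h^3. The summand 1
  keeps the uniform distribution over the rounds meaningful when there are no items.\<close>

definition rounds :: "nat \<Rightarrow> nat \<Rightarrow> nat \<Rightarrow> nat" where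
  "rounds n m h = m * m * n * n * n * h * h * h + 1"

section \<open>Guarantee of the algorithm on integer data\<close>

lemma best_response_list:
  "distinct (best_response n m h C s W lam) \<and> set (best_response n m h C s W lam) \<subseteq> {..<m}"
  unfolding best_response_def by (rule knapsack_approx_list)

text \<open>The assumption \<open>small\<close> says that every item of positive weight is feasible
  on its own. Both the approximate knapsack and the comparison with best single items rest on
  it.\<close>

locale robust_knapsack =
  fixes n m h :: nat and C :: int and s :: "nat \<Rightarrow> int" and W :: "nat \<Rightarrow> nat \<Rightarrow> int"
  assumes n: "n \<ge> 1" and h: "h \<ge> 2" and C: "C \<ge> 0"
    and s: "\<And>e. e < m \<Longrightarrow> s e \<ge> 0"
    and W: "\<And>k e. k < n \<Longrightarrow> e < m \<Longrightarrow> W k e \<ge> 0"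
    and small: "\<And>k e. k < n \<Longrightarrow> e < m \<Longrightarrow> W k e > 0 \<Longrightarrow> s e \<le> C"
begin

lemma min_total_le: "k < n \<Longrightarrow> min_total n m W \<le> (\<Sum>e<m. W k e)"
  by (simp add: min_total_def)

lemma min_total_attained: "\<exists>k<n. min_total n m W = (\<Sum>e<m. W k e)"
proof -
  have "min_total n m W \<in> (\<lambda>k. \<Sum>e<m. W k e) ` {..<n}"
    unfolding min_total_def using n by (intro Min_in) (auto simp: lessThan_empty_iff)
  then show ?thesis by auto
qed

lemma min_total_nonneg: "min_total n m W \<ge> 0"
  using min_total_attained W by (auto intro!: sum_nonneg)

lemma cap_nonneg: "cap n m h W \<ge> 0"
  using min_total_nonneg by (simp add: cap_def)

lemma capped_nonneg: "k < n \<Longrightarrow> e < m \<Longrightarrow> capped n m h W k e \<ge> 0"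
  using W cap_nonneg by (simp add: capped_def)

lemma total_capped_bounds:
  assumes "k < n"
  shows "0 \<le> list_total (capped n m h W k) (best_response n m h C s W lam)"
    and "list_total (capped n m h W k) (best_response n m h C s W lam) \<le> int m * cap n m h W"
proof -
  let ?L = "best_response n m h C s W lam"
  have L: "distinct ?L" "set ?L \<subseteq> {..<m}" using best_response_list by auto
  show "0 \<le> list_total (capped n m h W k) ?L"
    unfolding list_total_distinct[OF L(1)] using L(2) capped_nonneg[OF assms] by (intro sum_nonneg) auto
  have "list_total (capped n m h W k) ?L \<le> (\<Sum>e\<in>set ?L. cap n m h W)"
    unfolding list_total_distinct[OF L(1)] by (intro sum_mono) (simp add: capped_def)
  also have "\<dots> = int (card (set ?L)) * cap n m h W" by simp
  also have "\<dots> \<le> int m * cap n m h W"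
    using card_mono[OF _ L(2)] cap_nonneg by (intro mult_right_mono) auto
  finally show "list_total (capped n m h W k) ?L \<le> int m * cap n m h W" .
qed

lemma factor_bounds:
  assumes "k < n"
  shows "0 \<le> int h * int m * cap n m h W - list_total (capped n m h W k) (best_response n m h C s W lam)"
    and "int h * int m * cap n m h W - list_total (capped n m h W k) (best_response n m h C s W lam)
      \<le> int h * int m * cap n m h W"
proof -
  have "1 * (int m * cap n m h W) \<le> int h * (int m * cap n m h W)"
    using h cap_nonneg by (intro mult_right_mono) auto
  then show "0 \<le> int h * int m * cap n m h W - list_total (capped n m h W k) (best_response n m h C s W lam)"
    using total_capped_bounds(2)[OF assms, of lam] by (simp add: mult.assoc)
  show "int h * int m * cap n m h W - list_total (capped n m h W k) (best_response n m h C s W lam)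
      \<le> int h * int m * cap n m h W"
    using total_capped_bounds(1)[OF assms, of lam] by simp
qed

lemma weight_prod:
  "weight n m h C s W t k =
    (\<Prod>i<t. int h * int m * cap n m h W - list_total (capped n m h W k) (play n m h C s W i))"
  by (induction t) (simp_all add: mult.commute)

lemma weight_nonneg: "k < n \<Longrightarrow> weight n m h C s W t k \<ge> 0"
  using factor_bounds(1) by (subst weight_prod) (intro prod_nonneg, auto)

lemma combined_profit_nonneg:
  assumes "\<And>k. k < n \<Longrightarrow> lam k \<ge> 0" "e < m"
  shows "combined_profit n m h W lam e \<ge> 0"
  unfolding combined_profit_def using assms capped_nonneg by (intro sum_nonneg) auto

lemma best_response_feasible: "sum s (set (best_response n m h C s W lam)) \<le> C"
  unfolding best_response_def using C s by (rule knapsack_approx_feasible)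

lemma sum_combined_profit:
  "sum (combined_profit n m h W lam) X = (\<Sum>k<n. lam k * (\<Sum>e\<in>X. capped n m h W k e))"
  unfolding combined_profit_def sum_distrib_left by (rule sum.swap)

text \<open>For fixed \<open>lam\<close> the weighted sum of the capped objectives is linear in the
  items, so it is an ordinary knapsack profit. An item of positive combined profit has positive
  weight in some objective and thus fits by \<open>small\<close>.\<close>

lemma best_response_approx:
  assumes lam: "\<And>k. k < n \<Longrightarrow> lam k \<ge> 0" and X: "X \<subseteq> {..<m}" "sum s X \<le> C"
  shows "(int h - 1) * (\<Sum>k<n. lam k * (\<Sum>e\<in>X. capped n m h W k e)) \<le>
    int h * (\<Sum>k<n. lam k * list_total (capped n m h W k) (best_response n m h C s W lam))"
proof -
  have "s e \<le> C" if e: "e < m" "combined_profit n m h W lam e > 0" for e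
  proof (rule ccontr)
    assume "\<not> s e \<le> C"
    then have "W k e = 0" if "k < n" for k
      using small[OF that e(1)] W[OF that e(1)] by linarith
    then have "combined_profit n m h W lam e = 0"
      unfolding combined_profit_def capped_def using cap_nonneg by (intro sum.neutral) auto
    then show False using e(2) by simp
  qed
  then have "(int h - 1) * sum (combined_profit n m h W lam) X \<le>
      int h * sum (combined_profit n m h W lam) (set (best_response n m h C s W lam))"
    unfolding best_response_def using C s h X combined_profit_nonneg[OF lam]
    by (intro knapsack_approx) auto
  then show ?thesis
    using best_response_list by (simp add: sum_combined_profit list_total_distinct)
qed

text \<open>Instead of the optimum, the statement takes any value \<open>opt\<close> that some
  distribution \<open>p\<close> guarantees for all objectives. The average is estimated for capped
  weights, which can only underestimate the true ones.\<close>

theorem play_approx: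
  fixes p :: "nat set \<Rightarrow> real" and opt :: real
  defines "I \<equiv> {X. X \<subseteq> {..<m} \<and> sum s X \<le> C}"
  assumes p: "\<And>X. X \<in> I \<Longrightarrow> p X \<ge> 0" "sum p I = 1"
    and opt: "0 \<le> opt" "\<And>k. k < n \<Longrightarrow> opt \<le> (\<Sum>X\<in>I. p X * real_of_int (\<Sum>e\<in>X. W k e))"
    and k: "k < n"
  shows "(1 - 5 / h) * opt * rounds n m h \<le>
    (\<Sum>t<rounds n m h. real_of_int (\<Sum>e\<in>set (play n m h C s W t). W k e))"
proof -
  define V where "V = min_total n m W"
  define T where "T = rounds n m h"
  define H where "H = cap n m h W"
  have I: "finite I" "\<And>X. X \<in> I \<Longrightarrow> X \<subseteq> {..<m}"
    by (auto simp: I_def intro: finite_subset[of _ "Pow {..<m}"])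
  have V0: "V \<ge> 0" unfolding V_def by (rule min_total_nonneg)
  have optV: "opt \<le> V"
  proof -
    obtain j where j: "j < n" "V = (\<Sum>e<m. W j e)"
      using min_total_attained unfolding V_def by blast
    have "opt \<le> (\<Sum>X\<in>I. p X * real_of_int (\<Sum>e\<in>X. W j e))" by (rule opt(2)[OF j(1)])
    also have "\<dots> \<le> (\<Sum>X\<in>I. p X * real_of_int V)"
    proof (intro sum_mono mult_left_mono p(1))
      fix X assume "X \<in> I"
      then have "(\<Sum>e\<in>X. W j e) \<le> V"
        unfolding j(2) using I(2) W[OF j(1)] by (intro sum_mono2) auto
      then show "real_of_int (\<Sum>e\<in>X. W j e) \<le> real_of_int V" by (simp only: of_int_le_iff)
    qed
    also have "\<dots> = V" using p(2) by (simp flip: sum_distrib_right)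
    finally show ?thesis .
  qed
  have rhs0: "0 \<le> (\<Sum>t<T. real_of_int (\<Sum>e\<in>set (play n m h C s W t). W k e))"
    using best_response_list W[OF k] by (intro sum_nonneg of_int_nonneg) (meson lessThan_iff subsetD)
  show ?thesis
  proof (cases "V = 0 \<or> m = 0")
    case True
    then have "V = 0" using min_total_attained unfolding V_def by auto
    then have "opt = 0" using optV opt(1) by simp
    then show ?thesis using rhs0 by (simp add: T_def)
  next
    case False
    then have V: "V > 0" and m: "m > 0" using V0 by auto
    have H: "H = int n * int h * V" by (simp add: H_def cap_def V_def)
    \<comment> \<open>Both terms are values that the best response reaches up to the factor 1 - 1 /
      h. The first carries the approximation; the second bounds \<mu> from below in terms of V and
      thereby limits the number of rounds.\<close>
    define \<mu> where "\<mu> = max ((1 - 1 / h) * opt) (V / (n * m))"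
    define F where "F = real_of_int (int m * H)"
    define a where "a t j = real_of_int (list_total (capped n m h W j) (play n m h C s W t))" for t j
    define lam where "lam t j = real_of_int (weight n m h C s W t j)" for t j
    have nm: "real (n * m) > 0" using n m by simp
    have F: "F > 0" using H m n h V by (simp add: F_def)
    have h0: "real h \<ge> 2" using h by simp
    have "real T * \<mu> * (1 - 2 / h) \<le> (1 + 2 / h) * (\<Sum>t<T. a t k)"
    proof (rule multiplicative_weights_bound[OF n h0 F _ _ _ _ k, where lam = lam])
      show "0 \<le> a t j \<and> a t j \<le> F" if "j < n" for t j
        using total_capped_bounds[OF that] unfolding a_def F_def H_def
        by (simp only: of_int_0_le_iff of_int_le_iff)
      show "lam t j = (\<Prod>i<t. h * F - a i j)" for t j
        unfolding lam_def a_def F_def H_def by (subst weight_prod) (simp add: mult.assoc)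
      show "real n * F * (real h)\<^sup>2 \<le> real T * \<mu>"
      proof -
        have "real n * F * (real h)\<^sup>2 = real (m * m * n * n * n * h * h * h) * (V / (n * m))"
          using n m by (simp add: F_def H power2_eq_square)
        also have "\<dots> \<le> real T * \<mu>"
          using V nm by (intro mult_mono) (auto simp: T_def rounds_def \<mu>_def)
        finally show ?thesis .
      qed
      show "(real h - 1) * \<mu> * (\<Sum>k<n. lam t k) \<le> h * (\<Sum>k<n. lam t k * a t k)" for t
      proof -
        \<comment> \<open>The value of the current response divided by its guarantee 1 - 1 / h,
          hence an upper bound for the weighted value of every feasible set.\<close>
        define G where "G = h * (\<Sum>k<n. lam t k * a t k) / (real h - 1)"
        have G: "(\<Sum>k<n. lam t k * real_of_int (\<Sum>e\<in>X. min (W k e) H)) \<le> G" if "X \<in> I" for X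
        proof -
          have X: "X \<subseteq> {..<m}" "sum s X \<le> C" using that by (auto simp: I_def)
          have "real_of_int ((int h - 1) * (\<Sum>k<n. weight n m h C s W t k * (\<Sum>e\<in>X. capped n m h W k e)))
              \<le> real_of_int (int h * (\<Sum>k<n. weight n m h C s W t k *
                  list_total (capped n m h W k) (play n m h C s W t)))"
            unfolding of_int_le_iff by (rule best_response_approx[OF weight_nonneg X])
          then have "(real h - 1) * (\<Sum>k<n. lam t k * real_of_int (\<Sum>e\<in>X. min (W k e) H))
              \<le> h * (\<Sum>k<n. lam t k * a t k)"
            by (simp add: lam_def a_def capped_def H_def)
          then show ?thesis using h0 by (simp add: G_def pos_le_divide_eq mult.commute)
        qed
        have lam0: "lam t j \<ge> 0" if "j < n" for j
          using weight_nonneg[OF that] by (simp add: lam_def)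
        have single: "{e} \<in> I" if "k < n" "e < m" "W k e > 0" for k e
          using small[OF that] that(2) by (simp add: I_def)
        have Vle: "V \<le> (\<Sum>e<m. W k e)" if "k < n" for k
          using min_total_le[OF that] by (simp add: V_def)
        have h1: "h \<ge> 1" using h by simp
        note avg = capped_average[OF n h1 m V Vle H W lam0 I single p opt(2,1) optV G]
        have "\<mu> * (\<Sum>k<n. lam t k) \<le> G"
        proof -
          have "V / (n * m) * (\<Sum>k<n. lam t k) \<le> G"
            using avg(2) nm by (simp add: field_simps)
          with avg(1) show ?thesis by (simp add: \<mu>_def max_def)
        qed
        then have "(real h - 1) * (\<mu> * (\<Sum>k<n. lam t k)) \<le> (real h - 1) * G"
          using h0 by (intro mult_left_mono) auto
        also have "\<dots> = h * (\<Sum>k<n. lam t k * a t k)" using h0 by (simp add: G_def)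
        finally show ?thesis by (simp add: mult.assoc)
      qed
    qed
    moreover have "(1 - 5 / h) * opt \<le> \<mu> * ((1 - 2 / h) / (1 + 2 / h))"
    proof -
      define d where "d = 1 / real h"
      have d: "0 < d" "d \<le> 1 / 2" using h0 by (auto simp: d_def field_simps)
      \<comment> \<open>The constant 5 adds up the losses to first order: d from capping, 2 d on the
        left and 2 d on the right of the multiplicative weights bound.\<close>
      have "(1 - 5 * d) * (1 + 2 * d) \<le> (1 - d) * (1 - 2 * d)"
        using d by (simp add: algebra_simps)
      then have "1 - 5 * d \<le> (1 - d) * (1 - 2 * d) / (1 + 2 * d)"
        using d by (simp add: pos_le_divide_eq)
      then have "(1 - 5 * d) * opt \<le> (1 - d) * (1 - 2 * d) / (1 + 2 * d) * opt"
        using opt(1) by (intro mult_right_mono)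
      also have "\<dots> = (1 - d) * opt * ((1 - 2 * d) / (1 + 2 * d))" by simp
      also have "\<dots> \<le> \<mu> * ((1 - 2 * d) / (1 + 2 * d))"
        using d by (intro mult_right_mono) (auto simp: \<mu>_def d_def)
      finally show ?thesis by (simp add: d_def)
    qed
    moreover have "1 + 2 / real h > 0" using h0 by (intro add_pos_nonneg) auto
    ultimately have "(1 - 5 / h) * opt * T \<le> (\<Sum>t<T. a t k)"
    proof -
      assume 1: "real T * \<mu> * (1 - 2 / h) \<le> (1 + 2 / h) * (\<Sum>t<T. a t k)"
        and 2: "(1 - 5 / h) * opt \<le> \<mu> * ((1 - 2 / h) / (1 + 2 / h))" and 3: "1 + 2 / real h > 0"
      have "(1 - 5 / h) * opt * T \<le> \<mu> * ((1 - 2 / h) / (1 + 2 / h)) * T"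
        using 2 by (intro mult_right_mono) auto
      also have "\<dots> = real T * \<mu> * (1 - 2 / h) / (1 + 2 / h)" by simp
      also have "\<dots> \<le> (\<Sum>t<T. a t k)"
        using 1 3 by (simp add: pos_divide_le_eq mult.commute)
      finally show ?thesis .
    qed
    also have "\<dots> \<le> (\<Sum>t<T. real_of_int (\<Sum>e\<in>set (play n m h C s W t). W k e))"
      unfolding a_def
    proof (intro sum_mono)
      fix t
      have "list_total (capped n m h W k) (play n m h C s W t) \<le> (\<Sum>e\<in>set (play n m h C s W t). W k e)"
        using best_response_list by (subst list_total_distinct) (auto simp: capped_def intro!: sum_mono)
      then show "real_of_int (list_total (capped n m h W k) (play n m h C s W t))
          \<le> real_of_int (\<Sum>e\<in>set (play n m h C s W t). W k e)"
        by (simp only: of_int_le_iff)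
    qed
    finally show ?thesis by (simp add: T_def)
  qed
qed

end


section \<open>The algorithm runs in polynomial time\<close>

text \<open>The numbers fit to be loop lengths: computable in binary and polynomial in
  value.\<close>

definition small :: "'a set \<Rightarrow> ('a \<Rightarrow> val) \<Rightarrow> ('a \<Rightarrow> nat) \<Rightarrow> bool" where
  "small D c n \<longleftrightarrow> ptime D c (\<lambda>a. VInt (int (n a))) \<and> pbounded D c n"

lemma small_ptime: "small D c n \<Longrightarrow> ptime D c (\<lambda>a. VInt (int (n a)))"
  and small_pbounded: "small D c n \<Longrightarrow> pbounded D c n"
  by (simp_all add: small_def)

lemma small_const: "small D c (\<lambda>_. k)"
  by (simp add: small_def ptime_const pbounded_const)

lemma small_add: "small D c f \<Longrightarrow> small D c g \<Longrightarrow> small D c (\<lambda>a. f a + g a)"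
  unfolding small_def by (blast intro: ptime_nat_add pbounded_add)

lemma small_mult: "small D c f \<Longrightarrow> small D c g \<Longrightarrow> small D c (\<lambda>a. f a * g a)"
  unfolding small_def by (blast intro: ptime_nat_mult pbounded_mult)

lemma small_Suc: "small D c f \<Longrightarrow> small D c (\<lambda>a. Suc (f a))"
  using small_add[OF small_const[of D c 1], of f] by simp

lemma small_drop: "small D c f \<Longrightarrow> small D (\<lambda>a. VPair (c a) (g a)) f"
  unfolding small_def by (blast intro: ptime_drop pbounded_vpair)

lemma small_outer:
  assumes "small D c f"
  shows "small (idx D n) (idx_code c) (\<lambda>x. f (fst x))"
proof -
  have "pbounded (idx D n) (\<lambda>x. c (fst x)) (\<lambda>x. f (fst x))"
    using small_pbounded[OF assms] by (rule pbounded_reindex) simp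
  then show ?thesis
    unfolding small_def by (intro conjI ptime_outer small_ptime assms pbounded_vpair)
qed

lemma small_length:
  assumes "ptime D c (\<lambda>a. enc_list E (xs a))"
  shows "small D c (\<lambda>a. length (xs a))"
  unfolding small_def using ptime_length[OF assms] ptime_size[OF assms] length_le_vsize
  by (blast intro: pbounded_mono)

lemma ptime_conj:
  assumes "ptime D c (\<lambda>a. vbool (p a))" "ptime D c (\<lambda>a. vbool (q a))"
  shows "ptime D c (\<lambda>a. vbool (p a \<and> q a))"
proof -
  have "ptime D c (\<lambda>a. VInt ((if p a then 1 else 0) * (if q a then 1 else 0)))"
    using assms by (rule ptime_mult)
  then show ?thesis by (rule ptime_cong) simp
qed

lemma ptime_nat_le:
  "ptime D c (\<lambda>a. VInt (int (f a))) \<Longrightarrow> ptime D c (\<lambda>a. VInt (int (g a))) \<Longrightarrow>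
     ptime D c (\<lambda>a. vbool (f a \<le> g a))"
  using ptime_le[of D c "\<lambda>a. int (f a)" "\<lambda>a. int (g a)"] by simp

lemma ptime_nat_diff:
  assumes "ptime D c (\<lambda>a. VInt (int (f a)))" "ptime D c (\<lambda>a. VInt (int (g a)))"
  shows "ptime D c (\<lambda>a. VInt (int (f a - g a)))"
proof -
  have "ptime D c (\<lambda>a. VInt (if f a \<le> g a then 0 else int (f a) - int (g a)))"
    by (rule ptime_if_int[OF ptime_nat_le ptime_const ptime_diff]) (rule assms)+
  then show ?thesis by (rule ptime_cong) auto
qed

section \<open>Machine implementation of the dynamic program\<close>

definition enc_nats :: "nat list \<Rightarrow> val" where
  "enc_nats = enc_list (\<lambda>e. VInt (int e))"

definition enc_cell :: "int \<times> nat list \<Rightarrow> val" where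
  "enc_cell p = VPair (VInt (fst p)) (enc_nats (snd p))"

lemma vsize_enc_nats:
  assumes "distinct L" "set L \<subseteq> {..<m}"
  shows "vsize (enc_nats L) \<le> m * (m + 2) + 1"
proof -
  have "vsize (enc_nats L) \<le> length L * (m + 1 + 1) + 1"
    unfolding enc_nats_def
  proof (rule vsize_enc_list_le)
    fix e assume "e \<in> set L"
    then have "e < m" using assms by auto
    then show "vsize (VInt (int e)) \<le> m + 1" using vsize_int_le[of e] by simp
  qed
  also have "\<dots> \<le> m * (m + 2) + 1"
    using card_mono[OF _ assms(2)] distinct_card[OF assms(1)] mult_le_mono1[of "length L" m "m + 2"]
    by simp
  finally show ?thesis .
qed

text \<open>The outer loop runs over the items and keeps one row of the table as its state; the
  inner loop builds the next row from it. Rows stay short because sizes are at most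
  \<open>C a + 1\<close> and the stored lists are distinct lists of items.\<close>

lemma ptime_dp:
  assumes m: "small D c m" and K: "small D c K" and C: "ptime D c (\<lambda>a. VInt (C a))"
    and s: "ptime D c (\<lambda>a. enc_list VInt (map (s a) [0..<m a]))"
    and q: "ptime D c (\<lambda>a. enc_list (\<lambda>v. VInt (int v)) (map (q a) [0..<m a]))"
    and C0: "\<And>a. a \<in> D \<Longrightarrow> C a \<ge> 0" and s0: "\<And>a e. a \<in> D \<Longrightarrow> e < m a \<Longrightarrow> s a e \<ge> 0"
  shows "ptime D c (\<lambda>a. enc_list enc_cell (map (dp (C a) (s a) (q a) (m a)) [0..<Suc (K a)]))"
proof -
  define S where "S = (\<lambda>a i. enc_list enc_cell (map (dp (C a) (s a) (q a) i) [0..<Suc (K a)]))"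
  let ?M = "\<lambda>a. Suc (K a) * (1 + vsize (VInt (C a + 1)) + (m a * (m a + 2) + 1) + 1) + 1"
  have "ptime D c (\<lambda>a. S a (m a))"
  proof (rule ptime_natrec[OF small_ptime[OF m] small_pbounded[OF m]])
    show "pbounded D c ?M"
      by (intro pbounded_intros small_pbounded[OF m] small_pbounded[OF small_Suc[OF K]]
          ptime_size[OF ptime_add[OF C ptime_const]])
    show "vsize (S a i) \<le> ?M a" if a: "a \<in> D" "i \<le> m a" for a i
    proof -
      have "vsize (enc_cell (dp (C a) (s a) (q a) i v)) \<le> 1 + vsize (VInt (C a + 1)) + (m a * (m a + 2) + 1)" for v
      proof -
        have "0 \<le> fst (dp (C a) (s a) (q a) i v) \<and> fst (dp (C a) (s a) (q a) i v) \<le> C a + 1"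
          using C0[OF a(1)] s0[OF a(1)] a(2) by (intro dp_range) auto
        then have "vsize (VInt (fst (dp (C a) (s a) (q a) i v))) \<le> vsize (VInt (C a + 1))"
          by (intro vsize_VInt_mono) auto
        moreover have "vsize (enc_nats (snd (dp (C a) (s a) (q a) i v))) \<le> m a * (m a + 2) + 1"
          using dp_list[of "C a" "s a" "q a" i v] a(2) by (intro vsize_enc_nats) auto
        ultimately show ?thesis by (simp add: enc_cell_def del: vsize.simps(1))
      qed
      then have "vsize (S a i) \<le> length (map (dp (C a) (s a) (q a) i) [0..<Suc (K a)]) *
          (1 + vsize (VInt (C a + 1)) + (m a * (m a + 2) + 1) + 1) + 1"
        unfolding S_def by (intro vsize_enc_list_le) auto
      then show ?thesis by simp
    qed
    show "ptime D c (\<lambda>a. S a 0)"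
      unfolding S_def
    proof (rule ptime_vec[OF small_ptime[OF small_Suc[OF K]] small_pbounded[OF small_Suc[OF K]]])
      have "ptime (idx D (\<lambda>a. Suc (K a))) (idx_code c)
          (\<lambda>x. VPair (VInt (if snd x \<le> 0 then 0 else C (fst x) + 1)) (VInt 0))"
        by (rule ptime_pair[OF ptime_if_int[OF ptime_nat_le[OF ptime_counter ptime_const]
              ptime_const ptime_add[OF ptime_outer[OF C] ptime_const]] ptime_const])
      then show "ptime (idx D (\<lambda>a. Suc (K a))) (idx_code c)
          (\<lambda>x. enc_cell (dp (C (fst x)) (s (fst x)) (q (fst x)) 0 (snd x)))"
        by (rule ptime_cong) (simp add: enc_cell_def enc_nats_def)
    qed
    let ?c1 = "\<lambda>x. VPair (idx_code c x) (S (fst x) (snd x))"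
    let ?D1 = "idx D m"
    let ?K1 = "\<lambda>x. Suc (K (fst x))"
    let ?D2 = "idx ?D1 ?K1" and ?c2 = "idx_code ?c1"
    have K1: "small ?D1 ?c1 ?K1"
      by (rule small_drop[OF small_Suc[OF small_outer[OF K]]])
    have up: "ptime ?D2 ?c2 (\<lambda>y. f (fst (fst y)))" if "ptime D c f" for f
      by (rule ptime_outer[OF ptime_drop[OF ptime_outer[OF that]]])
    show "ptime ?D1 ?c1 (\<lambda>x. S (fst x) (Suc (snd x)))"
      unfolding S_def
    proof (rule ptime_vec[OF small_ptime[OF K1] small_pbounded[OF K1], unfolded S_def])
      define A where "A = (\<lambda>y :: ('a \<times> nat) \<times> nat.
        dp (C (fst (fst y))) (s (fst (fst y))) (q (fst (fst y))) (snd (fst y)) (snd y))"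
      \<comment> \<open>Subtraction on \<open>nat\<close> keeps the index inside the row even if
        \<open>q i\<close> exceeds the profit; the entry read in that case is rejected by
        \<open>cond\<close>.\<close>
      define B where "B = (\<lambda>y :: ('a \<times> nat) \<times> nat.
        dp (C (fst (fst y))) (s (fst (fst y))) (q (fst (fst y))) (snd (fst y))
          (snd y - q (fst (fst y)) (snd (fst y))))"
      have tbl: "ptime ?D2 ?c2 (\<lambda>y. enc_list enc_cell
          (map (dp (C (fst (fst y))) (s (fst (fst y))) (q (fst (fst y))) (snd (fst y))) [0..<?K1 (fst y)]))"
        unfolding S_def by (rule ptime_outer[OF ptime_code_snd])
      have i: "ptime ?D2 ?c2 (\<lambda>y. VInt (int (snd (fst y))))"
        by (rule ptime_outer[OF ptime_drop[OF ptime_counter]])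
      have v: "ptime ?D2 ?c2 (\<lambda>y. VInt (int (snd y)))"
        by (rule ptime_counter)
      have qi: "ptime ?D2 ?c2 (\<lambda>y. VInt (int (q (fst (fst y)) (snd (fst y)))))"
        by (rule ptime_vec_nth[OF up[OF q] i]) simp
      have si: "ptime ?D2 ?c2 (\<lambda>y. VInt (s (fst (fst y)) (snd (fst y))))"
        by (rule ptime_vec_nth[OF up[OF s] i]) simp
      have "ptime ?D2 ?c2 (\<lambda>y. enc_cell (A y))"
        unfolding A_def by (rule ptime_vec_nth[OF tbl v]) simp
      then have A: "ptime ?D2 ?c2 (\<lambda>y. VPair (VInt (fst (A y))) (enc_nats (snd (A y))))"
        by (simp only: enc_cell_def)
      have "ptime ?D2 ?c2 (\<lambda>y. enc_cell (B y))"
        unfolding B_def by (rule ptime_vec_nth[OF tbl ptime_nat_diff[OF v qi]]) auto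
      then have B: "ptime ?D2 ?c2 (\<lambda>y. VPair (VInt (fst (B y))) (enc_nats (snd (B y))))"
        by (simp only: enc_cell_def)
      have new: "ptime ?D2 ?c2 (\<lambda>y. VPair (VInt (fst (B y) + s (fst (fst y)) (snd (fst y))))
          (VPair (VInt (int (snd (fst y)))) (enc_nats (snd (B y)))))"
        by (rule ptime_pair[OF ptime_add[OF ptime_fst[OF B] si] ptime_pair[OF i ptime_snd[OF B]]])
      have cond: "ptime ?D2 ?c2 (\<lambda>y. vbool (q (fst (fst y)) (snd (fst y)) \<le> snd y \<and>
          fst (B y) + s (fst (fst y)) (snd (fst y)) < fst (A y)))"
        by (rule ptime_conj[OF ptime_nat_le[OF qi v]
              ptime_less[OF ptime_add[OF ptime_fst[OF B] si] ptime_fst[OF A]]])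
      have "ptime ?D2 ?c2 (\<lambda>y. if q (fst (fst y)) (snd (fst y)) \<le> snd y \<and>
          fst (B y) + s (fst (fst y)) (snd (fst y)) < fst (A y)
          then VPair (VInt (fst (B y) + s (fst (fst y)) (snd (fst y))))
            (VPair (VInt (int (snd (fst y)))) (enc_nats (snd (B y))))
          else VPair (VInt (fst (A y))) (enc_nats (snd (A y))))"
        by (rule ptime_if[OF cond ptime_subset[OF new] ptime_subset[OF A]]) auto
      then show "ptime ?D2 (idx_code (\<lambda>x. VPair (idx_code c x) (enc_list enc_cell
            (map (dp (C (fst x)) (s (fst x)) (q (fst x)) (snd x)) [0..<Suc (K (fst x))]))))
          (\<lambda>y. enc_cell (dp (C (fst (fst y))) (s (fst (fst y))) (q (fst (fst y))) (Suc (snd (fst y))) (snd y)))"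
        unfolding S_def
        by (rule ptime_cong) (simp add: A_def B_def enc_cell_def enc_nats_def)
    qed
  qed
  then show ?thesis by (simp only: S_def)
qed

lemma ptime_select:
  assumes K: "small D c K" and C: "ptime D c (\<lambda>a. VInt (C a))"
    and t: "ptime D c (\<lambda>a. enc_list enc_cell (map (t a) [0..<Suc (K a)]))"
  shows "ptime D c (\<lambda>a. enc_nats (select (C a) (t a) (K a)))"
proof (rule ptime_natrec[OF small_ptime[OF K] small_pbounded[OF K],
      where S = "\<lambda>a v. enc_nats (select (C a) (t a) v)"])
  have "ptime D c (\<lambda>a. enc_cell (t a 0))"
    by (rule ptime_vec_nth[OF t]) (simp_all add: ptime_const)
  then show "ptime D c (\<lambda>a. enc_nats (select (C a) (t a) 0))"
    unfolding enc_cell_def select.simps by (rule ptime_snd)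
  show "pbounded D c (\<lambda>a. vsize (enc_list enc_cell (map (t a) [0..<Suc (K a)])))"
    by (rule ptime_size[OF t])
  \<comment> \<open>The state of the search is always a list stored in the table, so the table
    itself bounds it.\<close>
  show "vsize (enc_nats (select (C a) (t a) v)) \<le> vsize (enc_list enc_cell (map (t a) [0..<Suc (K a)]))"
    if "v \<le> K a" for a v
  proof -
    obtain w where w: "w \<le> v" "select (C a) (t a) v = snd (t a w)"
      using select_is_snd[of v "C a" "t a"] by blast
    have "t a w \<in> set (map (t a) [0..<Suc (K a)])"
      unfolding set_map set_upt by (rule imageI) (use w(1) that in simp)
    from vsize_elem_le[OF this, of enc_cell] w(2) show ?thesis by (simp add: enc_cell_def)
  qed
  let ?c1 = "\<lambda>x. VPair (idx_code c x) (enc_nats (select (C (fst x)) (t (fst x)) (snd x)))"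
  have "ptime (idx D K) ?c1 (\<lambda>x. enc_cell (t (fst x) (Suc (snd x))))"
  proof (rule ptime_vec_nth[OF ptime_drop[OF ptime_outer[OF t]]])
    show "ptime (idx D K) ?c1 (\<lambda>x. VInt (int (Suc (snd x))))"
      using ptime_nat_add[OF ptime_drop[OF ptime_counter] ptime_const[of _ _ "VInt (int 1)"]] by simp
  qed simp
  then have cell: "ptime (idx D K) ?c1
      (\<lambda>x. VPair (VInt (fst (t (fst x) (Suc (snd x))))) (enc_nats (snd (t (fst x) (Suc (snd x))))))"
    by (simp only: enc_cell_def)
  have "ptime (idx D K) ?c1 (\<lambda>x. if fst (t (fst x) (Suc (snd x))) \<le> C (fst x)
      then enc_nats (snd (t (fst x) (Suc (snd x)))) else enc_nats (select (C (fst x)) (t (fst x)) (snd x)))"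
    by (rule ptime_if[OF ptime_le[OF ptime_fst[OF cell] ptime_drop[OF ptime_outer[OF C]]]
          ptime_subset[OF ptime_snd[OF cell]] ptime_subset[OF ptime_code_snd]]) auto
  then show "ptime (idx D K) ?c1 (\<lambda>x. enc_nats (select (C (fst x)) (t (fst x)) (Suc (snd x))))"
    by (rule ptime_cong) simp
qed

lemma ptime_knapsack_approx:
  assumes m: "small D c m" and K: "small D c K" and C: "ptime D c (\<lambda>a. VInt (C a))"
    and s: "ptime D c (\<lambda>a. enc_list VInt (map (s a) [0..<m a]))"
    and u: "ptime D c (\<lambda>a. enc_list VInt (map (u a) [0..<m a]))"
    and C0: "\<And>a. a \<in> D \<Longrightarrow> C a \<ge> 0" and s0: "\<And>a e. a \<in> D \<Longrightarrow> e < m a \<Longrightarrow> s a e \<ge> 0"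
    and u0: "\<And>a e. a \<in> D \<Longrightarrow> e < m a \<Longrightarrow> u a e \<ge> 0"
  shows "ptime D c (\<lambda>a. enc_nats (knapsack_approx (m a) (K a) (C a) (s a) (u a)))"
  unfolding knapsack_approx_def
proof (rule ptime_select[OF K C ptime_dp[OF m K C s _ C0 s0]])
  note m' = small_ptime[OF m] small_pbounded[OF m]
  have ue: "ptime (idx D m) (idx_code c) (\<lambda>x. VInt (u (fst x) (snd x)))"
    by (rule ptime_vec_nth[OF ptime_outer[OF u] ptime_counter]) simp
  have P: "ptime D c (\<lambda>a. VInt (\<Sum>j<m a. u a j))"
    by (rule ptime_sum[OF m' ue])
  have "ptime (idx D m) (idx_code c)
      (\<lambda>x. VInt (u (fst x) (snd x) * int (K (fst x)) div (\<Sum>j<m (fst x). u (fst x) j)))"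
    by (rule ptime_div[OF ptime_mult[OF ue ptime_outer[OF small_ptime[OF K]]] ptime_outer[OF P]])
  then have "ptime (idx D m) (idx_code c) (\<lambda>x. VInt (int (scaled_profit (m (fst x)) (K (fst x)) (u (fst x)) (snd x))))"
  proof (rule ptime_cong)
    fix x assume x: "x \<in> idx D m"
    then have "u (fst x) (snd x) * int (K (fst x)) div (\<Sum>j<m (fst x). u (fst x) j) \<ge> 0"
      using u0 by (intro div_int_pos_iff[THEN iffD2] disjI2 disjI1 conjI mult_nonneg_nonneg sum_nonneg) auto
    then show "VInt (u (fst x) (snd x) * int (K (fst x)) div (\<Sum>j<m (fst x). u (fst x) j)) =
        VInt (int (scaled_profit (m (fst x)) (K (fst x)) (u (fst x)) (snd x)))"
      by (simp add: scaled_profit_def)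
  qed
  then show "ptime D c (\<lambda>a. enc_list (\<lambda>v. VInt (int v)) (map (scaled_profit (m a) (K a) (u a)) [0..<m a]))"
    by (rule ptime_vec[OF m'])
qed


section \<open>Weight matrices, capping and best responses\<close>

abbreviation enc_vec :: "nat \<Rightarrow> (nat \<Rightarrow> int) \<Rightarrow> val" where
  "enc_vec m u \<equiv> enc_list VInt (map u [0..<m])"

abbreviation enc_mat :: "nat \<Rightarrow> nat \<Rightarrow> (nat \<Rightarrow> nat \<Rightarrow> int) \<Rightarrow> val" where
  "enc_mat n m W \<equiv> enc_list (enc_list VInt) (map (\<lambda>k. map (W k) [0..<m]) [0..<n])"

lemma ptime_mat:
  assumes n: "small D c n" and m: "small D c m"
    and W: "ptime (idx (idx D n) (\<lambda>x. m (fst x))) (idx_code (idx_code c))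
      (\<lambda>y. VInt (W (fst (fst y)) (snd (fst y)) (snd y)))"
  shows "ptime D c (\<lambda>a. enc_mat (n a) (m a) (W a))"
proof (rule ptime_vec[OF small_ptime[OF n] small_pbounded[OF n]])
  note m' = small_outer[OF m, of n]
  show "ptime (idx D n) (idx_code c) (\<lambda>x. enc_list VInt (map (W (fst x) (snd x)) [0..<m (fst x)]))"
    by (rule ptime_vec[OF small_ptime[OF m'] small_pbounded[OF m']], rule W)
qed

lemma ptime_mat_nth:
  assumes W: "ptime D c (\<lambda>a. enc_mat (n a) (m a) (W a))"
    and i: "ptime D c (\<lambda>a. VInt (int (i a)))" and j: "ptime D c (\<lambda>a. VInt (int (j a)))"
    and ij: "\<And>a. a \<in> D \<Longrightarrow> i a < n a" "\<And>a. a \<in> D \<Longrightarrow> j a < m a"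
  shows "ptime D c (\<lambda>a. VInt (W a (i a) (j a)))"
  by (rule ptime_vec_nth[OF ptime_vec_nth[OF W i ij(1)] j ij(2)])

lemma ptime_list_total:
  assumes u: "ptime D c (\<lambda>a. enc_vec (m a) (u a))" and L: "ptime D c (\<lambda>a. enc_nats (L a))"
    and Lm: "\<And>a. a \<in> D \<Longrightarrow> set (L a) \<subseteq> {..<m a}"
  shows "ptime D c (\<lambda>a. VInt (list_total (u a) (L a)))"
proof -
  note L' = L[unfolded enc_nats_def]
  note len = small_length[OF L']
  have "ptime (idx D (\<lambda>a. length (L a))) (idx_code c) (\<lambda>x. VInt (int (L (fst x) ! snd x)))"
    by (rule ptime_nth[OF ptime_outer[OF L'] ptime_counter]) simp
  then have "ptime (idx D (\<lambda>a. length (L a))) (idx_code c) (\<lambda>x. VInt (u (fst x) (L (fst x) ! snd x)))"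
    by (rule ptime_vec_nth[OF ptime_outer[OF u]]) (use Lm nth_mem in fastforce)
  then show ?thesis
    unfolding list_total_def by (rule ptime_sum[OF small_ptime[OF len] small_pbounded[OF len]])
qed

context
  fixes D :: "'a set" and c :: "'a \<Rightarrow> val" and n m :: "'a \<Rightarrow> nat" and W :: "'a \<Rightarrow> nat \<Rightarrow> nat \<Rightarrow> int"
  assumes n: "small D c n" and m: "small D c m"
    and W: "ptime D c (\<lambda>a. enc_mat (n a) (m a) (W a))"
    and n1: "\<And>a. a \<in> D \<Longrightarrow> n a \<ge> 1"
begin

lemma ptime_min_total: "ptime D c (\<lambda>a. VInt (min_total (n a) (m a) (W a)))"
  unfolding min_total_def
proof (rule ptime_Min[OF small_ptime[OF n] small_pbounded[OF n] n1])
  note m' = small_outer[OF m, of n]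
  show "ptime (idx D n) (idx_code c) (\<lambda>x. VInt (\<Sum>e<m (fst x). W (fst x) (snd x) e))"
    by (rule ptime_sum[OF small_ptime[OF m'] small_pbounded[OF m']],
        rule ptime_mat_nth[OF ptime_outer[OF ptime_outer[OF W]] ptime_outer[OF ptime_counter] ptime_counter])
       auto
qed

lemma ptime_cap: "ptime D c (\<lambda>a. VInt (cap (n a) (m a) h (W a)))"
  unfolding cap_def
  by (rule ptime_mult[OF ptime_mult[OF small_ptime[OF n] ptime_const] ptime_min_total])

lemma ptime_capped: "ptime D c (\<lambda>a. enc_mat (n a) (m a) (capped (n a) (m a) h (W a)))"
  unfolding capped_def
  by (rule ptime_mat[OF n m], rule ptime_min[OF ptime_mat_nth[OF ptime_outer[OF ptime_outer[OF W]]
          ptime_outer[OF ptime_counter] ptime_counter] ptime_outer[OF ptime_outer[OF ptime_cap]]])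
     auto

lemma ptime_combined_profit:
  assumes lam: "ptime D c (\<lambda>a. enc_vec (n a) (lam a))"
  shows "ptime D c (\<lambda>a. enc_vec (m a) (combined_profit (n a) (m a) h (W a) (lam a)))"
proof (rule ptime_vec[OF small_ptime[OF m] small_pbounded[OF m]])
  note n' = small_outer[OF n, of m]
  show "ptime (idx D m) (idx_code c)
      (\<lambda>x. VInt (combined_profit (n (fst x)) (m (fst x)) h (W (fst x)) (lam (fst x)) (snd x)))"
    unfolding combined_profit_def
    by (rule ptime_sum[OF small_ptime[OF n'] small_pbounded[OF n']],
        rule ptime_mult[OF ptime_vec_nth[OF ptime_outer[OF ptime_outer[OF lam]] ptime_counter]
          ptime_mat_nth[OF ptime_outer[OF ptime_outer[OF ptime_capped]] ptime_counter
            ptime_outer[OF ptime_counter]]])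
       auto
qed

lemma ptime_best_response:
  assumes C: "ptime D c (\<lambda>a. VInt (C a))" and s: "ptime D c (\<lambda>a. enc_vec (m a) (s a))"
    and lam: "ptime D c (\<lambda>a. enc_vec (n a) (lam a))"
    and valid: "\<And>a. a \<in> D \<Longrightarrow> robust_knapsack (n a) (m a) h (C a) (s a) (W a)"
    and lam0: "\<And>a k. a \<in> D \<Longrightarrow> k < n a \<Longrightarrow> lam a k \<ge> 0"
  shows "ptime D c (\<lambda>a. enc_nats (best_response (n a) (m a) h (C a) (s a) (W a) (lam a)))"
  unfolding best_response_def
proof (rule ptime_knapsack_approx[OF m _ C s ptime_combined_profit[OF lam]])
  show "small D c (\<lambda>a. m a * m a * h)"
    by (intro small_mult m small_const)
  show "C a \<ge> 0" if "a \<in> D" for a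
    using robust_knapsack.C[OF valid[OF that]] .
  show "s a e \<ge> 0" if "a \<in> D" "e < m a" for a e
    using robust_knapsack.s[OF valid[OF that(1)] that(2)] .
  show "combined_profit (n a) (m a) h (W a) (lam a) e \<ge> 0" if "a \<in> D" "e < m a" for a e
    using robust_knapsack.combined_profit_nonneg[OF valid[OF that(1)] lam0[OF that(1)] that(2)] .
qed

end

text \<open>The loop state consists of the weight vector and the output produced so far. New entries
  are put in front, whence the reversed order. By \<open>weight_prod\<close> a weight is a product
  of at most \<open>T\<close> factors between 0 and \<open>M\<close>, so its bit length is
  polynomial although its value is not.\<close>

lemma ptime_play:
  assumes n: "small D c n" and m: "small D c m"
    and W: "ptime D c (\<lambda>a. enc_mat (n a) (m a) (W a))"
    and C: "ptime D c (\<lambda>a. VInt (C a))" and s: "ptime D c (\<lambda>a. enc_vec (m a) (s a))"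
    and valid: "\<And>a. a \<in> D \<Longrightarrow> robust_knapsack (n a) (m a) h (C a) (s a) (W a)"
    and T: "small D c T"
  shows "ptime D c (\<lambda>a. enc_list enc_entry
    (map (\<lambda>t. (play (n a) (m a) h (C a) (s a) (W a) t, 1, int (T a))) (rev [0..<T a])))"
proof -
  define lam where "lam = (\<lambda>a. weight (n a) (m a) h (C a) (s a) (W a))"
  define X where "X = (\<lambda>a t. play (n a) (m a) h (C a) (s a) (W a) t)"
  define out where "out = (\<lambda>a t. enc_list enc_entry (map (\<lambda>t. (X a t, 1, int (T a))) (rev [0..<t])))"
  define S where "S = (\<lambda>a t. VPair (enc_vec (n a) (lam a t)) (out a t))"
  define M where "M = (\<lambda>a. int h * int (m a) * cap (n a) (m a) h (W a))"
  have n1: "n a \<ge> 1" if "a \<in> D" for a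
    using robust_knapsack.n[OF valid[OF that]] .
  have M: "ptime D c (\<lambda>a. VInt (M a))"
    unfolding M_def
    by (rule ptime_mult[OF ptime_mult[OF ptime_const small_ptime[OF m]] ptime_cap[OF n m W n1]])
  have entry: "enc_entry (X a t, 1, int (T a)) = VPair (enc_nats (X a t)) (VPair (VInt 1) (VInt (int (T a))))" for a t
    by (simp add: enc_entry_def enc_nats_def)
  have X: "distinct (X a t)" "set (X a t) \<subseteq> {..<m a}" for a t
    unfolding X_def using best_response_list by auto
  let ?B1 = "\<lambda>a. n a * (T a * vsize (VInt (M a)) + 2 + 1) + 1"
  let ?B2 = "\<lambda>a. T a * (1 + (m a * (m a + 2) + 1) + (1 + vsize (VInt 1) + vsize (VInt (int (T a)))) + 1) + 1"
  have "ptime D c (\<lambda>a. S a (T a))"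
  proof (rule ptime_natrec[OF small_ptime[OF T] small_pbounded[OF T]])
    show "pbounded D c (\<lambda>a. 1 + ?B1 a + ?B2 a)"
      by (intro pbounded_intros small_pbounded[OF n] small_pbounded[OF m] small_pbounded[OF T]
          ptime_size[OF M] ptime_size[OF small_ptime[OF T]])
    show "vsize (S a t) \<le> 1 + ?B1 a + ?B2 a" if a: "a \<in> D" "t \<le> T a" for a t
    proof -
      interpret robust_knapsack "n a" "m a" h "C a" "s a" "W a" by (rule valid[OF a(1)])
      have "vsize (enc_vec (n a) (lam a t)) \<le> length (map (lam a t) [0..<n a]) * (T a * vsize (VInt (M a)) + 2 + 1) + 1"
      proof (rule vsize_enc_list_le)
        fix x assume "x \<in> set (map (lam a t) [0..<n a])"
        then obtain k where k: "k < n a" "x = lam a t k" by auto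
        show "vsize (VInt x) \<le> T a * vsize (VInt (M a)) + 2"
          unfolding k(2) lam_def
        proof (subst weight_prod, rule vsize_prod_le[OF _ a(2)])
          fix i
          show "vsize (VInt (int h * int (m a) * cap (n a) (m a) h (W a) -
              list_total (capped (n a) (m a) h (W a) k) (play (n a) (m a) h (C a) (s a) (W a) i)))
              \<le> vsize (VInt (M a))"
            using factor_bounds[OF k(1), of "weight (n a) (m a) h (C a) (s a) (W a) i"]
            unfolding M_def by (intro vsize_VInt_mono) simp
        qed
      qed
      then have 1: "vsize (enc_vec (n a) (lam a t)) \<le> ?B1 a" by (simp only: length_map length_upt diff_zero)
      have "vsize (out a t) \<le> length (map (\<lambda>t. (X a t, 1 :: int, int (T a))) (rev [0..<t])) *
          (1 + (m a * (m a + 2) + 1) + (1 + vsize (VInt 1) + vsize (VInt (int (T a)))) + 1) + 1"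
        unfolding out_def
      proof (rule vsize_enc_list_le)
        fix x assume "x \<in> set (map (\<lambda>t. (X a t, 1 :: int, int (T a))) (rev [0..<t]))"
        then obtain t where x: "x = (X a t, 1, int (T a))" by auto
        show "vsize (enc_entry x) \<le> 1 + (m a * (m a + 2) + 1) + (1 + vsize (VInt 1) + vsize (VInt (int (T a))))"
          unfolding x entry using vsize_enc_nats[OF X, of a t] by simp
      qed
      also have "\<dots> \<le> ?B2 a"
        using a(2) by (intro add_mono mult_right_mono) auto
      finally show ?thesis using 1 by (simp add: S_def del: vsize.simps(1))
    qed
    have "ptime D c (\<lambda>a. enc_vec (n a) (lam a 0))"
      unfolding lam_def weight.simps
      by (rule ptime_vec[OF small_ptime[OF n] small_pbounded[OF n] ptime_const])
    then show "ptime D c (\<lambda>a. S a 0)"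
      unfolding S_def out_def by (rule ptime_pair) (simp add: ptime_const)
    let ?D1 = "idx D T"
    let ?c1 = "\<lambda>x. VPair (idx_code c x) (S (fst x) (snd x))"
    let ?n1 = "\<lambda>x. n (fst x)"
    have up: "ptime ?D1 ?c1 (\<lambda>x. f (fst x))" if "ptime D c f" for f
      by (rule ptime_drop[OF ptime_outer[OF that]])
    have sup: "small ?D1 ?c1 (\<lambda>x. f (fst x))" if "small D c f" for f
      by (rule small_drop[OF small_outer[OF that]])
    have state: "ptime ?D1 ?c1 (\<lambda>x. VPair (enc_vec (n (fst x)) (lam (fst x) (snd x))) (out (fst x) (snd x)))"
      using ptime_code_snd[of ?D1 "idx_code c" "\<lambda>x. S (fst x) (snd x)"] unfolding S_def .
    have valid1: "robust_knapsack (n (fst x)) (m (fst x)) h (C (fst x)) (s (fst x)) (W (fst x))"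
      if "x \<in> ?D1" for x using valid that by simp
    have resp: "ptime ?D1 ?c1 (\<lambda>x. enc_nats (X (fst x) (snd x)))"
      unfolding X_def lam_def[symmetric]
      by (rule ptime_best_response[OF sup[OF n] sup[OF m] up[OF W] _ up[OF C] up[OF s]
            ptime_fst[OF state] valid1, unfolded lam_def, folded lam_def])
         (use n1 robust_knapsack.weight_nonneg[OF valid1] in \<open>auto simp: lam_def\<close>)
    have cap: "ptime ?D1 ?c1 (\<lambda>x. enc_mat (n (fst x)) (m (fst x)) (capped (n (fst x)) (m (fst x)) h (W (fst x))))"
      by (rule up[OF ptime_capped[OF n m W n1]])
    have new: "ptime ?D1 ?c1 (\<lambda>x. enc_vec (n (fst x)) (lam (fst x) (Suc (snd x))))"
    proof (rule ptime_vec[OF small_ptime[OF sup[OF n]] small_pbounded[OF sup[OF n]]])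
      let ?D2 = "idx ?D1 ?n1" and ?c2 = "idx_code ?c1"
      have "ptime ?D2 ?c2 (\<lambda>y. enc_vec (m (fst (fst y)))
          (capped (n (fst (fst y))) (m (fst (fst y))) h (W (fst (fst y))) (snd y)))"
        by (rule ptime_vec_nth[OF ptime_outer[OF cap] ptime_counter]) simp
      then have "ptime ?D2 ?c2 (\<lambda>y. VInt (list_total
          (capped (n (fst (fst y))) (m (fst (fst y))) h (W (fst (fst y))) (snd y))
          (X (fst (fst y)) (snd (fst y)))))"
        by (rule ptime_list_total[OF _ ptime_outer[OF resp]]) (rule X)
      from ptime_mult[OF ptime_vec_nth[OF ptime_outer[OF ptime_fst[OF state]] ptime_counter]
          ptime_diff[OF ptime_outer[OF up[OF M]] this]]
      show "ptime ?D2 ?c2 (\<lambda>y. VInt (lam (fst (fst y)) (Suc (snd (fst y))) (snd y)))"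
        unfolding lam_def X_def M_def by simp
    qed
    have "ptime ?D1 ?c1 (\<lambda>x. VPair (enc_vec (n (fst x)) (lam (fst x) (Suc (snd x))))
        (VPair (VPair (enc_nats (X (fst x) (snd x))) (VPair (VInt 1) (VInt (int (T (fst x))))))
          (out (fst x) (snd x))))"
      by (rule ptime_pair[OF new ptime_pair[OF ptime_pair[OF resp ptime_pair[OF ptime_const
              up[OF small_ptime[OF T]]]] ptime_snd[OF state]]])
    then show "ptime ?D1 ?c1 (\<lambda>x. S (fst x) (Suc (snd x)))"
      by (rule ptime_cong) (simp add: S_def out_def entry)
  qed
  then show ?thesis
    unfolding S_def out_def X_def by (rule ptime_snd)
qed


section \<open>Scaling to integers\<close>

abbreviation num :: "rat \<Rightarrow> int" where "num r \<equiv> fst (quotient_of r)"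
abbreviation den :: "rat \<Rightarrow> int" where "den r \<equiv> snd (quotient_of r)"

definition to_int :: "int \<Rightarrow> rat \<Rightarrow> int" where
  "to_int d r = num r * d div den r"

lemma den_pos: "den r > 0"
  by (rule quotient_of_denom_pos')

lemma of_int_to_int:
  assumes "den r dvd d"
  shows "rat_of_int (to_int d r) = r * of_int d"
proof -
  obtain k where k: "d = den r * k" using assms by blast
  have "r = of_int (num r) / of_int (den r)"
    using quotient_of_div[of r "num r" "den r"] by simp
  then have "r * of_int (den r) = of_int (num r)"
    using den_pos[of r] by (simp add: field_simps)
  moreover have "to_int d r = num r * k"
    using den_pos[of r] unfolding to_int_def k by simp
  ultimately show ?thesis by (simp add: k)
qed

text \<open>The plain product of all denominators, not their least common multiple: its bit length
  is already polynomial and it is computed by multiplications alone.\<close>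

definition common_den :: "nat \<Rightarrow> nat \<Rightarrow> (nat \<Rightarrow> rat) \<Rightarrow> rat \<Rightarrow> (nat \<Rightarrow> nat \<Rightarrow> rat) \<Rightarrow> int" where
  "common_den m n s C w = den C * (\<Prod>e<m. den (s e)) * (\<Prod>k<n. \<Prod>e<m. den (w k e))"

lemma common_den_pos: "common_den m n s C w > 0"
  unfolding common_den_def by (intro mult_pos_pos prod_pos ballI den_pos)

lemma den_dvd_common_den:
  "den C dvd common_den m n s C w"
  "e < m \<Longrightarrow> den (s e) dvd common_den m n s C w"
  "k < n \<Longrightarrow> e < m \<Longrightarrow> den (w k e) dvd common_den m n s C w"
proof -
  show "den C dvd common_den m n s C w"
    unfolding common_den_def by (simp add: mult.assoc)
  show "den (s e) dvd common_den m n s C w" if "e < m"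
    unfolding common_den_def
    using dvd_prodI[of "{..<m}" e "\<lambda>e. den (s e)"] that by (simp add: dvd_mult dvd_mult2)
  show "den (w k e) dvd common_den m n s C w" if "k < n" "e < m"
    unfolding common_den_def
    using dvd_trans[OF dvd_prodI[of "{..<m}" e "\<lambda>e. den (w k e)"]
        dvd_prodI[of "{..<n}" k "\<lambda>k. \<Prod>e<m. den (w k e)"]] that
    by (simp add: dvd_mult)
qed

definition int_capacity where
  "int_capacity m n s C w = to_int (common_den m n s C w) C"

definition int_size where
  "int_size m n s C w e = to_int (common_den m n s C w) (s e)"

text \<open>Oversized items keep their index but lose their weight. They occur in no feasible set,
  and the modification secures the assumption \<open>small\<close> of
  \<open>robust_knapsack\<close>.\<close>

definition int_weight where
  "int_weight m n s C w k e =
     (if int_size m n s C w e \<le> int_capacity m n s C w then to_int (common_den m n s C w) (w k e) else 0)"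

lemma of_int_capacity: "rat_of_int (int_capacity m n s C w) = C * of_int (common_den m n s C w)"
  unfolding int_capacity_def by (intro of_int_to_int den_dvd_common_den)

lemma of_int_size:
  "e < m \<Longrightarrow> rat_of_int (int_size m n s C w e) = s e * of_int (common_den m n s C w)"
  unfolding int_size_def by (intro of_int_to_int den_dvd_common_den)

lemma sum_int_size_le_iff:
  assumes "X \<subseteq> {..<m}"
  shows "sum (int_size m n s C w) X \<le> int_capacity m n s C w \<longleftrightarrow> sum s X \<le> C"
proof -
  let ?d = "rat_of_int (common_den m n s C w)"
  have "sum (int_size m n s C w) X \<le> int_capacity m n s C w \<longleftrightarrow>
      rat_of_int (sum (int_size m n s C w) X) \<le> rat_of_int (int_capacity m n s C w)"
    by (simp only: of_int_le_iff)
  also have "rat_of_int (sum (int_size m n s C w) X) = sum s X * ?d"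
    using assms by (simp add: sum_distrib_right) (intro sum.cong, auto simp: of_int_size)
  also have "sum s X * ?d \<le> rat_of_int (int_capacity m n s C w) \<longleftrightarrow> sum s X \<le> C"
    unfolding of_int_capacity using common_den_pos[of m n s C w] by simp
  finally show ?thesis .
qed

lemma knapsack_int:
  "knapsack m s C = {X. X \<subseteq> {..<m} \<and> sum (int_size m n s C w) X \<le> int_capacity m n s C w}"
  unfolding knapsack_def using sum_int_size_le_iff by blast

lemma int_size_le_iff:
  "e < m \<Longrightarrow> int_size m n s C w e \<le> int_capacity m n s C w \<longleftrightarrow> s e \<le> C"
  using sum_int_size_le_iff[of "{e}" m n s C w] by simp

lemma of_int_weight:
  assumes "k < n" "e < m" "s e \<le> C"
  shows "rat_of_int (int_weight m n s C w k e) = w k e * of_int (common_den m n s C w)"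
  using assms unfolding int_weight_def by (simp add: int_size_le_iff of_int_to_int den_dvd_common_den)

lemma robust_knapsack_int:
  assumes "valid_instance m n s C w" "h \<ge> 2"
  shows "robust_knapsack n m h (int_capacity m n s C w) (int_size m n s C w) (int_weight m n s C w)"
proof
  note [simp] = common_den_pos[of m n s C w]
  have v: "n \<ge> 1" "C \<ge> 0" "\<And>e. e < m \<Longrightarrow> s e \<ge> 0" "\<And>k e. k < n \<Longrightarrow> e < m \<Longrightarrow> w k e \<ge> 0"
    using assms(1) by (auto simp: valid_instance_def)
  show "1 \<le> n" "2 \<le> h" by fact+
  have "0 \<le> rat_of_int (int_capacity m n s C w)"
    unfolding of_int_capacity using v(2) by (simp add: less_imp_le)
  then show "0 \<le> int_capacity m n s C w" by simp
  show "0 \<le> int_size m n s C w e" if "e < m" for e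
  proof -
    have "0 \<le> rat_of_int (int_size m n s C w e)"
      unfolding of_int_size[OF that] using v(3)[OF that] by (simp add: less_imp_le)
    then show ?thesis by simp
  qed
  show "0 \<le> int_weight m n s C w k e" if "k < n" "e < m" for k e
  proof (cases "s e \<le> C")
    case True
    have "0 \<le> rat_of_int (int_weight m n s C w k e)"
      unfolding of_int_weight[of k n e m s C w, OF that True] using v(4)[OF that] by (simp add: less_imp_le)
    then show ?thesis by simp
  next
    case False
    then show ?thesis using that by (simp add: int_weight_def int_size_le_iff)
  qed
  show "int_size m n s C w e \<le> int_capacity m n s C w" if "0 < int_weight m n s C w k e" for k e
    using that by (simp add: int_weight_def split: if_splits)
qed

text \<open>As sizes are nonnegative, each item of a feasible set fits alone, so none of the weights
  involved has been set to 0.\<close>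

lemma linear_fun_int:
  assumes "valid_instance m n s C w" "k < n" "X \<in> knapsack m s C"
  shows "linear_fun (w k) X * of_int (common_den m n s C w) = of_int (\<Sum>e\<in>X. int_weight m n s C w k e)"
proof -
  have X: "X \<subseteq> {..<m}" "finite X" "sum s X \<le> C"
    using assms(3) finite_subset by (auto simp: knapsack_def)
  have "real_of_rat (w k e) * of_int (common_den m n s C w) = of_int (int_weight m n s C w k e)"
    if e: "e \<in> X" for e
  proof -
    have "s e \<le> sum s X"
      using assms(1) X e by (intro member_le_sum) (auto simp: valid_instance_def)
    then have "s e \<le> C" using X(3) by simp
    then have "real_of_rat (rat_of_int (int_weight m n s C w k e)) =
        real_of_rat (w k e * of_int (common_den m n s C w))"
      using assms(2) X(1) e by (subst of_int_weight[of k n e m s C w]) auto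
    then show ?thesis by (simp add: of_rat_mult)
  qed
  then show ?thesis by (simp add: linear_fun_def sum_distrib_right)
qed


section \<open>The approximation scheme\<close>

text \<open>A program starts at function 0, whereas \<open>f\<close> may sit at any index; a stub
  calling it is put in front and everything else moves up by one.\<close>

lemma ptime_runs:
  assumes "ptime D c f"
  shows "\<exists>P q. \<forall>a\<in>D. \<exists>t. runs P (c a) (f a) t \<and> t \<le> poly q (vsize (c a))"
proof -
  obtain P i b where P: "computes P i D c f b" using assms by (auto simp: ptime_def)
  obtain q :: "nat poly" where q: "\<forall>a\<in>D. b a \<le> poly q (vsize (c a))"
    using P by (auto simp: computes_def pbounded_def)
  let ?e = "Call (Suc i) [Var 0]"
  define Q where "Q = [?e] @ map (reloc 1) P"
  have Q: "computes Q (Suc i) D c f b"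
    using computes_append2[OF P, of "[?e]"] by (simp add: Q_def)
  \<comment> \<open>Two nested calls, of the entry point and of \<open>f\<close>, each add the input
    size and double the cost, which yields 3 times the input size plus 4 times the bound.\<close>
  have "\<exists>t. runs Q (c a) (f a) t \<and> t \<le> poly ([:0, 3:] + [:4:] * q) (vsize (c a))" if a: "a \<in> D" for a
  proof -
    obtain t where t: "t \<le> vsize (c a) + 2 * b a" "eval Q [c a] ?e (f a) t"
      using eval_callD[OF Q a eval_Var0] by blast
    then have t2: "eval Q [c a] (Q ! 0) (f a) t" by (simp add: Q_def)
    obtain t' where t': "t' \<le> vsize (c a) + 2 * t" "eval Q [c a] (Call 0 [Var 0]) (f a) t'"
      using eval_call1[OF eval_Var0 t2] by (auto simp: Q_def)
    have "t' \<le> poly ([:0, 3:] + [:4:] * q) (vsize (c a))"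
      using t(1) t'(1) q a by fastforce
    with t'(2) show ?thesis unfolding runs_def by blast
  qed
  then show ?thesis by blast
qed

type_synonym inst = "nat \<times> nat \<times> (nat \<Rightarrow> rat) \<times> rat \<times> (nat \<Rightarrow> nat \<Rightarrow> rat)"

lemma enc_rat_eq: "enc_rat r = VPair (VInt (num r)) (VInt (den r))"
  by (cases "quotient_of r") (simp add: enc_rat_def)

lemma ptime_to_int:
  assumes "ptime D c (\<lambda>a. VInt (d a))" "ptime D c (\<lambda>a. enc_rat (r a))"
  shows "ptime D c (\<lambda>a. VInt (to_int (d a) (r a)))"
  unfolding to_int_def
  by (rule ptime_div[OF ptime_mult[OF ptime_fst assms(1)] ptime_snd]; (rule assms(2)[unfolded enc_rat_eq]))

lemma ptime_int_data:
  fixes n m :: "'a \<Rightarrow> nat" and s :: "'a \<Rightarrow> nat \<Rightarrow> rat" and C :: "'a \<Rightarrow> rat" and w :: "'a \<Rightarrow> nat \<Rightarrow> nat \<Rightarrow> rat"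
  assumes n: "small D c n" and m: "small D c m"
    and C: "ptime D c (\<lambda>a. enc_rat (C a))"
    and s: "ptime D c (\<lambda>a. enc_list enc_rat (map (s a) [0..<m a]))"
    and w: "ptime D c (\<lambda>a. enc_list (enc_list enc_rat) (map (\<lambda>k. map (w a k) [0..<m a]) [0..<n a]))"
  shows "ptime D c (\<lambda>a. VInt (int_capacity (m a) (n a) (s a) (C a) (w a)))"
    and "ptime D c (\<lambda>a. enc_vec (m a) (int_size (m a) (n a) (s a) (C a) (w a)))"
    and "ptime D c (\<lambda>a. enc_mat (n a) (m a) (int_weight (m a) (n a) (s a) (C a) (w a)))"
proof -
  note m' = small_ptime[OF m] small_pbounded[OF m] and n' = small_ptime[OF n] small_pbounded[OF n]
  note mn = small_outer[OF m, of n]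
  have se: "ptime (idx D m) (idx_code c) (\<lambda>x. enc_rat (s (fst x) (snd x)))"
    by (rule ptime_vec_nth[OF ptime_outer[OF s] ptime_counter]) simp
  let ?D2 = "idx (idx D n) (\<lambda>x. m (fst x))" and ?c2 = "idx_code (idx_code c)"
  have "ptime ?D2 ?c2 (\<lambda>y. enc_list enc_rat (map (w (fst (fst y)) (snd (fst y))) [0..<m (fst (fst y))]))"
    by (rule ptime_vec_nth[OF ptime_outer[OF ptime_outer[OF w]] ptime_outer[OF ptime_counter]]) simp
  then have we: "ptime ?D2 ?c2 (\<lambda>y. enc_rat (w (fst (fst y)) (snd (fst y)) (snd y)))"
    by (rule ptime_vec_nth[OF _ ptime_counter]) simp
  have d: "ptime D c (\<lambda>a. VInt (common_den (m a) (n a) (s a) (C a) (w a)))"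
    unfolding common_den_def
  proof (rule ptime_mult[OF ptime_mult])
    show "ptime D c (\<lambda>a. VInt (den (C a)))"
      by (rule ptime_snd, rule C[unfolded enc_rat_eq])
    show "ptime D c (\<lambda>a. VInt (\<Prod>e<m a. den (s a e)))"
      by (rule ptime_prod[OF m'], rule ptime_snd, rule se[unfolded enc_rat_eq])
    show "ptime D c (\<lambda>a. VInt (\<Prod>k<n a. \<Prod>e<m a. den (w a k e)))"
      by (rule ptime_prod[OF n'], rule ptime_prod[OF small_ptime[OF mn] small_pbounded[OF mn]],
          rule ptime_snd, rule we[unfolded enc_rat_eq])
  qed
  show C': "ptime D c (\<lambda>a. VInt (int_capacity (m a) (n a) (s a) (C a) (w a)))"
    unfolding int_capacity_def by (rule ptime_to_int[OF d C])
  show s': "ptime D c (\<lambda>a. enc_vec (m a) (int_size (m a) (n a) (s a) (C a) (w a)))"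
    by (rule ptime_vec[OF m'], unfold int_size_def, rule ptime_to_int[OF ptime_outer[OF d] se])
  show "ptime D c (\<lambda>a. enc_mat (n a) (m a) (int_weight (m a) (n a) (s a) (C a) (w a)))"
  proof (rule ptime_mat[OF n m])
    have e: "ptime ?D2 ?c2 (\<lambda>y. VInt (int_size (m (fst (fst y))) (n (fst (fst y))) (s (fst (fst y)))
        (C (fst (fst y))) (w (fst (fst y))) (snd y)))"
      by (rule ptime_vec_nth[OF ptime_outer[OF ptime_outer[OF s']] ptime_counter]) simp
    show "ptime ?D2 ?c2 (\<lambda>y. VInt (int_weight (m (fst (fst y))) (n (fst (fst y))) (s (fst (fst y)))
        (C (fst (fst y))) (w (fst (fst y))) (snd (fst y)) (snd y)))"
      unfolding int_weight_def
      by (rule ptime_if_int[OF ptime_le[OF e ptime_outer[OF ptime_outer[OF C']]]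
            ptime_to_int[OF ptime_outer[OF ptime_outer[OF d]] we] ptime_const])
  qed
qed

section \<open>The scheme on rational instances\<close>

definition scheme ::
  "nat \<Rightarrow> nat \<Rightarrow> nat \<Rightarrow> (nat \<Rightarrow> rat) \<Rightarrow> rat \<Rightarrow> (nat \<Rightarrow> nat \<Rightarrow> rat) \<Rightarrow> nat \<Rightarrow> nat list" where
  "scheme h m n s C w = play n m h (int_capacity m n s C w) (int_size m n s C w) (int_weight m n s C w)"

text \<open>The encoding does not mention m and n; they are recovered as the lengths of the lists of
  sizes and of objectives, and being lengths they are polynomial in value. As \<open>h\<close> is a
  constant, it enters only the polynomial and the program.\<close>

lemma ptime_scheme:
  assumes h: "h \<ge> 2"
  shows "ptime {(m, n, s, C, w). valid_instance m n s C w} (\<lambda>(m, n, s, C, w). enc_instance m n s C w)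
    (\<lambda>(m, n, s, C, w). enc_list enc_entry
      (map (\<lambda>t. (scheme h m n s C w t, 1, int (rounds n m h))) (rev [0..<rounds n m h])))"
proof -
  define M where "M = (\<lambda>a :: inst. fst a)"
  define N where "N = (\<lambda>a :: inst. fst (snd a))"
  define S where "S = (\<lambda>a :: inst. fst (snd (snd a)))"
  define C where "C = (\<lambda>a :: inst. fst (snd (snd (snd a))))"
  define W where "W = (\<lambda>a :: inst. snd (snd (snd (snd a))))"
  define D where "D = {a. valid_instance (M a) (N a) (S a) (C a) (W a)}"
  define c where "c = (\<lambda>a. enc_instance (M a) (N a) (S a) (C a) (W a))"
  have c: "ptime D c (\<lambda>a. VPair (enc_rat (C a)) (VPair (enc_list enc_rat (map (S a) [0..<M a]))
     (enc_list (enc_list enc_rat) (map (\<lambda>k. map (W a k) [0..<M a]) [0..<N a]))))"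
    using ptime_self[of D c] by (simp only: c_def enc_instance_def)
  note cC = ptime_fst[OF c] and cS = ptime_fst[OF ptime_snd[OF c]] and cW = ptime_snd[OF ptime_snd[OF c]]
  have m: "small D c M" using small_length[OF cS] by simp
  have n: "small D c N" using small_length[OF cW] by simp
  note data = ptime_int_data[OF n m cC cS cW]
  have "ptime D c (\<lambda>a. enc_list enc_entry
      (map (\<lambda>t. (scheme h (M a) (N a) (S a) (C a) (W a) t, 1, int (rounds (N a) (M a) h)))
        (rev [0..<rounds (N a) (M a) h])))"
    unfolding scheme_def
  proof (rule ptime_play[OF n m data(3,1,2)])
    show "small D c (\<lambda>a. rounds (N a) (M a) h)"
      unfolding rounds_def by (intro small_add small_mult small_const m n)
    show "robust_knapsack (N a) (M a) h (int_capacity (M a) (N a) (S a) (C a) (W a))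
        (int_size (M a) (N a) (S a) (C a) (W a)) (int_weight (M a) (N a) (S a) (C a) (W a))" if "a \<in> D" for a
      using that h unfolding D_def by (intro robust_knapsack_int) auto
  qed
  then show ?thesis
    unfolding D_def c_def M_def N_def S_def C_def W_def by (simp add: case_prod_unfold)
qed

text \<open>Different rounds may produce the same set. The output keeps one entry of mass 1 / T per
  round, and \<open>represents\<close> adds up the masses of equal sets; expectations thus become
  averages over the rounds.\<close>

lemma uniform_plays:
  fixes X :: "nat \<Rightarrow> nat list" and T :: nat
  assumes T: "T > 0"
  defines "p \<equiv> map_pmf (\<lambda>t. set (X t)) (pmf_of_set {..<T})"
  shows "set_pmf p = (\<lambda>t. set (X t)) ` {..<T}"
    and "represents (enc_list enc_entry (map (\<lambda>t. (X t, 1, int T)) (rev [0..<T]))) p"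
    and "finite I \<Longrightarrow> (\<And>t. t < T \<Longrightarrow> set (X t) \<in> I) \<Longrightarrow>
      (\<Sum>Y\<in>I. pmf p Y * g Y) = (\<Sum>t<T. g (set (X t))) / T"
proof -
  have ne: "{..<T} \<noteq> {}" using T by (simp add: lessThan_empty_iff)
  show "set_pmf p = (\<lambda>t. set (X t)) ` {..<T}"
    using ne by (simp add: p_def)
  have pmf: "pmf p Y = (\<Sum>t<T. if set (X t) = Y then 1 / real T else 0)" for Y
  proof -
    have "pmf p Y = card ({..<T} \<inter> {t. set (X t) = Y}) / real T"
      using ne by (simp add: p_def pmf_map measure_pmf_of_set vimage_def)
    also have "\<dots> = (\<Sum>t\<in>{..<T} \<inter> {t. set (X t) = Y}. 1 / real T)" by simp
    also have "\<dots> = (\<Sum>t<T. if set (X t) = Y then 1 / real T else 0)"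
      by (subst sum.inter_restrict) auto
    finally show ?thesis .
  qed
  show "represents (enc_list enc_entry (map (\<lambda>t. (X t, 1, int T)) (rev [0..<T]))) p"
    unfolding represents_def
  proof (intro exI[of _ "map (\<lambda>t. (X t, 1 :: int, int T)) (rev [0..<T])"] conjI allI)
    fix Y
    show "pmf p Y = (\<Sum>(L, a, b)\<leftarrow>map (\<lambda>t. (X t, 1, int T)) (rev [0..<T]).
        if set L = Y then real_of_int a / real_of_int b else 0)"
      unfolding pmf by (simp add: comp_def rev_map[symmetric] sum_list_rev sum_list_distinct_conv_sum_set atLeast0LessThan
          cong: if_cong)
  qed (use T in auto)
  show "(\<Sum>Y\<in>I. pmf p Y * g Y) = (\<Sum>t<T. g (set (X t))) / T"
    if I: "finite I" "\<And>t. t < T \<Longrightarrow> set (X t) \<in> I"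
  proof -
    have "(\<Sum>Y\<in>I. pmf p Y * g Y) = (\<Sum>Y\<in>I. \<Sum>t<T. if set (X t) = Y then g Y / T else 0)"
      unfolding pmf sum_distrib_right by (intro sum.cong) auto
    also have "\<dots> = (\<Sum>t<T. \<Sum>Y\<in>I. if set (X t) = Y then g Y / T else 0)" by (rule sum.swap)
    also have "\<dots> = (\<Sum>t<T. g (set (X t)) / T)"
      using I by (intro sum.cong) auto
    finally show ?thesis by (simp add: sum_divide_distrib)
  qed
qed

text \<open>\<open>play_approx\<close> is applied to an optimal distribution \<open>p0\<close>,
  whose value is multiplied by the common denominator \<open>d\<close> to match the integer weights;
  afterwards \<open>d\<close> cancels.\<close>

lemma robust_value_scheme:
  fixes m n :: nat and s :: "nat \<Rightarrow> rat" and C :: rat and w :: "nat \<Rightarrow> nat \<Rightarrow> rat"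
  assumes valid: "valid_instance m n s C w" and h: "h \<ge> 2" and T: "T = rounds n m h"
  defines "I \<equiv> knapsack m s C"
    and "p \<equiv> map_pmf (\<lambda>t. set (scheme h m n s C w t)) (pmf_of_set {..<T})"
  shows "p \<in> distributions I" and "robust_opt n w I \<ge> 0"
    and "robust_value n w I p \<ge> (1 - 5 / h) * robust_opt n w I"
proof -
  define d where "d = real_of_int (common_den m n s C w)"
  have d: "d > 0" using common_den_pos[of m n s C w] by (simp add: d_def)
  define opt where "opt = robust_opt n w I"
  interpret robust_knapsack n m h "int_capacity m n s C w" "int_size m n s C w" "int_weight m n s C w"
    by (rule robust_knapsack_int[OF valid h])
  have T0: "T > 0" by (simp add: T rounds_def)
  have I: "finite I" "I \<noteq> {}"
    using knapsack_nonempty[of C m s] valid by (auto simp: I_def valid_instance_def)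
  have play_I: "set (scheme h m n s C w t) \<in> I" for t
    unfolding I_def knapsack_int[of m s C n w] scheme_def
    using best_response_list best_response_feasible by blast
  show "p \<in> distributions I"
    unfolding distributions_def p_def using uniform_plays(1)[OF T0] play_I by auto
  have lin: "linear_fun (w k) X * d = real_of_int (\<Sum>e\<in>X. int_weight m n s C w k e)"
    if "k < n" "X \<in> I" for k X
    using linear_fun_int[OF valid that(1)] that(2) by (simp add: I_def d_def)
  have lin0: "linear_fun (w k) X \<ge> 0" if "k < n" "X \<in> I" for k X
    using valid that unfolding linear_fun_def I_def knapsack_def valid_instance_def
    by (intro sum_nonneg) auto
  obtain p0 where p0: "p0 \<in> distributions I" "robust_value n w I p0 = opt"
    using robust_opt_attained[OF I n] unfolding opt_def by blast
  have opt_le: "opt \<le> (\<Sum>X\<in>I. pmf p0 X * linear_fun (w k) X)" if "k < n" for k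
    using that unfolding p0(2)[symmetric] robust_value_def by (intro Min_le) auto
  show opt0: "robust_opt n w I \<ge> 0"
    unfolding opt_def[symmetric] p0(2)[symmetric] robust_value_def
    using n lin0 by (subst Min_ge_iff) (auto simp: lessThan_empty_iff intro!: sum_nonneg mult_nonneg_nonneg)
  have "(1 - 5 / h) * opt \<le> (\<Sum>X\<in>I. pmf p X * linear_fun (w k) X)" if k: "k < n" for k
  proof -
    have "(1 - 5 / h) * (opt * d) * T \<le>
      (\<Sum>t<T. real_of_int (\<Sum>e\<in>set (scheme h m n s C w t). int_weight m n s C w k e))"
      unfolding T scheme_def
    proof (rule play_approx[OF _ _ _ _ k, folded knapsack_int[of m s C n w] I_def])
      show "0 \<le> pmf p0 X" for X by simp
      show "sum (pmf p0) I = 1"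
        using p0(1) I(1) by (intro sum_pmf_eq_1) (auto simp: distributions_def)
      show "0 \<le> opt * d" using opt0 d by (simp add: opt_def)
      fix k assume k: "k < n"
      have "opt * d \<le> (\<Sum>X\<in>I. pmf p0 X * linear_fun (w k) X) * d"
        using opt_le[OF k] d by (intro mult_right_mono) auto
      also have "\<dots> = (\<Sum>X\<in>I. pmf p0 X * (linear_fun (w k) X * d))"
        by (simp add: sum_distrib_right mult.assoc)
      also have "\<dots> = (\<Sum>X\<in>I. pmf p0 X * real_of_int (\<Sum>e\<in>X. int_weight m n s C w k e))"
        using lin[OF k] by (intro sum.cong) auto
      finally show "opt * d \<le> (\<Sum>X\<in>I. pmf p0 X * real_of_int (\<Sum>e\<in>X. int_weight m n s C w k e))" .
    qed
    also have "\<dots> = (\<Sum>t<T. linear_fun (w k) (set (scheme h m n s C w t)) * d)"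
      using lin[OF k play_I] by simp
    also have "\<dots> = (\<Sum>t<T. linear_fun (w k) (set (scheme h m n s C w t))) * d"
      by (simp only: sum_distrib_right)
    finally have "(1 - 5 / h) * opt * T * d \<le> (\<Sum>t<T. linear_fun (w k) (set (scheme h m n s C w t))) * d"
      by (simp only: mult_ac)
    then have "(1 - 5 / h) * opt * T \<le> (\<Sum>t<T. linear_fun (w k) (set (scheme h m n s C w t)))"
      using d by simp
    then have "(1 - 5 / h) * opt \<le> (\<Sum>t<T. linear_fun (w k) (set (scheme h m n s C w t))) / T"
      using T0 by (simp add: pos_le_divide_eq)
    also have "\<dots> = (\<Sum>X\<in>I. pmf p X * linear_fun (w k) X)"
      unfolding p_def by (rule uniform_plays(3)[OF T0 I(1) play_I, symmetric])
    finally show ?thesis .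
  qed
  then show "robust_value n w I p \<ge> (1 - 5 / h) * robust_opt n w I"
    unfolding robust_value_def opt_def[symmetric]
    using n by (subst Min_ge_iff) (auto simp: lessThan_empty_iff)
qed

theorem mainTheorem3:
  fixes \<epsilon> :: real
  assumes "\<epsilon> > 0"
  shows "\<exists>(P :: program) (q :: nat poly).
    \<forall>(m :: nat) (n :: nat) (s :: nat \<Rightarrow> rat) (C :: rat) (w :: nat \<Rightarrow> nat \<Rightarrow> rat).
      valid_instance m n s C w \<longrightarrow>
      (\<exists>y t. runs P (enc_instance m n s C w) y t \<and>
         t \<le> poly q (vsize (enc_instance m n s C w)) \<and>
         (\<exists>p\<in>distributions (knapsack m s C). represents y p \<and>
            robust_value n w (knapsack m s C) p
              \<ge> (1 - \<epsilon>) * robust_opt n w (knapsack m s C)))"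
proof -
  \<comment> \<open>Rounding up gives 5 / h <= \<epsilon>, and the summand 2 secures
    \<open>h >= 2\<close> for every \<epsilon>.\<close>
  define h where "h = nat \<lceil>5 / \<epsilon>\<rceil> + 2"
  have h: "h \<ge> 2" by (simp add: h_def)
  have "5 / \<epsilon> \<le> h" unfolding h_def by linarith
  then have h\<epsilon>: "5 / h \<le> \<epsilon>" using assms h by (simp add: field_simps)
  obtain P q where P: "\<forall>a\<in>{(m, n, s, C, w). valid_instance m n s C w}. \<exists>t.
      runs P ((\<lambda>(m, n, s, C, w). enc_instance m n s C w) a)
        ((\<lambda>(m, n, s, C, w). enc_list enc_entry
          (map (\<lambda>t. (scheme h m n s C w t, 1, int (rounds n m h))) (rev [0..<rounds n m h]))) a) t \<and>
      t \<le> poly q (vsize ((\<lambda>(m, n, s, C, w). enc_instance m n s C w) a))"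
    using ptime_runs[OF ptime_scheme[OF h]] by blast
  show ?thesis
  proof (intro exI[of _ P] exI[of _ q] allI impI)
    fix m n :: nat and s :: "nat \<Rightarrow> rat" and C :: rat and w :: "nat \<Rightarrow> nat \<Rightarrow> rat"
    assume valid: "valid_instance m n s C w"
    define T where "T = rounds n m h"
    let ?I = "knapsack m s C"
    let ?y = "enc_list enc_entry (map (\<lambda>t. (scheme h m n s C w t, 1, int T)) (rev [0..<T]))"
    let ?p = "map_pmf (\<lambda>t. set (scheme h m n s C w t)) (pmf_of_set {..<T})"
    obtain t where t: "runs P (enc_instance m n s C w) ?y t" "t \<le> poly q (vsize (enc_instance m n s C w))"
      using P[rule_format, of "(m, n, s, C, w)"] valid unfolding T_def by auto
    note val = robust_value_scheme[OF valid h T_def]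
    have "(1 - \<epsilon>) * robust_opt n w ?I \<le> (1 - 5 / h) * robust_opt n w ?I"
      using h\<epsilon> val(2) by (intro mult_right_mono) auto
    also note val(3)
    finally have "(1 - \<epsilon>) * robust_opt n w ?I \<le> robust_value n w ?I ?p" .
    moreover have "represents ?y ?p"
      by (rule uniform_plays(2)) (simp add: T_def rounds_def)
    ultimately show "\<exists>y t. runs P (enc_instance m n s C w) y t \<and>
         t \<le> poly q (vsize (enc_instance m n s C w)) \<and>
         (\<exists>p\<in>distributions ?I. represents y p \<and> robust_value n w ?I p \<ge> (1 - \<epsilon>) * robust_opt n w ?I)"
      using t val(1) by blast
  qed
qed

end
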